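(* Let $n\ge1$, let $\lambda,\mu,\nu,\rho$ be partitions of length $n$, let $\kappa$ be a partition of length $2n$, and let $k$ be an integer with $1\le|k|\le n$. Then $$c_{\lambda/\mu,\nu/\rho}^{\kappa}=\big|k\text{-}\mathrm{SkewHive}_{\lambda/\mu,\nu/\rho}^{\kappa}\big|.$$
   Context: A partition of length $m$ is a weakly decreasing sequence of $m$ nonnegative integers. $c_{\lambda/\mu,\nu/\rho}^\kappa$ is the coefficient of $s_\kappa$ in the product $s_{\lambda/\mu}s_{\nu/\rho}$ of skew Schur functions ($s_{\lambda/\mu}=0$ if $\mu\not\subseteq\lambda$). $\Delta_{2n}=\{(i,j)\in\mathbb{Z}_{\ge0}^2:i+j\le 2n\}$. Phased paths. For $1\le k\le n$ let $P_k$ be the word $W^k(NW)^{n-k}N^k$ and $P_{-k}$ the word $N^k(WN)^{n-k}W^k$; each has $2n$ letters, $n$ of them $N$ and $n$ of them $W$ (viewed as a lattice path from $(n,0)$ to $(0,n)$ with steps $N=(0,1)$, $W=(-1,0)$). Let $\mathrm{ht}_P(i)$ be (number of $N$'s) minus (number of $W$'s) among the first $i$ letters of $P$. Shuffling. For $\alpha,\beta\in\mathbb{Z}^n$ and $1\le|k|\le n$, $\alpha\circledast_k\beta\in\mathbb{Z}^{2n}$ is the sequence having $\alpha_i$ in the position of the $i$th $W$ of $P_k$ and $\beta_i$ in the position of the $i$th $N$ of $P_k$; e.g. for $k>0$ it is $(\alpha_1,\ldots,\alpha_k,\beta_1,\alpha_{k+1},\beta_2,\ldots,\alpha_n,\beta_{n-k+1},\ldots,\beta_n)$.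 Phased skew hives. Let $\mathrm{Ht}_{P_k}(i,j)=\mathrm{ht}_{P_k}(2n-i-j)$ for $(i,j)\in\Delta_{2n}$. A unit triangle is a set of three points $\{w\pm(1,0,0),w\pm(0,1,0),w\pm(0,0,1)\}$ with $w\in\mathbb{Z}^3$ and some choice of signs (an equilateral triangle with side $\sqrt2$). A unit rhombus is the union of two coplanar unit triangles sharing an edge; the shared edge $\{x',y'\}$ is its short diagonal and the other two vertices $\{x,y\}$ its long diagonal. A $k$-phased skew hive is a function $h:\Delta_{2n}\to\mathbb{Z}$ such that, viewing $h$ as a function on the set $\{(i,j,\mathrm{Ht}_{P_k}(i,j)):(i,j)\in\Delta_{2n}\}\subset\mathbb{Z}^3$, one has $h(x')+h(y')\ge h(x)+h(y)$ for every unit rhombus all of whose vertices lie in that set. Define $h^{\uparrow}=(h_{0,1}-h_{0,0},\ldots,h_{0,2n}-h_{0,2n-1})$, $h^{\rightarrow}=(h_{1,0}-h_{0,0},\ldots,h_{2n,0}-h_{2n-1,0})$, $h^{\nwarrow}=(h_{2n-1,1}-h_{2n,0},\,h_{2n-2,2}-h_{2n-1,1},\ldots,h_{0,2n}-h_{1,2n-1})$. Then $k\text{-}\mathrm{SkewHive}_{\lambda/\mu,\nu/\rho}^{\kappa}$ is the set of $k$-phased skew hives with $h_{0,0}=0$, $h^\uparrow=\lambda\circledast_k\nu$, $h^\rightarrow=\mu\circledast_k\rho$ and $h^\nwarrow=\kappa$. *)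

theory Defs
  imports
    "HOL-Analysis.Analysis"
    "HOL-Library.Multiset"
    "HOL-Library.More_List"
    "HOL-Library.FuncSet"
    "HOL-Library.Function_Algebras"
begin

definition is_partition :: "nat \<Rightarrow> nat list \<Rightarrow> bool" where
  "is_partition m la \<longleftrightarrow> length la = m \<and> sorted_wrt (\<ge>) la"

text \<open>A row index beyond the end of the list denotes an empty row, so trailing zeros are immaterial.\<close>

definition part_le :: "nat list \<Rightarrow> nat list \<Rightarrow> bool" where
  "part_le mu la \<longleftrightarrow> (\<forall>i. nth_default 0 mu i \<le> nth_default 0 la i)"

definition cells :: "nat list \<Rightarrow> nat list \<Rightarrow> (nat \<times> nat) set" where
  "cells la mu = {(i, j). nth_default 0 mu i \<le> j \<and> j < nth_default 0 la i}"

definition ssyt :: "nat list \<Rightarrow> nat list \<Rightarrow> (nat \<times> nat \<Rightarrow> nat) set" where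
  "ssyt la mu = {T \<in> extensional (cells la mu).
     (\<forall>i j j'. (i, j) \<in> cells la mu \<and> (i, j') \<in> cells la mu \<and> j < j' \<longrightarrow> T (i, j) \<le> T (i, j')) \<and>
     (\<forall>i i' j. (i, j) \<in> cells la mu \<and> (i', j) \<in> cells la mu \<and> i < i' \<longrightarrow> T (i, j) < T (i', j))}"

text \<open>
  A formal power series over the integers in the variables x_0, x_1, x_2, ... is a function
  assigning a coefficient to every monomial; a monomial is the finite multiset of the indices of
  its variables. The sum is pointwise, but the product is the following convolution, not the
  pointwise product of functions.
\<close>

type_synonym series = "nat multiset \<Rightarrow> int"

definition series_mult :: "series \<Rightarrow> series \<Rightarrow> series" where
  "series_mult f g M = (\<Sum>A | A \<subseteq># M. f A * g (M - A))"

definition skew_schur :: "nat list \<Rightarrow> nat list \<Rightarrow> series" where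
  "skew_schur la mu M =
     (if part_le mu la
      then int (card {T \<in> ssyt la mu. image_mset T (mset_set (cells la mu)) = M})
      else 0)"

definition schur :: "nat list \<Rightarrow> series" where
  "schur la = skew_schur la []"

definition series_scale :: "int \<Rightarrow> series \<Rightarrow> series" where
  "series_scale c f = (\<lambda>M. c * f M)"

global_interpretation series: module series_scale
  by standard (simp_all add: series_scale_def fun_eq_iff algebra_simps)

text \<open>
  The coefficient of a Schur function in the expansion with respect to the set of all Schur
  functions. Partitions that differ by trailing zeros have the same Schur function, hence give the
  same element of the basis.
\<close>

definition schur_basis :: "series set" where
  "schur_basis = {schur la | la m. is_partition m la}"

definition schur_coeff :: "series \<Rightarrow> nat list \<Rightarrow> int" where
  "schur_coeff f ka = series.representation schur_basis f (schur ka)"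

datatype step = North | West

definition phased_path :: "nat \<Rightarrow> int \<Rightarrow> step list" where
  "phased_path n k = (let m = nat \<bar>k\<bar> in
     if 0 < k
     then replicate m West @ concat (replicate (n - m) [North, West]) @ replicate m North
     else replicate m North @ concat (replicate (n - m) [West, North]) @ replicate m West)"

definition height :: "step list \<Rightarrow> nat \<Rightarrow> int" where
  "height P i = int (count_list (take i P) North) - int (count_list (take i P) West)"

definition shuffle :: "nat \<Rightarrow> int \<Rightarrow> int list \<Rightarrow> int list \<Rightarrow> int list" where
  "shuffle n k a b = (let P = phased_path n k in
     map (\<lambda>p. (if P ! p = West then a else b) ! count_list (take p P) (P ! p)) [0..<2 * n])"

definition Delta :: "nat \<Rightarrow> (nat \<times> nat) set" where
  "Delta N = {(i, j). i + j \<le> N}"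

definition lift :: "nat \<Rightarrow> int \<Rightarrow> nat \<times> nat \<Rightarrow> int \<times> int \<times> int" where
  "lift n k = (\<lambda>(i, j). (int i, int j, height (phased_path n k) (2 * n - i - j)))"

text \<open>The three signs are chosen independently.\<close>

definition unit_triangle :: "(int \<times> int \<times> int) set \<Rightarrow> bool" where
  "unit_triangle S \<longleftrightarrow> (\<exists>w. \<exists>a \<in> {1, -1}. \<exists>b \<in> {1, -1}. \<exists>c \<in> {1, -1}.
     S = {w + (a, 0, 0), w + (0, b, 0), w + (0, 0, c)})"

definition real_point :: "int \<times> int \<times> int \<Rightarrow> real \<times> real \<times> real" where
  "real_point = (\<lambda>(x, y, z). (of_int x, of_int y, of_int z))"

text \<open>The long diagonal is x, y and the short diagonal is x', y'.\<close>

definition unit_rhombus ::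
  "int \<times> int \<times> int \<Rightarrow> int \<times> int \<times> int \<Rightarrow> int \<times> int \<times> int \<Rightarrow> int \<times> int \<times> int \<Rightarrow> bool" where
  "unit_rhombus x y x' y' \<longleftrightarrow>
     unit_triangle {x, x', y'} \<and> unit_triangle {y, x', y'} \<and> x \<noteq> y \<and>
     coplanar (real_point ` {x, y, x', y'})"

text \<open>Hives are made extensional so that distinct elements differ on the domain.\<close>

definition phased_skew_hive :: "nat \<Rightarrow> int \<Rightarrow> (nat \<times> nat \<Rightarrow> int) \<Rightarrow> bool" where
  "phased_skew_hive n k h \<longleftrightarrow> h \<in> extensional (Delta (2 * n)) \<and>
     (\<forall>x \<in> Delta (2 * n). \<forall>y \<in> Delta (2 * n). \<forall>x' \<in> Delta (2 * n). \<forall>y' \<in> Delta (2 * n).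
        unit_rhombus (lift n k x) (lift n k y) (lift n k x') (lift n k y') \<longrightarrow>
        h x' + h y' \<ge> h x + h y)"

definition border_up :: "nat \<Rightarrow> (nat \<times> nat \<Rightarrow> int) \<Rightarrow> int list" where
  "border_up n h = map (\<lambda>t. h (0, t + 1) - h (0, t)) [0..<2 * n]"

definition border_right :: "nat \<Rightarrow> (nat \<times> nat \<Rightarrow> int) \<Rightarrow> int list" where
  "border_right n h = map (\<lambda>t. h (t + 1, 0) - h (t, 0)) [0..<2 * n]"

definition border_nw :: "nat \<Rightarrow> (nat \<times> nat \<Rightarrow> int) \<Rightarrow> int list" where
  "border_nw n h = map (\<lambda>t. h (2 * n - (t + 1), t + 1) - h (2 * n - t, t)) [0..<2 * n]"

definition skew_hives ::
  "nat \<Rightarrow> int \<Rightarrow> nat list \<Rightarrow> nat list \<Rightarrow> nat list \<Rightarrow> nat list \<Rightarrow> nat list \<Rightarrow> (nat \<times> nat \<Rightarrow> int) set"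
  where
  "skew_hives n k la mu nu rh ka = {h. phased_skew_hive n k h \<and> h (0, 0) = 0 \<and>
     border_up n h = shuffle n k (map int la) (map int nu) \<and>
     border_right n h = shuffle n k (map int mu) (map int rh) \<and>
     border_nw n h = map int ka}"

end

theory Submission
  imports Defs
begin

text \<open>
  Level \<open>t\<close> of a hive consists of the points \<open>(i, j)\<close> with \<open>i + j = t\<close>. Along level \<open>t\<close> the hive has
  \<open>t\<close> successive differences; call this row \<open>a t\<close>. The rhombi that lie between two neighbouring levels
  say exactly that \<open>a t\<close> and \<open>a (t + 1)\<close> interlace. Hence a hive is a Gelfand--Tsetlin pattern of
  shape \<open>ka\<close>, and the two other borders prescribe its content: the strip from level \<open>t\<close> to \<open>t + 1\<close>
  belongs to a row of \<open>la/mu\<close> or of \<open>nu/rh\<close>, according to letter \<open>t\<close> of the path, and its size is the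
  length of this row. The other rhombi compare the strips of two consecutive rows of the same skew
  shape. If these strips are adjacent, one gets the classical lattice word condition relative to
  \<open>mu\<close> or \<open>rh\<close> (\<open>ballot\<close>). If a strip of the other shape separates them, one gets a longer list of
  inequalities (\<open>spread_ballot\<close>).

  The spread condition is the ballot condition in disguise: a Bender--Knuth toggle of either of the
  two inner rows turns one into the other (\<open>spread_ballot_iff_toggle_last\<close>,
  \<open>spread_ballot_iff_toggle_first\<close>). In terms of the hive, a toggle is a step of the octahedron
  recurrence, and it flips a corner of the path. The path \<open>P_(k+1)\<close> becomes \<open>P_k\<close> by flipping
  corners at every other level of its zigzag, so the number of hives is the same for all \<open>k > 0\<close>
  (\<open>card_phased_patterns\<close>), and it suffices to treat \<open>k = n\<close>, where the path is
  \<open>W\<^sup>n N\<^sup>n\<close> and only ballot conditions occur. Negative \<open>k\<close> reflects all heights, which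
  interchanges \<open>la/mu\<close> and \<open>nu/rh\<close>.

  For \<open>k = n\<close> the count comes from the growth diagram form of the Robinson--Schensted--Knuth
  correspondence. Pair a pattern \<open>a\<close> of shape \<open>ka\<close> with a semistandard tableau of shape \<open>ka\<close> and
  remove the last letter of the tableau. The local rule shrinks all rows of \<open>a\<close> and emits a column
  \<open>A\<close> of integers, and the ballot condition with offset \<open>d\<close> splits into \<open>A (t + 1) \<le> d\<close> and a ballot
  condition with offset \<open>d + A t - A (t + 1)\<close> (\<open>ballot_grow\<close>). In other words, the inner shape
  \<open>mu\<close>, \<open>rh\<close> grows by the horizontal strip \<open>A\<close>. After all letters are used up, the emitted strips form
  a pair of semistandard tableaux of shapes \<open>la/mu\<close> and \<open>nu/rh\<close>, with the alphabet reversed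
  (\<open>ballot_patterns_count\<close>). Reversing the alphabet does not change the number of tableaux, again by
  toggles (\<open>chain_count_rev\<close>). So the product of the two skew Schur functions is the sum over \<open>ka\<close> of
  the number of patterns times the Schur function of \<open>ka\<close>. By dominance, Schur functions are linearly
  independent (\<open>independent_schur_basis\<close>), hence these numbers are the coefficients.
\<close>

section \<open>Interlacing sequences, ballot conditions and toggles\<close>


definition interlaces :: "(nat \<Rightarrow> int) \<Rightarrow> (nat \<Rightarrow> int) \<Rightarrow> bool" where
  "interlaces x y \<longleftrightarrow> (\<forall>s. y (Suc s) \<le> x s \<and> x s \<le> y s)"

text \<open>
  Regard \<open>y/x\<close> and \<open>z/y\<close> as the horizontal strips of two letters \<open>p\<close> and \<open>q\<close> of a tableau whose rows are
  indexed by \<open>s\<close>, and \<open>d\<close> as the difference of parts \<open>p\<close> and \<open>q\<close> of a partition. Read the tableau from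
  the top row down, every row from right to left, and add a box to part \<open>p\<close> or \<open>q\<close> for every such
  letter. The condition says that part \<open>q\<close> never exceeds part \<open>p\<close>.
\<close>

definition ballot :: "int \<Rightarrow> (nat \<Rightarrow> int) \<Rightarrow> (nat \<Rightarrow> int) \<Rightarrow> (nat \<Rightarrow> int) \<Rightarrow> bool" where
  "ballot d x y z \<longleftrightarrow> (\<forall>j. (\<Sum>s\<le>j. z s - y s) \<le> d + (\<Sum>s<j. y s - x s))"

text \<open>
  The relation between the strips \<open>y/x\<close> and \<open>w/z\<close> that unit rhombi impose when a strip \<open>z/y\<close> of the other
  shape lies between them. Its two families come from the two kinds of rhombi that cross three strips.
  The second one starts a row later because \<open>x\<close> has no entry above row 0.
\<close>

definition spread_ballot ::
  "int \<Rightarrow> (nat \<Rightarrow> int) \<Rightarrow> (nat \<Rightarrow> int) \<Rightarrow> (nat \<Rightarrow> int) \<Rightarrow> (nat \<Rightarrow> int) \<Rightarrow> bool" where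
  "spread_ballot d x y z w \<longleftrightarrow>
     (\<forall>j. (\<Sum>s\<le>j. w s - z s) \<le> d + (\<Sum>s<j. y s - x s)) \<and>
     (\<forall>j. (\<Sum>s\<le>Suc j. w s - z s) \<le> d + (\<Sum>s\<le>j. y s - x s) + x j - z (Suc j))"

lemma all_nat_split: "(\<forall>j. P j) \<longleftrightarrow> P 0 \<and> (\<forall>j. P (Suc j))"
  by (metis not0_implies_Suc)

text \<open>
  The Bender--Knuth involution: between \<open>x\<close> and \<open>z\<close>, the entry \<open>y s\<close> ranges over an interval that does not
  depend on the other entries of \<open>y\<close>, and the toggle reflects this interval. In row 0 only \<open>z\<close> bounds it
  from above.
\<close>

definition toggle :: "(nat \<Rightarrow> int) \<Rightarrow> (nat \<Rightarrow> int) \<Rightarrow> (nat \<Rightarrow> int) \<Rightarrow> nat \<Rightarrow> int" where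
  "toggle x z y = (\<lambda>s. min (z s) (if s = 0 then z 0 else x (s - 1)) + max (z (Suc s)) (x s) - y s)"

lemma sum_atMost_eq_lessThan: "(\<Sum>s\<le>j. f s) = (\<Sum>s<j. f s) + (f j :: int)" for j :: nat
  by (simp add: lessThan_Suc_atMost[symmetric])

text \<open>
  The upper bound in row \<open>s + 1\<close> and the lower bound in row \<open>s\<close> are the minimum and the maximum of the
  same two numbers, so their sum is linear. Hence just one maximum, that of the last row, survives in a
  partial sum.
\<close>

lemma toggle_sum:
  "(\<Sum>s\<le>j. toggle x z y s) =
     (\<Sum>s\<le>j. z s) - (\<Sum>s\<le>j. y s) + (\<Sum>s<j. x s) + max (z (Suc j)) (x j)"
  by (induction j) (auto simp: toggle_def)

lemma toggle_toggle: "toggle x z (toggle x z y) = y"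
  by (rule ext) (simp add: toggle_def)

lemma interlaces_toggle:
  assumes "interlaces x y" "interlaces y z"
  shows "interlaces x (toggle x z y)" "interlaces (toggle x z y) z"
proof -
  have le: "y s \<le> min (z s) (if s = 0 then z 0 else x (s - 1))" for s
    using assms by (cases s) (auto simp: interlaces_def)
  have ge: "max (z (Suc s)) (x s) \<le> y s" for s
    using assms by (auto simp: interlaces_def)
  have a: "max (z (Suc s)) (x s) \<le> toggle x z y s" for s
    using le[of s] unfolding toggle_def by linarith
  have b: "toggle x z y s \<le> min (z s) (if s = 0 then z 0 else x (s - 1))" for s
    using ge[of s] unfolding toggle_def by linarith
  show "interlaces x (toggle x z y)" unfolding interlaces_def
    using a b[of "Suc _"] by simp
  show "interlaces (toggle x z y) z" unfolding interlaces_def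
  proof (intro allI conjI)
    fix s
    show "z (Suc s) \<le> toggle x z y s" using a[of s] by simp
    show "toggle x z y s \<le> z s" using b[of s] by linarith
  qed
qed

text \<open>
  After toggling, row \<open>j\<close> of the ballot condition bounds a maximum of two terms, by \<open>toggle_sum\<close>. Bounding
  the two terms separately gives the two families of the spread condition.
\<close>

lemma spread_ballot_iff_toggle_last:
  "spread_ballot d x y z w \<longleftrightarrow> ballot d x y (toggle y w z)"
proof -
  have "(\<Sum>s\<le>j. toggle y w z s - y s) \<le> d + (\<Sum>s<j. y s - x s) \<longleftrightarrow>
    (\<Sum>s\<le>j. w s - z s) \<le> d + (\<Sum>s<j. y s - x s) \<and>
    (\<Sum>s\<le>Suc j. w s - z s) \<le> d + (\<Sum>s\<le>j. y s - x s) + x j - z (Suc j)" for j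
    using toggle_sum[of y w z j]
    by (simp add: sum_subtractf sum_atMost_eq_lessThan) linarith
  then show ?thesis unfolding spread_ballot_def ballot_def by blast
qed

text \<open>
  Here the surviving maximum is subtracted on the other side, and it belongs to row \<open>j - 1\<close>. This accounts
  for the special role of row 0.
\<close>

lemma spread_ballot_iff_toggle_first:
  "spread_ballot d x y z w \<longleftrightarrow> ballot d (toggle x z y) z w"
proof -
  let ?P = "\<lambda>j. (\<Sum>s\<le>j. w s - z s) \<le> d + (\<Sum>s<j. z s - toggle x z y s)"
  let ?A = "\<lambda>j. (\<Sum>s\<le>j. w s - z s) \<le> d + (\<Sum>s<j. y s - x s)"
  let ?B = "\<lambda>j. (\<Sum>s\<le>Suc j. w s - z s) \<le> d + (\<Sum>s\<le>j. y s - x s) + x j - z (Suc j)"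
  have 0: "?P 0 \<longleftrightarrow> ?A 0" by simp
  have 1: "?P (Suc j) \<longleftrightarrow> ?A (Suc j) \<and> ?B j" for j
    using toggle_sum[of x z y j]
    by (simp add: sum_subtractf sum_atMost_eq_lessThan) linarith
  show ?thesis unfolding spread_ballot_def ballot_def using all_nat_split[of ?P] all_nat_split[of ?A] 0 1 by simp blast
qed

text \<open>
  The local rules of a growth diagram: in a square whose smallest shape is \<open>v\<close>, whose largest shape is \<open>z\<close>
  and whose other two are \<open>y\<close> and \<open>w\<close>, the entry \<open>A\<close> of the square goes to row 0 of \<open>z\<close>, and what is bumped
  from row \<open>r\<close> goes to row \<open>r + 1\<close>. The function \<open>shrink\<close> recovers \<open>v\<close> from the other three shapes.
\<close>

definition shrink :: "(nat \<Rightarrow> int) \<Rightarrow> (nat \<Rightarrow> int) \<Rightarrow> (nat \<Rightarrow> int) \<Rightarrow> nat \<Rightarrow> int" where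
  "shrink y z w = (\<lambda>s. max (y (Suc s)) (w (Suc s)) + min (y s) (w s) - z (Suc s))"

definition grow :: "int \<Rightarrow> (nat \<Rightarrow> int) \<Rightarrow> (nat \<Rightarrow> int) \<Rightarrow> (nat \<Rightarrow> int) \<Rightarrow> nat \<Rightarrow> int" where
  "grow A y v w = (\<lambda>s. max (y s) (w s) + (case s of 0 \<Rightarrow> A | Suc r \<Rightarrow> min (y r) (w r) - v r))"

lemma interlaces_shrink:
  assumes "interlaces y z" "interlaces w z"
  shows "interlaces (shrink y z w) y" "interlaces (shrink y z w) w"
    "max (y 0) (w 0) \<le> z 0"
    "grow (z 0 - max (y 0) (w 0)) y (shrink y z w) w = z"
proof -
  have le: "z (Suc s) \<le> min (y s) (w s)" for s using assms by (auto simp: interlaces_def)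
  have ge: "max (y s) (w s) \<le> z s" for s using assms by (auto simp: interlaces_def)
  have a: "max (y (Suc s)) (w (Suc s)) \<le> shrink y z w s" for s
    using le[of s] unfolding shrink_def by linarith
  have b: "shrink y z w s \<le> min (y s) (w s)" for s
    using ge[of "Suc s"] unfolding shrink_def by linarith
  show "interlaces (shrink y z w) y" "interlaces (shrink y z w) w"
    unfolding interlaces_def using a b by simp_all
  show "max (y 0) (w 0) \<le> z 0" by (rule ge)
  show "grow (z 0 - max (y 0) (w 0)) y (shrink y z w) w = z"
    by (rule ext) (auto simp: grow_def shrink_def split: nat.split)
qed

lemma interlaces_grow:
  assumes "interlaces v y" "interlaces v w" "0 \<le> A"
  shows "interlaces y (grow A y v w)" "interlaces w (grow A y v w)"
    "shrink y (grow A y v w) w = v" "grow A y v w 0 - max (y 0) (w 0) = A"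
proof -
  have le: "v s \<le> min (y s) (w s)" for s using assms by (auto simp: interlaces_def)
  have ge: "max (y (Suc s)) (w (Suc s)) \<le> v s" for s using assms by (auto simp: interlaces_def)
  have a: "max (y s) (w s) \<le> grow A y v w s" for s
    using le[of "s - 1"] assms(3) unfolding grow_def by (cases s) auto
  have b: "grow A y v w (Suc s) \<le> min (y s) (w s)" for s
    using ge[of s] unfolding grow_def by (simp only: nat.case)
  show "interlaces y (grow A y v w)" "interlaces w (grow A y v w)"
    unfolding interlaces_def using a b by simp_all
  show "shrink y (grow A y v w) w = v"
    by (rule ext) (simp add: shrink_def grow_def)
  show "grow A y v w 0 - max (y 0) (w 0) = A" by (simp add: grow_def)
qed

text \<open>
  As for toggles, the maximum and the minimum of neighbouring summands combine to a linear term.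
\<close>

lemma grow_sum:
  "(\<Sum>s\<le>j. grow A y v w s) = A + max (y j) (w j) + (\<Sum>s<j. y s) + (\<Sum>s<j. w s) - (\<Sum>s<j. v s)"
  by (induction j) (auto simp: grow_def)

text \<open>
  The column of squares with entries \<open>A\<close> and \<open>B\<close> leads from the chain \<open>x' < y' < z'\<close> to the chain
  \<open>x < y < z\<close>. The maximum in \<open>grow_sum\<close> splits every ballot inequality upstairs, and every one
  downstairs, into two. The halves are the same for both chains, except for the half of row 0 upstairs that
  reads \<open>B \<le> d\<close>.
\<close>

lemma ballot_grow:
  assumes y: "y = grow A x x' y'" and z: "z = grow B y y' z'"
  shows "ballot d x y z \<longleftrightarrow> B \<le> d \<and> ballot (d + A - B) x' y' z'"
proof -
  let ?P = "\<lambda>j. (\<Sum>s\<le>j. z s - y s) \<le> d + (\<Sum>s<j. y s - x s)"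
  let ?P1 = "\<lambda>j. B + (\<Sum>s<j. z' s - y' s) \<le> d + (\<Sum>s<j. y s - x s)"
  let ?P2 = "\<lambda>j. B + (\<Sum>s\<le>j. z' s) - (\<Sum>s<j. y' s) \<le> d + (\<Sum>s\<le>j. y s - x s) + x j"
  let ?Q = "\<lambda>j. (\<Sum>s\<le>j. z' s - y' s) \<le> d + A - B + (\<Sum>s<j. y' s - x' s)"
  have p: "?P j \<longleftrightarrow> ?P1 j \<and> ?P2 j" for j
    using grow_sum[where A = B and y = y and v = y' and w = z' and j = j]
    unfolding z[symmetric] by (simp add: sum_subtractf sum_atMost_eq_lessThan) linarith
  have q: "?Q j \<longleftrightarrow> ?P1 (Suc j) \<and> ?P2 j" for j
    using grow_sum[where A = A and y = x and v = x' and w = y' and j = j]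
    unfolding y[symmetric] by (simp add: sum_subtractf sum_atMost_eq_lessThan) linarith
  have 0: "?P1 0 \<longleftrightarrow> B \<le> d" by simp
  show ?thesis unfolding ballot_def using all_nat_split[of ?P1] p q 0 by simp blast
qed

section \<open>Chains of horizontal strips\<close>


definition weight :: "nat \<Rightarrow> (nat \<Rightarrow> int) \<Rightarrow> int" where
  "weight L x = (\<Sum>s<L. x s)"

text \<open>
  For \<open>S = UNIV\<close> this says that \<open>y/x\<close> is a horizontal strip of size \<open>m\<close>. An index \<open>t\<close> outside \<open>S\<close> marks a
  place where rows \<open>t\<close> and \<open>t + 1\<close> belong to different shapes and need not interlace. The nonnegativity of
  \<open>x\<close> then replaces the missing bound for the last row of the first shape.
\<close>

definition hstrip :: "nat set \<Rightarrow> nat \<Rightarrow> nat \<Rightarrow> (nat \<Rightarrow> int) \<Rightarrow> (nat \<Rightarrow> int) \<Rightarrow> bool" where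
  "hstrip S L m x y \<longleftrightarrow> (\<forall>t. 0 \<le> x t \<and> x t \<le> y t) \<and> (\<forall>t\<in>S. y (Suc t) \<le> x t) \<and>
     (\<forall>t\<ge>L. y t = 0) \<and> weight L y - weight L x = int m"

text \<open>
  The number of ways to reach \<open>z\<close> from \<open>x\<close> by adding strips, where the head of the list is the size of
  the last strip.
\<close>

primrec chain_count :: "nat set \<Rightarrow> nat \<Rightarrow> nat list \<Rightarrow> (nat \<Rightarrow> int) \<Rightarrow> (nat \<Rightarrow> int) \<Rightarrow> nat" where
  "chain_count S L [] x z = of_bool (x = z)"
| "chain_count S L (m # ms) x z = (\<Sum>y | hstrip S L m y z. chain_count S L ms x y)"

text \<open>
  All shapes and patterns below are functions on \<open>nat\<close> that are fixed from some index on.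
\<close>

lemma finite_bounded_funs:
  fixes c :: "nat \<Rightarrow> 'b"
  assumes "\<And>t. t < L \<Longrightarrow> finite (B t)"
  shows "finite {f. (\<forall>t<L. f t \<in> B t) \<and> (\<forall>t\<ge>L. f t = c t)}"
proof (rule finite_subset)
  show "{f. (\<forall>t<L. f t \<in> B t) \<and> (\<forall>t\<ge>L. f t = c t)}
      \<subseteq> (\<lambda>g t. if t < L then g t else c t) ` (PiE {..<L} B)"
  proof
    fix f assume f: "f \<in> {f. (\<forall>t<L. f t \<in> B t) \<and> (\<forall>t\<ge>L. f t = c t)}"
    then have "f = (\<lambda>t. if t < L then restrict f {..<L} t else c t)" by (auto simp: fun_eq_iff)
    moreover from f have "restrict f {..<L} \<in> PiE {..<L} B" by auto
    ultimately show "f \<in> (\<lambda>g t. if t < L then g t else c t) ` (PiE {..<L} B)" by blast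
  qed
  show "finite ((\<lambda>g t. if t < L then g t else c t) ` (PiE {..<L} B))"
    using assms by (intro finite_imageI finite_PiE) auto
qed

lemma finite_hstrip_inner: "finite {x. hstrip S L m x y}"
proof (rule finite_subset[OF _ finite_bounded_funs[where B = "\<lambda>t. {0..y t}" and c = "\<lambda>_. 0" and L = L]])
  show "{x. hstrip S L m x y} \<subseteq> {f. (\<forall>t<L. f t \<in> {0..y t}) \<and> (\<forall>t\<ge>L. f t = 0)}"
    by (auto simp: hstrip_def intro: antisym) (metis antisym)
qed auto

lemma finite_hstrip_outer: "finite {y. hstrip S L m x y}"
proof (rule finite_subset[OF _ finite_bounded_funs[where B = "\<lambda>t. {0..x t + int m}" and c = "\<lambda>_. 0" and L = L]])
  show "{y. hstrip S L m x y} \<subseteq> {f. (\<forall>t<L. f t \<in> {0..x t + int m}) \<and> (\<forall>t\<ge>L. f t = 0)}"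
  proof (clarsimp, intro conjI allI impI)
    fix y t assume y: "hstrip S L m x y" and t: "t < L"
    show "0 \<le> y t" using y by (meson hstrip_def order_trans)
    have "y t - x t \<le> (\<Sum>s<L. y s - x s)"
      using y t by (intro member_le_sum) (auto simp: hstrip_def)
    then show "y t \<le> x t + int m" using y by (simp add: hstrip_def weight_def sum_subtractf)
  next
    fix y t assume "hstrip S L m x y" "L \<le> t"
    then show "y t = 0" by (simp add: hstrip_def)
  qed
qed auto

lemma hstrip_inner_zero: "hstrip S L m x y \<Longrightarrow> t \<ge> L \<Longrightarrow> x t = 0"
  unfolding hstrip_def by (metis antisym)

lemma interlaces_zero:
  assumes "interlaces x y" "\<forall>t\<ge>L. y t = 0" "t \<ge> L"
  shows "x t = 0"
proof -
  have "y (Suc t) \<le> x t" "x t \<le> y t" using assms(1) by (auto simp: interlaces_def)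
  then show ?thesis using assms(2,3) by auto
qed

lemma interlaces_nonneg:
  assumes "interlaces x y" "\<forall>t\<ge>L. y t = 0"
  shows "0 \<le> x t"
proof (cases "t \<ge> L")
  case True then show ?thesis using interlaces_zero[OF assms] by simp
next
  case False
  then have "t \<le> L" by simp
  then show ?thesis
  proof (induction t rule: inc_induct)
    case base then show ?case using interlaces_zero[OF assms] by simp
  next
    case (step t)
    have "x (Suc t) \<le> y (Suc t)" "y (Suc t) \<le> x t" using assms(1) by (auto simp: interlaces_def)
    then show ?case using step by linarith
  qed
qed

lemma hstrip_UNIV_iff:
  "hstrip UNIV L m x y \<longleftrightarrow>
     interlaces x y \<and> (\<forall>t\<ge>L. y t = 0) \<and> weight L y - weight L x = int m"
proof -
  have "interlaces x y \<Longrightarrow> \<forall>t\<ge>L. y t = 0 \<Longrightarrow> 0 \<le> x t" for t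
    by (rule interlaces_nonneg)
  then show ?thesis unfolding hstrip_def interlaces_def by blast
qed

lemma weight_eq_sum_atMost: "x L = 0 \<Longrightarrow> weight L x = (\<Sum>s\<le>L. x s)"
  by (simp add: weight_def sum_atMost_eq_lessThan)

lemma toggle_zero:
  assumes "interlaces x y" "interlaces y z" "\<forall>t\<ge>L. z t = 0" "t \<ge> L"
  shows "toggle x z y t = 0"
  using interlaces_zero[OF interlaces_toggle(2)[OF assms(1,2)] assms(3,4)] .

lemma weight_toggle:
  assumes "interlaces x y" "interlaces y z" "\<forall>t\<ge>L. z t = 0"
  shows "weight L (toggle x z y) = weight L x + weight L z - weight L y"
proof -
  have y: "\<forall>t\<ge>L. y t = 0" using interlaces_zero[OF assms(2,3)] by blast
  have "x L = 0" using interlaces_zero[OF assms(1) y] by simp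
  then show ?thesis
    using toggle_sum[of x z y L] toggle_zero[OF assms, of L] y assms(3)
    by (simp add: weight_eq_sum_atMost[of "toggle x z y"] weight_eq_sum_atMost[of y]
        weight_eq_sum_atMost[of z] sum_atMost_eq_lessThan weight_def)
qed

lemma weight_grow:
  assumes "\<forall>t\<ge>L. v t = 0" "\<forall>t\<ge>L. y t = 0" "\<forall>t\<ge>L. w t = 0" "\<forall>t\<ge>L. grow A y v w t = 0"
  shows "weight L (grow A y v w) = A + weight L y + weight L w - weight L v"
proof -
  have "weight L (grow A y v w) = (\<Sum>s\<le>L. grow A y v w s)"
    using assms(4) by (intro weight_eq_sum_atMost) simp
  also have "\<dots> = A + weight L y + weight L w - weight L v"
    using assms by (simp add: grow_sum weight_def)
  finally show ?thesis .
qed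

text \<open>
  The recursion defining \<open>chain_count\<close> removes the outermost strip; here the innermost one is removed. The
  growth diagram consumes a tableau from the outside and builds another one from the inside.
\<close>

lemma chain_count_snoc:
  "chain_count S L (ms @ [m]) x z = (\<Sum>y | hstrip S L m x y. chain_count S L ms y z)"
proof (induction ms arbitrary: z)
  case Nil
  show ?case
    using finite_hstrip_inner[of S L m z] finite_hstrip_outer[of S L m x]
    by (simp add: of_bool_def sum.delta sum.delta')
next
  case (Cons k ms)
  then show ?case by (simp add: sum.swap[of _ "{y. hstrip S L m x y}"])
qed

text \<open>
  Toggling the middle shape of two successive strips exchanges their sizes. This is the symmetry of Schur
  functions.
\<close>

lemma chain_count_swap_head:
  "chain_count UNIV L (a # b # ms) x z = chain_count UNIV L (b # a # ms) x z"
proof -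
  let ?P = "\<lambda>a b. (SIGMA y : {y. hstrip UNIV L a y z}. {w. hstrip UNIV L b w y})"
  have count: "chain_count UNIV L (a # b # ms) x z
      = (\<Sum>(y, w) \<in> ?P a b. chain_count UNIV L ms x w)" for a b
    by (simp add: sum.Sigma finite_hstrip_inner)
  have mem: "(toggle w z y, w) \<in> ?P b a" if "(y, w) \<in> ?P a b" for a b y w
    using that by (auto simp: hstrip_UNIV_iff interlaces_toggle weight_toggle toggle_zero)
  have "(\<Sum>(y, w) \<in> ?P a b. chain_count UNIV L ms x w)
      = (\<Sum>(y, w) \<in> ?P b a. chain_count UNIV L ms x w)"
    by (rule sum.reindex_bij_witness[where i = "\<lambda>(y, w). (toggle w z y, w)"
          and j = "\<lambda>(y, w). (toggle w z y, w)"])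
      (use mem in \<open>auto simp: toggle_toggle\<close>)
  then show ?thesis by (simp only: count)
qed

lemma chain_count_swap:
  "chain_count UNIV L (xs @ a # b # ys) x z = chain_count UNIV L (xs @ b # a # ys) x z"
proof (induction xs arbitrary: z)
  case Nil
  show ?case by (simp only: append_Nil chain_count_swap_head)
qed simp

lemma swap_invariant_rev:
  assumes "\<And>xs a b ys. f (xs @ a # b # ys) = f (xs @ b # a # ys)"
  shows "f (rev xs) = f xs"
proof -
  have move: "f (ps @ a # xs @ qs) = f (ps @ xs @ a # qs)" for ps a xs qs
  proof (induction xs arbitrary: ps)
    case (Cons b xs)
    have "f (ps @ a # (b # xs) @ qs) = f ((ps @ [b]) @ a # xs @ qs)" using assms by simp
    also have "\<dots> = f (ps @ (b # xs) @ a # qs)" using Cons[of "ps @ [b]"] by simp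
    finally show ?case .
  qed simp
  have "f (rev xs @ qs) = f (xs @ qs)" for qs
  proof (induction xs arbitrary: qs)
    case (Cons a xs)
    then show ?case using move[of "[]" a xs qs] by simp
  qed simp
  from this[of "[]"] show ?thesis by simp
qed

lemma chain_count_rev: "chain_count UNIV L (rev ms) x z = chain_count UNIV L ms x z"
  by (rule swap_invariant_rev[where f = "\<lambda>ms. chain_count UNIV L ms x z"]) (rule chain_count_swap)

section \<open>Ballot patterns and the Robinson--Schensted--Knuth correspondence\<close>


text \<open>
  Gelfand--Tsetlin patterns as chains of shapes: that row \<open>t\<close> has at most \<open>t\<close> nonzero entries follows from
  interlacing (\<open>chain_zero\<close>). A pattern is continued as a constant beyond row \<open>L\<close>, so that it is determined by its rows up
  to \<open>L\<close>.
\<close>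

definition gt_patterns :: "nat \<Rightarrow> (nat \<Rightarrow> int) \<Rightarrow> (nat \<Rightarrow> int) \<Rightarrow> (nat \<Rightarrow> nat \<Rightarrow> int) set" where
  "gt_patterns L c z = {a. a 0 = (\<lambda>_. 0) \<and> (\<forall>t<L. interlaces (a t) (a (Suc t))) \<and>
     (\<forall>t\<ge>L. a t = z) \<and> (\<forall>t<L. weight L (a (Suc t)) - weight L (a t) = c t)}"

text \<open>
  The steps of the pattern stand for the rows of a skew shape from \<open>R\<close> to \<open>U\<close>, and \<open>S\<close> lists those rows that
  have their successor in the same shape.
\<close>

definition ballot_patterns ::
  "nat set \<Rightarrow> nat \<Rightarrow> (nat \<Rightarrow> int) \<Rightarrow> (nat \<Rightarrow> int) \<Rightarrow> (nat \<Rightarrow> int) \<Rightarrow> (nat \<Rightarrow> nat \<Rightarrow> int) set" where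
  "ballot_patterns S L R U z = {a \<in> gt_patterns L (\<lambda>t. U t - R t) z.
     \<forall>t\<in>S. t + 2 \<le> L \<longrightarrow> ballot (R t - R (Suc t)) (a t) (a (Suc t)) (a (Suc (Suc t)))}"

definition partitions_of :: "nat \<Rightarrow> int \<Rightarrow> (nat \<Rightarrow> int) set" where
  "partitions_of L w = {z. (\<forall>s. z (Suc s) \<le> z s) \<and> (\<forall>s\<ge>L. z s = 0) \<and> weight L z = w}"

lemma chain_zero:
  assumes "a 0 = (\<lambda>_. 0)" "\<And>t. t < L \<Longrightarrow> interlaces (a t) (a (Suc t))"
  shows "t \<le> L \<Longrightarrow> t \<le> s \<Longrightarrow> a t s = (0::int)"
proof (induction t arbitrary: s)
  case 0
  then show ?case using assms(1) by simp
next
  case (Suc t)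
  then obtain r where s: "s = Suc r" "t \<le> r" by (cases s) auto
  have i: "interlaces (a t) (a (Suc t))" using assms(2) Suc by simp
  have "a (Suc t) s \<le> a t r" using i by (simp add: interlaces_def s)
  moreover have "a t s \<le> a (Suc t) s" using i by (simp add: interlaces_def)
  ultimately show ?case using Suc.IH[of r] Suc.IH[of s] Suc.prems s by simp
qed

lemma chain_decreasing:
  assumes "a 0 = (\<lambda>_. 0)" "\<And>t. t < L \<Longrightarrow> interlaces (a t) (a (Suc t))"
  shows "t \<le> L \<Longrightarrow> a t (Suc s) \<le> (a t s :: int)"
proof (cases t)
  case (Suc r)
  assume "t \<le> L"
  then have "interlaces (a r) (a (Suc r))" using assms(2) Suc by simp
  then show ?thesis unfolding interlaces_def Suc by (meson order_trans)
qed (simp add: assms)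

lemma gt_pattern_zero: "a \<in> gt_patterns L c z \<Longrightarrow> t \<le> L \<Longrightarrow> t \<le> s \<Longrightarrow> a t s = 0"
  by (rule chain_zero[of a L]) (auto simp: gt_patterns_def)

lemma gt_patterns_shape:
  assumes "a \<in> gt_patterns L c z"
  shows "z \<in> partitions_of L (\<Sum>t<L. c t)"
proof -
  have z: "a L = z" using assms by (simp add: gt_patterns_def)
  have 1: "z (Suc s) \<le> z s" for s
    using chain_decreasing[of a L L s] assms z by (auto simp: gt_patterns_def)
  have 2: "z s = 0" if "s \<ge> L" for s
    using gt_pattern_zero[OF assms, of L s] that z by simp
  have "(\<Sum>t<L. c t) = (\<Sum>t<L. weight L (a (Suc t)) - weight L (a t))"
    using assms by (intro sum.cong) (auto simp: gt_patterns_def)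
  also have "\<dots> = weight L (a L) - weight L (a 0)" by (rule sum_lessThan_telescope)
  also have "\<dots> = weight L z" using assms z by (simp add: gt_patterns_def weight_def)
  finally show ?thesis using 1 2 by (simp add: partitions_of_def)
qed

lemma gt_pattern_bounds:
  assumes "a \<in> gt_patterns L c z" "t \<le> L"
  shows "0 \<le> a t s" "a t s \<le> z s"
proof -
  have i: "interlaces (a t) (a (Suc t))" if "t < L" for t using assms that by (simp add: gt_patterns_def)
  have zp: "z \<in> partitions_of L (\<Sum>t<L. c t)" by (rule gt_patterns_shape[OF assms(1)])
  have aL: "a L = z" using assms by (simp add: gt_patterns_def)
  show "a t s \<le> z s" using assms(2)
  proof (induction t rule: inc_induct)
    case base then show ?case by (simp add: aL)
  next
    case (step t)
    then show ?case using i[of t] unfolding interlaces_def by (meson order_trans)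
  qed
  show "0 \<le> a t s"
  proof (cases t)
    case 0 then show ?thesis using assms by (simp add: gt_patterns_def)
  next
    case (Suc r)
    show ?thesis
    proof (cases "s \<ge> t")
      case True then show ?thesis using gt_pattern_zero[OF assms True] by simp
    next
      case False
      have "a t (Suc s) \<le> a t s" for s
        using chain_decreasing[of a L t] assms i by (auto simp: gt_patterns_def)
      then have "a t t \<le> a t s" using False by (intro lift_Suc_antimono_le[of "a t" s t]) auto
      then show ?thesis using gt_pattern_zero[OF assms, of t] by simp
    qed
  qed
qed

lemma finite_gt_patterns: "finite (gt_patterns L c z)"
proof (rule finite_subset)
  let ?B = "{f. (\<forall>s<L. f s \<in> {0..z s}) \<and> (\<forall>s\<ge>L. f s = 0)}"
  show "gt_patterns L c z \<subseteq> {a. (\<forall>t<L. a t \<in> ?B) \<and> (\<forall>t\<ge>L. a t = z)}"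
    using gt_pattern_bounds gt_pattern_zero by (auto simp: gt_patterns_def)
  have "finite ?B" by (rule finite_bounded_funs) simp
  then show "finite {a. (\<forall>t<L. a t \<in> ?B) \<and> (\<forall>t\<ge>L. a t = z)}"
    by (rule finite_bounded_funs[where B = "\<lambda>_. ?B"])
qed

lemma finite_ballot_patterns: "finite (ballot_patterns S L R U z)"
  by (simp add: ballot_patterns_def finite_gt_patterns)

lemma finite_partitions_of: "finite (partitions_of L w)"
proof (rule finite_subset)
  show "partitions_of L w \<subseteq> {f. (\<forall>s<L. f s \<in> {0..w}) \<and> (\<forall>s\<ge>L. f s = 0)}"
  proof (clarsimp, intro conjI allI impI)
    fix z s assume z: "z \<in> partitions_of L w" and s: "s < L"
    have nn: "0 \<le> z s" for s
    proof -
      have "z (max s L) \<le> z s" using z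
        by (intro lift_Suc_antimono_le[of z s]) (auto simp: partitions_of_def)
      then show ?thesis using z by (simp add: partitions_of_def)
    qed
    then show "0 \<le> z s" .
    have "z s \<le> (\<Sum>s<L. z s)" using nn s by (intro member_le_sum) auto
    then show "z s \<le> w" using z by (simp add: partitions_of_def weight_def)
  qed (simp add: partitions_of_def)
qed (rule finite_bounded_funs, simp)

text \<open>
  The chains \<open>a\<close> and \<open>b\<close> are the two sides of one column of a growth diagram with entries \<open>A\<close>. The
  content of \<open>a\<close> exceeds that of \<open>b\<close> by \<open>A\<close>, and \<open>ballot_grow\<close> compares the ballot conditions; the surplus inequalities
  \<open>A (t + 1) \<le> R t - R (t + 1)\<close> say that \<open>A\<close> is a horizontal strip on \<open>R\<close>.
\<close>

lemma grid_iff: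
  assumes a0: "a 0 = (\<lambda>_. 0)" and b0: "b 0 = (\<lambda>_. 0)"
    and ia: "\<And>t. t < L \<Longrightarrow> interlaces (a t) (a (Suc t))"
    and ib: "\<And>t. t < L \<Longrightarrow> interlaces (b t) (b (Suc t))"
    and iba: "\<And>t. t \<le> L \<Longrightarrow> interlaces (b t) (a t)"
    and ea: "\<And>t. t \<ge> L \<Longrightarrow> a t = z" and eb: "\<And>t. t \<ge> L \<Longrightarrow> b t = y"
    and g: "\<And>t. t < L \<Longrightarrow> a (Suc t) = grow (A t) (a t) (b t) (b (Suc t))"
    and A: "\<And>t. 0 \<le> A t" and A0: "\<And>t. t \<ge> L \<Longrightarrow> A t = 0"
    and R: "\<And>t. 0 \<le> R t" and R0: "\<And>t. t \<ge> L \<Longrightarrow> R t = 0"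
  shows "a \<in> ballot_patterns S L R U z \<and> hstrip UNIV L m y z \<longleftrightarrow>
    hstrip S L m R (\<lambda>t. R t + A t) \<and> b \<in> ballot_patterns S L (\<lambda>t. R t + A t) U y"
proof -
  have za: "a t s = 0" if "t \<le> L" "s \<ge> L" for t s
    using chain_zero[of a L t s] a0 ia that by simp
  have zb: "b t s = 0" if "t \<le> L" "s \<ge> L" for t s
    using chain_zero[of b L t s] b0 ib that by simp
  have w: "weight L (a (Suc t)) = A t + weight L (a t) + weight L (b (Suc t)) - weight L (b t)"
    if "t < L" for t
    using za[of "Suc t"] za[of t] zb[of t] zb[of "Suc t"] that unfolding g[OF that]
    by (intro weight_grow) auto
  have "(\<Sum>t<L. A t) = (\<Sum>t<L. (weight L (a (Suc t)) - weight L (b (Suc t))) - (weight L (a t) - weight L (b t)))"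
    using w by (intro sum.cong) auto
  also have "\<dots> = weight L z - weight L y"
    by (subst sum_lessThan_telescope) (simp add: a0 b0 ea eb weight_def)
  finally have sA: "weight L A = weight L z - weight L y" by (simp add: weight_def)
  have wRA: "weight L (\<lambda>t. R t + A t) = weight L R + weight L A" by (simp add: weight_def sum.distrib)
  have hz: "hstrip UNIV L m y z \<longleftrightarrow> weight L A = int m"
    using iba[of L] za[of L] sA by (simp add: hstrip_UNIV_iff ea eb)
  have bal: "ballot (R t - R (Suc t)) (a t) (a (Suc t)) (a (Suc (Suc t))) \<longleftrightarrow>
      A (Suc t) \<le> R t - R (Suc t) \<and>
      ballot (R t + A t - (R (Suc t) + A (Suc t))) (b t) (b (Suc t)) (b (Suc (Suc t)))"
    if "t + 2 \<le> L" for t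
    using ballot_grow[of "a (Suc t)" "A t" "a t" "b t" "b (Suc t)" "a (Suc (Suc t))" "A (Suc t)"
        "b (Suc (Suc t))" "R t - R (Suc t)"] g[of t] g[of "Suc t"] that
    by (simp add: algebra_simps)
  have hR: "hstrip S L m R (\<lambda>t. R t + A t) \<longleftrightarrow>
      (\<forall>t\<in>S. t + 2 \<le> L \<longrightarrow> A (Suc t) \<le> R t - R (Suc t)) \<and> weight L A = int m"
  proof -
    have "R (Suc t) + A (Suc t) \<le> R t \<longleftrightarrow> (t + 2 \<le> L \<longrightarrow> A (Suc t) \<le> R t - R (Suc t))" for t
      using R0[of "Suc t"] A0[of "Suc t"] R[of t] by (cases "t + 2 \<le> L") auto
    then show ?thesis using R A R0 A0 by (simp add: hstrip_def wRA)
  qed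
  have gta: "a \<in> gt_patterns L (\<lambda>t. U t - R t) z \<longleftrightarrow>
      b \<in> gt_patterns L (\<lambda>t. U t - (R t + A t)) y"
    using w by (auto simp: gt_patterns_def a0 b0 ia ib ea eb)
  show ?thesis unfolding ballot_patterns_def mem_Collect_eq hz hR gta using bal by blast
qed

text \<open>
  The left side of a growth column, computed from the right side \<open>a\<close> and the top corner \<open>y\<close> downwards. The
  recursion runs over \<open>L - t\<close>.
\<close>

primrec shrink_from :: "(nat \<Rightarrow> nat \<Rightarrow> int) \<Rightarrow> (nat \<Rightarrow> int) \<Rightarrow> nat \<Rightarrow> nat \<Rightarrow> nat \<Rightarrow> int" where
  "shrink_from a y L 0 = y"
| "shrink_from a y L (Suc i) = shrink (a (L - Suc i)) (a (L - i)) (shrink_from a y L i)"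

definition shrink_chain :: "nat \<Rightarrow> (nat \<Rightarrow> nat \<Rightarrow> int) \<Rightarrow> (nat \<Rightarrow> int) \<Rightarrow> nat \<Rightarrow> nat \<Rightarrow> int" where
  "shrink_chain L a y t = shrink_from a y L (L - t)"

lemma shrink_chain_simps:
  "t \<ge> L \<Longrightarrow> shrink_chain L a y t = y"
  "t < L \<Longrightarrow> shrink_chain L a y t = shrink (a t) (a (Suc t)) (shrink_chain L a y (Suc t))"
proof -
  assume "t < L"
  then have "L - t = Suc (L - Suc t)" "L - Suc (L - Suc t) = t" "L - (L - Suc t) = Suc t" by auto
  then show "shrink_chain L a y t = shrink (a t) (a (Suc t)) (shrink_chain L a y (Suc t))"
    by (simp add: shrink_chain_def)
qed (simp add: shrink_chain_def)

text \<open>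
  The right side of a growth column, computed from the left side \<open>b\<close> and the entries \<open>A\<close> upwards.
\<close>

primrec grow_from :: "(nat \<Rightarrow> int) \<Rightarrow> (nat \<Rightarrow> nat \<Rightarrow> int) \<Rightarrow> nat \<Rightarrow> nat \<Rightarrow> int" where
  "grow_from A b 0 = (\<lambda>_. 0)"
| "grow_from A b (Suc t) = grow (A t) (grow_from A b t) (b t) (b (Suc t))"

definition grow_chain :: "nat \<Rightarrow> (nat \<Rightarrow> int) \<Rightarrow> (nat \<Rightarrow> nat \<Rightarrow> int) \<Rightarrow> nat \<Rightarrow> nat \<Rightarrow> int" where
  "grow_chain L A b t = grow_from A b (min t L)"

definition added_column :: "nat \<Rightarrow> (nat \<Rightarrow> nat \<Rightarrow> int) \<Rightarrow> (nat \<Rightarrow> nat \<Rightarrow> int) \<Rightarrow> nat \<Rightarrow> int" where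
  "added_column L a b t = (if t < L then a (Suc t) 0 - max (a t 0) (b (Suc t) 0) else 0)"

lemma added_column_outside: "t \<ge> L \<Longrightarrow> added_column L a b t = 0"
  by (simp add: added_column_def)

lemma grow_chain_simps:
  "grow_chain L A b 0 = (\<lambda>_. 0)"
  "t \<ge> L \<Longrightarrow> grow_chain L A b t = grow_chain L A b L"
  "t < L \<Longrightarrow> grow_chain L A b (Suc t) = grow (A t) (grow_chain L A b t) (b t) (b (Suc t))"
  by (simp_all add: grow_chain_def)

text \<open>
  Since \<open>a\<close> starts with the empty shape, so does the shrunk chain. Nothing but the entries of the column has
  to be recorded in order to go back.
\<close>

lemma shrink_chain_props:
  fixes a y L
  defines "b \<equiv> shrink_chain L a y"
  assumes a0: "a 0 = (\<lambda>_. 0)" and ia: "\<And>t. t < L \<Longrightarrow> interlaces (a t) (a (Suc t))"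
    and y: "interlaces y (a L)"
  shows "t \<le> L \<Longrightarrow> interlaces (b t) (a t)"
    and "t < L \<Longrightarrow> interlaces (b t) (b (Suc t))"
    and "b 0 = (\<lambda>_. 0)"
    and "0 \<le> added_column L a b t"
    and "t < L \<Longrightarrow> a (Suc t) = grow (added_column L a b t) (a t) (b t) (b (Suc t))"
proof -
  have ba: "interlaces (b t) (a t)" if "t \<le> L" for t
    using that
  proof (induction t rule: inc_induct)
    case base then show ?case using y by (simp add: b_def shrink_chain_simps)
  next
    case (step t)
    then show ?case using interlaces_shrink(1) ia[of t] by (simp add: b_def shrink_chain_simps)
  qed
  show "t \<le> L \<Longrightarrow> interlaces (b t) (a t)" by (rule ba)
  have bs: "b t = shrink (a t) (a (Suc t)) (b (Suc t))" if "t < L" for t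
    using that by (simp add: b_def shrink_chain_simps)
  show "t < L \<Longrightarrow> interlaces (b t) (b (Suc t))"
    using interlaces_shrink(2)[OF ia ba[of "Suc t"]] bs[of t] by simp
  show "b 0 = (\<lambda>_. 0)" using interlaces_zero[OF ba[of 0], of 0] a0 by auto
  show "0 \<le> added_column L a b t" using interlaces_shrink(3)[OF ia ba[of "Suc t"]]
    by (simp add: added_column_def)
  show "t < L \<Longrightarrow> a (Suc t) = grow (added_column L a b t) (a t) (b t) (b (Suc t))"
    using interlaces_shrink(4)[OF ia ba[of "Suc t"]] bs[of t] by (simp add: added_column_def)
qed

lemma grow_chain_props:
  fixes A b L
  defines "a \<equiv> grow_chain L A b"
  assumes b0: "b 0 = (\<lambda>_. 0)" and ib: "\<And>t. t < L \<Longrightarrow> interlaces (b t) (b (Suc t))"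
    and A: "\<And>t. 0 \<le> A t" and A0: "\<And>t. t \<ge> L \<Longrightarrow> A t = 0" and eb: "\<And>t. t \<ge> L \<Longrightarrow> b t = y"
  shows "t \<le> L \<Longrightarrow> interlaces (b t) (a t)"
    and "t < L \<Longrightarrow> interlaces (a t) (a (Suc t))"
    and "added_column L a b t = A t"
    and "shrink_chain L a y t = b t"
proof -
  have as: "a (Suc t) = grow (A t) (a t) (b t) (b (Suc t))" if "t < L" for t
    using that by (simp add: a_def grow_chain_simps)
  have ba: "interlaces (b t) (a t)" if "t \<le> L" for t
    using that
  proof (induction t)
    case 0 then show ?case by (simp add: b0 a_def grow_chain_simps interlaces_def)
  next
    case (Suc t)
    then show ?case using interlaces_grow(2)[OF _ ib A] as[of t] by simp
  qed
  show "t \<le> L \<Longrightarrow> interlaces (b t) (a t)" by (rule ba)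
  show "t < L \<Longrightarrow> interlaces (a t) (a (Suc t))"
    using interlaces_grow(1)[OF ba ib A] as[of t] by simp
  show "added_column L a b t = A t"
    using interlaces_grow(4)[OF ba ib A] as[of t] A0[of t] by (simp add: added_column_def)
  show "shrink_chain L a y t = b t"
  proof (cases "t \<le> L")
    case True
    then show ?thesis
    proof (induction t rule: inc_induct)
      case base then show ?case by (simp add: shrink_chain_simps eb)
    next
      case (step t)
      then show ?case using interlaces_grow(3)[OF ba ib A, of t t] as[of t]
        by (simp add: shrink_chain_simps)
    qed
  next
    case False
    then show ?thesis by (simp add: shrink_chain_simps eb)
  qed
qed

lemma grow_shrink_chain:
  assumes a0: "a 0 = (\<lambda>_. 0)" and ia: "\<And>t. t < L \<Longrightarrow> interlaces (a t) (a (Suc t))"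
    and y: "interlaces y (a L)" and ea: "\<And>t. t \<ge> L \<Longrightarrow> a t = z"
  shows "grow_chain L (added_column L a (shrink_chain L a y)) (shrink_chain L a y) t = a t"
proof -
  let ?b = "shrink_chain L a y"
  have le: "grow_chain L (added_column L a ?b) ?b t = a t" if "t \<le> L" for t
    using that
  proof (induction t)
    case 0 then show ?case by (simp add: grow_chain_simps a0)
  next
    case (Suc t)
    then show ?case using shrink_chain_props(5)[of a L y t] a0 ia y by (simp add: grow_chain_simps)
  qed
  show ?thesis using le[of t] le[of L] ea[of t] ea[of L] grow_chain_simps(2)[of L t]
    by (cases "t \<le> L") auto
qed

text \<open>
  One column of the growth diagram: a pattern of shape \<open>z\<close> together with a strip \<open>z/y\<close> corresponds to a
  pattern of shape \<open>y\<close> together with a strip added to the inner shape \<open>R\<close>. The function \<open>f\<close> carries the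
  number of ways to continue with \<open>y\<close>.
\<close>

lemma ballot_patterns_peel:
  fixes f :: "(nat \<Rightarrow> int) \<Rightarrow> nat"
  assumes R: "\<And>t. 0 \<le> R t" and R0: "\<And>t. t \<ge> L \<Longrightarrow> R t = 0"
  shows "(\<Sum>z \<in> partitions_of L (weight L U - weight L R).
            card (ballot_patterns S L R U z) * (\<Sum>y | hstrip UNIV L m y z. f y)) =
    (\<Sum>R' | hstrip S L m R R'. \<Sum>y \<in> partitions_of L (weight L U - weight L R').
            card (ballot_patterns S L R' U y) * f y)"
    (is "?lhs = ?rhs")
proof -
  let ?P = "partitions_of L"
  let ?A = "SIGMA z : ?P (weight L U - weight L R). SIGMA a : ballot_patterns S L R U z.
              {y. hstrip UNIV L m y z}"
  let ?B = "SIGMA R' : {R'. hstrip S L m R R'}. SIGMA y : ?P (weight L U - weight L R').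
              ballot_patterns S L R' U y"
  have l: "?lhs = (\<Sum>(z, a, y) \<in> ?A. f y)"
    by (simp add: sum.Sigma[symmetric] finite_partitions_of finite_ballot_patterns
        finite_hstrip_inner finite_SigmaI)
  have r: "?rhs = (\<Sum>(R', y, a) \<in> ?B. f y)"
    by (simp add: sum.Sigma[symmetric] finite_partitions_of finite_ballot_patterns
        finite_hstrip_outer finite_SigmaI)
  have shape: "z \<in> ?P (weight L U - weight L R)" if "a \<in> ballot_patterns S L R U z" for a z R
    using gt_patterns_shape[of a L "\<lambda>t. U t - R t" z] that
    by (auto simp: ballot_patterns_def weight_def sum_subtractf)
  let ?i = "\<lambda>(z, a, y). ((\<lambda>t. R t + added_column L a (shrink_chain L a y) t), y, shrink_chain L a y)"
  let ?j = "\<lambda>(R', y, b). (grow_chain L (\<lambda>t. R' t - R t) b L, grow_chain L (\<lambda>t. R' t - R t) b, y)"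
  have A: "?i p \<in> ?B \<and> ?j (?i p) = p" if "p \<in> ?A" for p
  proof -
    obtain z a y where p: "p = (z, a, y)" by (cases p)
    let ?b = "shrink_chain L a y"
    have a: "a \<in> ballot_patterns S L R U z" and y: "hstrip UNIV L m y z" using that p by auto
    have a0: "a 0 = (\<lambda>_. 0)" and ia: "\<And>t. t < L \<Longrightarrow> interlaces (a t) (a (Suc t))"
      and ea: "\<And>t. t \<ge> L \<Longrightarrow> a t = z"
      using a by (auto simp: ballot_patterns_def gt_patterns_def)
    have iy: "interlaces y (a L)" using y ea by (simp add: hstrip_UNIV_iff)
    note props = shrink_chain_props[where a = a and L = L and y = y, OF a0 ia iy]
    have "hstrip S L m R (\<lambda>t. R t + added_column L a ?b t) \<and>
        ?b \<in> ballot_patterns S L (\<lambda>t. R t + added_column L a ?b t) U y"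
      using grid_iff[where a = a and b = ?b and A = "added_column L a ?b" and R = R and L = L,
          OF a0 props(3) ia props(2) props(1) ea shrink_chain_simps(1) props(5) props(4)
          added_column_outside R R0, of S U m] a y by (simp only: simp_thms)
    moreover have "?j (?i p) = p"
      using grow_shrink_chain[OF a0 ia iy ea] ea by (simp add: p fun_eq_iff)
    ultimately show ?thesis using shape ea by (auto simp: p)
  qed
  have B: "?j p \<in> ?A \<and> ?i (?j p) = p" if "p \<in> ?B" for p
  proof -
    obtain R' y b where p: "p = (R', y, b)" by (cases p)
    let ?c = "\<lambda>t. R' t - R t"
    let ?a = "grow_chain L ?c b"
    have b: "b \<in> ballot_patterns S L R' U y" and h: "hstrip S L m R R'" using that p by auto
    have b0: "b 0 = (\<lambda>_. 0)" and ib: "\<And>t. t < L \<Longrightarrow> interlaces (b t) (b (Suc t))"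
      and eb: "\<And>t. t \<ge> L \<Longrightarrow> b t = y"
      using b by (auto simp: ballot_patterns_def gt_patterns_def)
    have c: "0 \<le> ?c t" for t using h by (simp add: hstrip_def)
    have c0: "?c t = 0" if "t \<ge> L" for t using h R0 that by (simp add: hstrip_def)
    have Rc: "(\<lambda>t. R t + ?c t) = R'" by simp
    note props = grow_chain_props[where b = b and L = L and A = ?c and y = y, OF b0 ib c c0 eb]
    have a: "?a \<in> ballot_patterns S L R U (?a L) \<and> hstrip UNIV L m y (?a L)"
      using grid_iff[where a = ?a and b = b and A = ?c and R = R and L = L,
          OF grow_chain_simps(1) b0 props(2) ib props(1) grow_chain_simps(2) eb
          grow_chain_simps(3) c c0 R R0, of S U m] b h unfolding Rc by (simp only: simp_thms)
    then have 1: "?j p \<in> ?A" using shape[of ?a R "?a L"] by (simp add: p)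
    have "shrink_chain L ?a y = b" using props(4) by blast
    then have 2: "?i (?j p) = p" using props(3) by (simp add: p)
    show ?thesis using 1 2 by blast
  qed
  have "(\<Sum>(z, a, y) \<in> ?A. f y) = (\<Sum>(R', y, a) \<in> ?B. f y)"
    by (rule sum.reindex_bij_witness[where i = ?j and j = ?i]) (use A B in \<open>auto 0 0\<close>)
  then show ?thesis using l r by simp
qed



text \<open>
  The base case of the correspondence, when no letter is left.
\<close>

lemma ballot_patterns_to_zero:
  assumes R0: "\<And>t. t \<ge> L \<Longrightarrow> R t = 0" and U0: "\<And>t. t \<ge> L \<Longrightarrow> U t = 0"
    and S: "\<And>t. t \<in> S \<Longrightarrow> R (Suc t) \<le> R t"
  shows "card (ballot_patterns S L R U (\<lambda>_. 0)) = of_bool (R = U)"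
proof -
  let ?Z = "\<lambda>_ _. 0 :: int"
  have only: "a = ?Z \<and> R = U" if a: "a \<in> ballot_patterns S L R U (\<lambda>_. 0)" for a
  proof -
    have g: "a \<in> gt_patterns L (\<lambda>t. U t - R t) (\<lambda>_. 0)" using a by (simp add: ballot_patterns_def)
    have z: "a t s = 0" for t s
    proof (cases "t \<le> L")
      case True then show ?thesis using gt_pattern_bounds[OF g True, of s] by simp
    next
      case False then show ?thesis using g by (simp add: gt_patterns_def)
    qed
    then have aZ: "a = ?Z" by (simp add: fun_eq_iff)
    have "U t = R t" for t
      using g R0[of t] U0[of t] by (cases "t < L") (auto simp: gt_patterns_def aZ weight_def)
    then show ?thesis using aZ by (simp add: fun_eq_iff)
  qed
  show ?thesis
  proof (cases "R = U")
    case True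
    have "?Z \<in> ballot_patterns S L R U (\<lambda>_. 0)"
      using S by (simp add: ballot_patterns_def gt_patterns_def interlaces_def ballot_def True weight_def)
    then have "ballot_patterns S L R U (\<lambda>_. 0) = {?Z}" using only by blast
    then show ?thesis using True by simp
  next
    case False
    then have "ballot_patterns S L R U (\<lambda>_. 0) = {}" using only by blast
    then show ?thesis using False by simp
  qed
qed

text \<open>
  Pairs of a ballot pattern and a tableau of the same shape correspond to fillings of the skew shape
  from \<open>R\<close> to \<open>U\<close>. The list is reversed because the last letter of the tableau adds the first strip to
  \<open>R\<close>.
\<close>

theorem ballot_patterns_count:
  assumes "\<And>t. 0 \<le> R t" "\<And>t. t \<ge> L \<Longrightarrow> R t = 0" "\<And>t. t \<in> S \<Longrightarrow> R (Suc t) \<le> R t"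
    and U0: "\<And>t. t \<ge> L \<Longrightarrow> U t = 0"
  shows "(\<Sum>z \<in> partitions_of L (weight L U - weight L R).
      card (ballot_patterns S L R U z) * chain_count UNIV L ms (\<lambda>_. 0) z) =
    chain_count S L (rev ms) R U"
  using assms(1-3)
proof (induction ms arbitrary: R)
  case Nil
  let ?P = "partitions_of L (weight L U - weight L R)"
  let ?b = "\<lambda>z. card (ballot_patterns S L R U z)"
  have b0: "?b (\<lambda>_. 0) = of_bool (R = U)"
    using Nil U0 by (intro ballot_patterns_to_zero) auto
  have "(\<Sum>z \<in> ?P. ?b z * chain_count UNIV L [] (\<lambda>_. 0) z) = (\<Sum>z \<in> ?P. if (\<lambda>_. 0) = z then ?b (\<lambda>_. 0) else 0)"
    by (intro sum.cong) auto
  also have "\<dots> = (if (\<lambda>_. 0) \<in> ?P then ?b (\<lambda>_. 0) else 0)"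
    by (simp add: finite_partitions_of)
  also have "\<dots> = of_bool (R = U)"
    using b0 by (auto simp: partitions_of_def weight_def)
  finally show ?case by simp
next
  case (Cons m ms)
  have R': "0 \<le> R' t" "t \<ge> L \<Longrightarrow> R' t = 0" "t \<in> S \<Longrightarrow> R' (Suc t) \<le> R' t"
    if "hstrip S L m R R'" for R' t
    using that by (auto simp: hstrip_def intro: order_trans)
  have "(\<Sum>z \<in> partitions_of L (weight L U - weight L R).
      card (ballot_patterns S L R U z) * chain_count UNIV L (m # ms) (\<lambda>_. 0) z) =
    (\<Sum>R' | hstrip S L m R R'. \<Sum>y \<in> partitions_of L (weight L U - weight L R').
            card (ballot_patterns S L R' U y) * chain_count UNIV L ms (\<lambda>_. 0) y)"
    unfolding chain_count.simps using Cons.prems by (intro ballot_patterns_peel) auto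
  also have "\<dots> = (\<Sum>R' | hstrip S L m R R'. chain_count S L (rev ms) R' U)"
    using R' by (intro sum.cong refl Cons.IH) auto
  also have "\<dots> = chain_count S L (rev (m # ms)) R U"
    by (simp add: chain_count_snoc)
  finally show ?case .
qed

section \<open>Semistandard tableaux as chains of horizontal strips\<close>

definition shape_cells :: "(nat \<Rightarrow> int) \<Rightarrow> (nat \<Rightarrow> int) \<Rightarrow> (nat \<times> nat) set" where
  "shape_cells y x = {(i, j). y i \<le> int j \<and> int j < x i}"

definition tableaux :: "(nat \<Rightarrow> int) \<Rightarrow> (nat \<Rightarrow> int) \<Rightarrow> nat multiset \<Rightarrow> (nat \<times> nat \<Rightarrow> nat) set" where
  "tableaux y x M = {T \<in> extensional (shape_cells y x).
     (\<forall>i j j'. (i, j) \<in> shape_cells y x \<and> (i, j') \<in> shape_cells y x \<and> j < j' \<longrightarrow> T (i, j) \<le> T (i, j')) \<and>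
     (\<forall>i i' j. (i, j) \<in> shape_cells y x \<and> (i', j) \<in> shape_cells y x \<and> i < i' \<longrightarrow> T (i, j) < T (i', j)) \<and>
     image_mset T (mset_set (shape_cells y x)) = M}"

text \<open>
  The multiplicities of the letters below \<open>N\<close>, the largest letter first, as \<open>chain_count\<close> removes the
  outermost strip first.
\<close>

definition letter_counts :: "nat \<Rightarrow> nat multiset \<Rightarrow> nat list" where
  "letter_counts N M = map (count M) (rev [0..<N])"

lemma shape_cells_eq_Sigma:
  assumes "\<And>i. i \<ge> L \<Longrightarrow> x i = 0" "\<And>i. 0 \<le> y i"
  shows "shape_cells y x = (SIGMA i : {..<L}. {nat (y i)..<nat (x i)})"
proof -
  have "i < L" if "int j < x i" for i j using assms(1)[of i] that by (cases "i < L") auto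
  then show ?thesis using assms(2) by (auto simp: shape_cells_def)
qed

lemma finite_shape_cells:
  assumes "\<And>i. i \<ge> L \<Longrightarrow> x i = 0" "\<And>i. 0 \<le> y i"
  shows "finite (shape_cells y x)"
proof -
  have "shape_cells y x = (SIGMA i : {..<L}. {nat (y i)..<nat (x i)})"
    by (rule shape_cells_eq_Sigma) (use assms in auto)
  then show ?thesis by simp
qed

lemma card_shape_cells:
  assumes "\<And>i. i \<ge> L \<Longrightarrow> x i = 0" "\<And>i. 0 \<le> y i" "\<And>i. y i \<le> x i"
  shows "int (card (shape_cells y x)) = weight L x - weight L y"
proof -
  have "int (card (shape_cells y x)) = (\<Sum>i<L. int (nat (x i) - nat (y i)))"
    using assms by (subst shape_cells_eq_Sigma[where L = L]) auto
  also have "\<dots> = (\<Sum>i<L. x i - y i)"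
  proof (intro sum.cong refl)
    fix i show "int (nat (x i) - nat (y i)) = x i - y i"
      using assms(2)[of i] assms(3)[of i] by linarith
  qed
  finally show ?thesis by (simp add: weight_def sum_subtractf)
qed

text \<open>
  In a row of a tableau, the cells with small letters are an initial segment.
\<close>

lemma downclosed_eq_interval:
  fixes J :: "nat set"
  assumes "finite J" "J \<subseteq> {a..}" "\<And>j j'. j \<in> J \<Longrightarrow> a \<le> j' \<Longrightarrow> j' < j \<Longrightarrow> j' \<in> J"
  shows "J = {a..<a + card J}"
proof (cases "J = {}")
  case False
  have "J = {a..Max J}"
  proof (intro equalityI subsetI)
    fix j assume "j \<in> {a..Max J}"
    then show "j \<in> J" using assms(3)[of "Max J" j] Max_in[OF assms(1) False] by (cases "j = Max J") auto
  qed (use assms in auto)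
  moreover have "a \<le> Max J" using Max_in[OF assms(1) False] assms(2) by auto
  ultimately show ?thesis by (metis Suc_diff_le add_diff_inverse_nat atLeastLessThanSuc_atLeastAtMost card_atLeastAtMost le_SucI not_less)
qed simp



text \<open>
  The shape that is left when the letters from \<open>N\<close> on are erased.
\<close>

definition subshape :: "nat \<Rightarrow> (nat \<Rightarrow> int) \<Rightarrow> (nat \<Rightarrow> int) \<Rightarrow> (nat \<times> nat \<Rightarrow> nat) \<Rightarrow> nat \<Rightarrow> int" where
  "subshape N y x T i = y i + int (card {j. (i, j) \<in> shape_cells y x \<and> T (i, j) < N})"

lemma finite_tableaux:
  assumes "finite (shape_cells y x)"
  shows "finite (tableaux y x M)"
proof (rule finite_subset)
  show "tableaux y x M \<subseteq> PiE (shape_cells y x) (\<lambda>_. set_mset M)"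
    using assms by (auto simp: tableaux_def PiE_def)
  show "finite (PiE (shape_cells y x) (\<lambda>_. set_mset M))"
    using assms by (intro finite_PiE) auto
qed

text \<open>
  In a semistandard tableau the cells with the largest letter form a horizontal strip at the outer rim.
  Conversely, any such strip can be filled with the largest letter: two of its cells never share a column,
  and the cells inside carry smaller letters.
\<close>

lemma tableaux_peel:
  assumes x: "\<And>i. x (Suc i) \<le> x i" "\<And>i. i \<ge> L \<Longrightarrow> x i = 0"
    and y: "\<And>i. y (Suc i) \<le> y i" "\<And>i. 0 \<le> y i" and yx: "\<And>i. y i \<le> x i"
    and M: "\<And>c. c \<in># M \<Longrightarrow> c \<le> N"
  shows "card (tableaux y x M) =
    (\<Sum>z | hstrip UNIV L (count M N) z x.
        if \<forall>i. y i \<le> z i then card (tableaux y z (filter_mset (\<lambda>c. c < N) M)) else 0)"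
proof -
  let ?M = "filter_mset (\<lambda>c. c < N) M"
  let ?C = "shape_cells y x"
  let ?Z = "{z. hstrip UNIV L (count M N) z x \<and> (\<forall>i. y i \<le> z i)}"
  let ?B = "SIGMA z : ?Z. tableaux y z ?M"
  let ?i = "\<lambda>T. (subshape N y x T, restrict T (shape_cells y (subshape N y x T)))"
  let ?j = "\<lambda>(z, T). (\<lambda>c. if c \<in> shape_cells y z then T c else if c \<in> ?C then N else undefined)"
  have fC: "finite ?C" using x(2) y(2) by (rule finite_shape_cells)
  have x_anti: "x i' \<le> x i" if "i \<le> i'" for i i' using x(1) that by (rule lift_Suc_antimono_le)
  have y_anti: "y i' \<le> y i" if "i \<le> i'" for i i' using y(1) that by (rule lift_Suc_antimono_le)
  have A: "?i T \<in> ?B \<and> ?j (?i T) = T" if T: "T \<in> tableaux y x M" for T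
  proof -
    let ?z = "subshape N y x T"
    let ?J = "\<lambda>i. {j. (i, j) \<in> ?C \<and> T (i, j) < N}"
    have content: "image_mset T (mset_set ?C) = M"
      and row: "\<And>i j j'. (i, j) \<in> ?C \<Longrightarrow> (i, j') \<in> ?C \<Longrightarrow> j < j' \<Longrightarrow> T (i, j) \<le> T (i, j')"
      and col: "\<And>i i' j. (i, j) \<in> ?C \<Longrightarrow> (i', j) \<in> ?C \<Longrightarrow> i < i' \<Longrightarrow> T (i, j) < T (i', j)"
      and ext: "T \<in> extensional ?C"
      using T unfolding tableaux_def by blast+
    have leN: "T c \<le> N" if "c \<in> ?C" for c
    proof -
      have "T c \<in># M" unfolding content[symmetric] using that fC by simp
      then show ?thesis by (rule M)
    qed
    have J: "?J i = {nat (y i)..<nat (y i) + card (?J i)}" for i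
    proof (rule downclosed_eq_interval)
      have "?J i \<subseteq> snd ` ?C" by force
      then show "finite (?J i)" using fC finite_surj by blast
      show "?J i \<subseteq> {nat (y i)..}" by (auto simp: shape_cells_def)
      show "j' \<in> ?J i" if "j \<in> ?J i" "nat (y i) \<le> j'" "j' < j" for j j'
      proof -
        have "(i, j') \<in> ?C" using that by (auto simp: shape_cells_def)
        then show ?thesis using that row[of i j' j] by auto
      qed
    qed
    have zJ: "j \<in> ?J i \<longleftrightarrow> y i \<le> int j \<and> int j < ?z i" for i j
    proof -
      define n where "n = card (?J i)"
      have "?J i = {nat (y i)..<nat (y i) + n}" unfolding n_def by (rule J)
      then have "j \<in> ?J i \<longleftrightarrow> nat (y i) \<le> j \<and> j < nat (y i) + n" by (simp only: atLeastLessThan_iff)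
      moreover have "?z i = y i + int n" by (simp add: subshape_def n_def)
      ultimately show ?thesis using y(2)[of i] by linarith
    qed
    have cz: "shape_cells y ?z = {c \<in> ?C. T c < N}"
      using zJ by (auto simp: shape_cells_def)
    have yz: "y i \<le> ?z i" for i by (simp add: subshape_def)
    have zx: "?z i \<le> x i" for i
    proof (rule ccontr)
      assume "\<not> ?z i \<le> x i"
      then have "nat (x i) \<in> ?J i" unfolding zJ using y(2)[of i] yx[of i] by auto
      then show False using y(2)[of i] yx[of i] by (auto simp: shape_cells_def)
    qed
    \<comment> \<open>the cell below a cell outside the subshape would carry a letter larger than \<open>N\<close>\<close>
    have xz: "x (Suc i) \<le> ?z i" for i
    proof (rule ccontr)
      assume neg: "\<not> x (Suc i) \<le> ?z i"
      let ?k = "nat (?z i)"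
      have k: "int ?k = ?z i" using yz[of i] y(2)[of i] by simp
      have c: "(i, ?k) \<in> ?C" "(Suc i, ?k) \<in> ?C"
        using neg k yz[of i] y(1)[of i] x(1)[of i] by (auto simp: shape_cells_def)
      then have "T (i, ?k) < N" using col[OF c] leN[OF c(2)] by simp
      then have "?k \<in> ?J i" using c by simp
      then show False unfolding zJ using k by simp
    qed
    have z0: "?z i = 0" if "i \<ge> L" for i using zx[of i] yz[of i] y(2)[of i] x(2)[OF that] by simp
    have "count M N = card {c \<in> ?C. T c = N}"
      unfolding content[symmetric] using fC
      by (simp add: count_image_mset vimage_def Int_def conj_commute)
    also have "{c \<in> ?C. T c = N} = ?C - shape_cells y ?z"
      unfolding cz using leN by (auto simp: le_less)
    also have "int (card \<dots>) = weight L x - weight L ?z"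
    proof -
      have "shape_cells y ?z \<subseteq> ?C" unfolding cz by blast
      then have "int (card (?C - shape_cells y ?z)) = int (card ?C) - int (card (shape_cells y ?z))"
        using fC by (simp add: card_Diff_subset card_mono finite_subset of_nat_diff)
      also have "\<dots> = weight L x - weight L ?z"
        using card_shape_cells[of L x y] card_shape_cells[of L ?z y] x(2) y(2) yx z0 yz by simp
      finally show ?thesis .
    qed
    finally have "hstrip UNIV L (count M N) ?z x"
      using zx xz x(2) by (auto simp: hstrip_UNIV_iff interlaces_def)
    then have zZ: "?z \<in> ?Z" using yz by simp
    have "image_mset (restrict T (shape_cells y ?z)) (mset_set (shape_cells y ?z)) =
        image_mset T (mset_set (shape_cells y ?z))"
      using finite_shape_cells[of L ?z y] z0 y(2) by (intro image_mset_cong) simp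
    also have "\<dots> = ?M"
      unfolding cz content[symmetric] using fC by (simp add: filter_mset_image_mset)
    finally have "restrict T (shape_cells y ?z) \<in> tableaux y ?z ?M"
      unfolding tableaux_def using row col by (auto simp: cz)
    moreover have "(if c \<in> shape_cells y ?z then restrict T (shape_cells y ?z) c
        else if c \<in> ?C then N else undefined) = T c" for c
      using leN[of c] ext by (cases c) (auto simp: cz extensional_def le_less)
    ultimately show ?thesis using zZ by (simp add: fun_eq_iff)
  qed
  have B: "?j p \<in> tableaux y x M \<and> ?i (?j p) = p" if p_in: "p \<in> ?B" for p
  proof -
    obtain z T where p: "p = (z, T)" by (cases p)
    let ?D = "shape_cells y z"
    let ?T = "?j (z, T)"
    have h: "hstrip UNIV L (count M N) z x" and yz: "\<And>i. y i \<le> z i" and T: "T \<in> tableaux y z ?M"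
      using p_in p by auto
    have zx: "z i \<le> x i" and xz: "x (Suc i) \<le> z i" for i
      using h by (auto simp: hstrip_def)
    have z_anti: "z i' \<le> z i" if "i \<le> i'" for i i'
      by (rule lift_Suc_antimono_le[OF _ that]) (use zx xz order_trans in blast)
    have xz': "x i' \<le> z i" if "i < i'" for i i'
      using xz[of i] x_anti[of "Suc i" i'] that by simp
    have z0: "z i = 0" if "i \<ge> L" for i using zx[of i] yz[of i] y(2)[of i] x(2)[OF that] by simp
    have fD: "finite ?D" using z0 y(2) by (rule finite_shape_cells)
    have content: "image_mset T (mset_set ?D) = ?M"
      and row: "\<And>i j j'. (i, j) \<in> ?D \<Longrightarrow> (i, j') \<in> ?D \<Longrightarrow> j < j' \<Longrightarrow> T (i, j) \<le> T (i, j')"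
      and col: "\<And>i i' j. (i, j) \<in> ?D \<Longrightarrow> (i', j) \<in> ?D \<Longrightarrow> i < i' \<Longrightarrow> T (i, j) < T (i', j)"
      and ext: "T \<in> extensional ?D"
      using T unfolding tableaux_def by blast+
    have ltN: "T c < N" if "c \<in> ?D" for c
    proof -
      have "T c \<in># ?M" unfolding content[symmetric] using that fD by simp
      then show ?thesis by simp
    qed
    have DC: "?D \<subseteq> ?C" using zx by (auto simp: shape_cells_def intro: less_le_trans)
    have "int (card (?C - ?D)) = int (card ?C) - int (card ?D)"
      using DC fC by (simp add: card_Diff_subset card_mono finite_subset of_nat_diff)
    also have "\<dots> = weight L x - weight L z"
      using card_shape_cells[of L x y] card_shape_cells[of L z y] x(2) y(2) yx z0 yz by simp
    also have "\<dots> = int (count M N)" using h by (simp add: hstrip_def)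
    finally have rest: "card (?C - ?D) = count M N" by simp
    have "mset_set ?C = mset_set ?D + mset_set (?C - ?D)"
      using DC fC fD by (subst mset_set_Union[symmetric]) (auto simp: Un_absorb1)
    then have "image_mset ?T (mset_set ?C) =
        image_mset ?T (mset_set ?D) + image_mset ?T (mset_set (?C - ?D))" by simp
    also have "image_mset ?T (mset_set ?D) = image_mset T (mset_set ?D)"
      using fD by (intro image_mset_cong) simp
    also have "image_mset ?T (mset_set (?C - ?D)) = image_mset (\<lambda>_. N) (mset_set (?C - ?D))"
      using fC by (intro image_mset_cong) simp
    also have "\<dots> = replicate_mset (count M N) N" by (simp add: image_mset_const_eq rest)
    also have "image_mset T (mset_set ?D) + replicate_mset (count M N) N = M"
      unfolding content
    proof (rule multiset_eqI)
      fix c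
      show "count (?M + replicate_mset (count M N) N) c = count M c"
        using M[of c] by (cases "c \<in># M") (auto simp: count_filter_mset not_in_iff)
    qed
    finally have content': "image_mset ?T (mset_set ?C) = M" .
    have D_left: "(i, j) \<in> ?D" if "(i, j') \<in> ?D" "(i, j) \<in> ?C" "j < j'" for i j j'
      using that by (auto simp: shape_cells_def)
    have D_up: "(i, j) \<in> ?D" if "(i', j) \<in> ?C" "(i, j) \<in> ?C" "i < i'" for i i' j
      using that xz'[of i i'] by (auto simp: shape_cells_def)
    have "?T \<in> tableaux y x M" unfolding tableaux_def mem_Collect_eq
    proof (intro conjI allI impI content')
      show "?T \<in> extensional ?C" using DC by (auto simp: extensional_def)
    next
      fix i j j' assume "(i, j) \<in> ?C \<and> (i, j') \<in> ?C \<and> j < j'"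
      then show "?T (i, j) \<le> ?T (i, j')"
        using row[of i j j'] D_left[of i j' j] ltN[of "(i, j)"] by auto
    next
      fix i i' j assume "(i, j) \<in> ?C \<and> (i', j) \<in> ?C \<and> i < i'"
      then show "?T (i, j) < ?T (i', j)"
        using col[of i j i'] D_up[of i' j i] ltN[of "(i, j)"] by auto
    qed
    moreover have "subshape N y x ?T i = z i" for i
    proof -
      have "{j. (i, j) \<in> ?C \<and> ?T (i, j) < N} = {nat (y i)..<nat (z i)}"
        using DC ltN y(2)[of i] by (auto simp: shape_cells_def split: if_splits)
      then show ?thesis using yz[of i] y(2)[of i] by (simp add: subshape_def)
    qed
    then have "subshape N y x ?T = z" by blast
    moreover have "restrict ?T ?D = T" using ext by (auto simp: extensional_def fun_eq_iff)
    ultimately show ?thesis by (simp add: p)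
  qed
  have fZ: "finite ?Z" using finite_hstrip_inner by (rule rev_finite_subset) blast
  have bij: "bij_betw ?i (tableaux y x M) ?B"
    by (rule bij_betw_byWitness[where f' = ?j]) (use A B in blast)+
  have fT: "finite (tableaux y z M')" if "hstrip UNIV L (count M N) z x" for z M'
  proof (rule finite_tableaux[OF finite_shape_cells[OF _ y(2)]])
    show "L \<le> i \<Longrightarrow> z i = 0" for i using that x(2)[of i] unfolding hstrip_def by (metis antisym)
  qed
  have "card (tableaux y x M) = card ?B" using bij by (rule bij_betw_same_card)
  also have "\<dots> = (\<Sum>z\<in>?Z. card (tableaux y z ?M))"
    using fZ fT by (intro card_SigmaI) auto
  also have "\<dots> = (\<Sum>z | hstrip UNIV L (count M N) z x.
        if \<forall>i. y i \<le> z i then card (tableaux y z ?M) else 0)"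
    using finite_hstrip_inner by (simp add: sum.If_cases Int_def)
  finally show ?thesis .
qed

lemma tableaux_count:
  assumes x: "\<And>i. x (Suc i) \<le> x i" "\<And>i. i \<ge> L \<Longrightarrow> x i = 0"
    and y: "\<And>i. y (Suc i) \<le> y i" "\<And>i. 0 \<le> y i"
    and M: "\<And>c. c \<in># M \<Longrightarrow> c < N"
  shows "(if \<forall>i. y i \<le> x i then card (tableaux y x M) else 0) =
    chain_count UNIV L (letter_counts N M) y x"
  using x M
proof (induction N arbitrary: x M)
  case 0
  have M: "M = {#}" using 0(3) by (metis multiset_nonemptyE not_less0)
  have "tableaux y x {#} = (if y = x then {\<lambda>_. undefined} else {})" if yx: "\<forall>i. y i \<le> x i"
  proof -
    have fC: "finite (shape_cells y x)" using 0(2) y(2) by (rule finite_shape_cells)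
    have "y = x" if "shape_cells y x = {}"
    proof (rule ext)
      fix i
      have "(i, nat (y i)) \<notin> shape_cells y x" using that by simp
      then show "y i = x i" using y(2)[of i] yx by (simp add: shape_cells_def antisym)
    qed
    moreover have "shape_cells x x = {}" by (auto simp: shape_cells_def)
    ultimately show ?thesis using fC by (auto simp: tableaux_def mset_set_empty_iff)
  qed
  then show ?case by (auto simp: letter_counts_def M)
next
  case (Suc N)
  have counts: "letter_counts (Suc N) M = count M N # letter_counts N (filter_mset (\<lambda>c. c < N) M)"
    by (simp add: letter_counts_def)
  have step: "(if \<forall>i. y i \<le> z i then card (tableaux y z (filter_mset (\<lambda>c. c < N) M)) else 0) =
      chain_count UNIV L (letter_counts N (filter_mset (\<lambda>c. c < N) M)) y z"
    if h: "hstrip UNIV L (count M N) z x" for z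
  proof (rule Suc.IH)
    show "z (Suc i) \<le> z i" for i using h by (auto simp: hstrip_def intro: order_trans)
    show "L \<le> i \<Longrightarrow> z i = 0" for i using h Suc.prems(2)[of i] unfolding hstrip_def by (metis antisym)
  qed simp
  show ?case
  proof (cases "\<forall>i. y i \<le> x i")
    case True
    have "card (tableaux y x M) = (\<Sum>z | hstrip UNIV L (count M N) z x.
        if \<forall>i. y i \<le> z i then card (tableaux y z (filter_mset (\<lambda>c. c < N) M)) else 0)"
      using Suc.prems y True by (intro tableaux_peel) (auto simp: less_Suc_eq_le)
    then show ?thesis using step True by (simp add: counts)
  next
    case False
    have "(if \<forall>i. y i \<le> z i then card (tableaux y z (filter_mset (\<lambda>c. c < N) M)) else 0) = 0"
      if "hstrip UNIV L (count M N) z x" for z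
      using that False unfolding hstrip_def by (meson order_trans)
    then have "chain_count UNIV L (letter_counts (Suc N) M) y x = 0"
      unfolding counts chain_count.simps using step by (simp add: sum.neutral)
    then show ?thesis unfolding if_not_P[OF False] by simp
  qed
qed

definition row_lengths :: "nat list \<Rightarrow> nat \<Rightarrow> int" where
  "row_lengths la i = int (nth_default 0 la i)"

lemma partition_row_lengths:
  assumes "is_partition m la"
  shows "row_lengths la (Suc i) \<le> row_lengths la i" "i \<ge> m \<Longrightarrow> row_lengths la i = 0"
    "0 \<le> row_lengths la i"
proof -
  have "la ! Suc i \<le> la ! i" if "Suc i < length la"
    using assms that by (simp add: is_partition_def sorted_wrt_iff_nth_less)
  then show "row_lengths la (Suc i) \<le> row_lengths la i"
    by (simp add: row_lengths_def nth_default_def)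
qed (use assms in \<open>auto simp: row_lengths_def nth_default_def is_partition_def\<close>)

lemma skew_schur_eq_chain_count:
  assumes la: "is_partition m la" "m \<le> L" and mu: "is_partition m' mu"
    and M: "\<And>c. c \<in># M \<Longrightarrow> c < N"
  shows "skew_schur la mu M =
    int (chain_count UNIV L (letter_counts N M) (row_lengths mu) (row_lengths la))"
proof -
  have cells: "cells la mu = shape_cells (row_lengths mu) (row_lengths la)"
    by (auto simp: cells_def shape_cells_def row_lengths_def)
  have tab: "{T \<in> ssyt la mu. image_mset T (mset_set (cells la mu)) = M} =
      tableaux (row_lengths mu) (row_lengths la) M"
    by (auto simp: ssyt_def tableaux_def cells)
  have le: "part_le mu la \<longleftrightarrow> (\<forall>i. row_lengths mu i \<le> row_lengths la i)"
    by (simp add: part_le_def row_lengths_def)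
  have "(if \<forall>i. row_lengths mu i \<le> row_lengths la i
      then card (tableaux (row_lengths mu) (row_lengths la) M) else 0) =
    chain_count UNIV L (letter_counts N M) (row_lengths mu) (row_lengths la)"
  proof (rule tableaux_count[OF _ _ _ _ M])
    show "L \<le> i \<Longrightarrow> row_lengths la i = 0" for i
      using partition_row_lengths(2)[OF la(1), of i] la(2) by simp
  qed (use partition_row_lengths(1,3)[OF la(1)] partition_row_lengths(1,3)[OF mu] in auto)
  then show ?thesis unfolding skew_schur_def tab le by (metis of_nat_0)
qed

section \<open>Products of two skew Schur functions\<close>


text \<open>
  Two shapes with \<open>n\<close> rows each as one sequence of \<open>2 n\<close> rows. There is no condition between row \<open>n - 1\<close>
  and row \<open>n\<close>, so a strip on the stack is a pair of strips.
\<close>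

definition stack :: "nat \<Rightarrow> (nat \<Rightarrow> int) \<Rightarrow> (nat \<Rightarrow> int) \<Rightarrow> nat \<Rightarrow> int" where
  "stack n x y t = (if t < n then x t else y (t - n))"

lemma stack_eq_iff:
  assumes "\<And>t. t \<ge> n \<Longrightarrow> x t = 0" "\<And>t. t \<ge> n \<Longrightarrow> x' t = 0"
  shows "stack n x y = stack n x' y' \<longleftrightarrow> x = x' \<and> y = y'"
proof
  assume eq: "stack n x y = stack n x' y'"
  have "x t = x' t" for t
    using fun_cong[OF eq, of t] assms[of t] by (cases "t < n") (auto simp: stack_def)
  moreover have "y t = y' t" for t
    using fun_cong[OF eq, of "n + t"] by (simp add: stack_def)
  ultimately show "x = x' \<and> y = y'" by blast
qed simp

lemma weight_stack: "weight (2 * n) (stack n x y) = weight n x + weight n y"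
proof -
  have "weight (2 * n) (stack n x y) = (\<Sum>s = 0..<n + n. stack n x y s)"
    by (simp add: weight_def mult_2 atLeast0LessThan)
  also have "\<dots> = (\<Sum>s = 0..<n. stack n x y s) + (\<Sum>s = n..<n + n. stack n x y s)"
    by (rule sum.atLeastLessThan_concat[symmetric]) auto
  also have "(\<Sum>s = n..<n + n. stack n x y s) = (\<Sum>s = 0..<n. stack n x y (s + n))"
    using sum.shift_bounds_nat_ivl[of "stack n x y" 0 n n] by simp
  finally show ?thesis by (simp add: weight_def stack_def atLeast0LessThan)
qed

lemma hstrip_stack_iff:
  assumes n: "n \<ge> 1"
  shows "hstrip (- {n - 1}) (2 * n) m (stack n x' y') (stack n x y) \<and> (\<forall>t\<ge>n. x t = 0 \<and> x' t = 0) \<longleftrightarrow>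
    (\<exists>a\<le>m. hstrip UNIV n a x' x \<and> hstrip UNIV n (m - a) y' y)"
    (is "?l \<longleftrightarrow> ?r")
proof
  assume ?l
  then have h: "hstrip (- {n - 1}) (2 * n) m (stack n x' y') (stack n x y)"
    and x0: "\<And>t. t \<ge> n \<Longrightarrow> x t = 0 \<and> x' t = 0" by auto
  have bx: "0 \<le> x' t \<and> x' t \<le> x t" for t
    using h x0[of t] unfolding hstrip_def stack_def by (cases "t < n") (auto dest: spec[of _ t])
  have ley: "0 \<le> y' t \<and> y' t \<le> y t" for t
    using h unfolding hstrip_def stack_def by (auto dest!: spec[of _ "n + t"])
  have sx: "x (Suc t) \<le> x' t" for t
  proof (cases "Suc t < n")
    case True
    then have "t \<in> - {n - 1}" by auto
    then have "stack n x y (Suc t) \<le> stack n x' y' t" using h by (simp add: hstrip_def)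
    then show ?thesis using True by (simp add: stack_def)
  next
    case False then show ?thesis using x0[of "Suc t"] bx[of t] by simp
  qed
  have sy: "y (Suc t) \<le> y' t" for t
  proof -
    have "n + t \<in> - {n - 1}" using n by auto
    then have "stack n x y (Suc (n + t)) \<le> stack n x' y' (n + t)" using h by (simp add: hstrip_def)
    then show ?thesis by (simp add: stack_def Suc_diff_le)
  qed
  have y0: "y t = 0" if "t \<ge> n" for t
  proof -
    have "stack n x y (n + t) = 0" using h that by (simp add: hstrip_def)
    then show ?thesis by (simp add: stack_def)
  qed
  have w: "weight n x - weight n x' + (weight n y - weight n y') = int m"
    using h by (simp add: hstrip_def weight_stack)
  have wx: "0 \<le> weight n x - weight n x'" and wy: "0 \<le> weight n y - weight n y'"
    using bx ley by (simp_all add: weight_def sum_mono)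
  let ?a = "nat (weight n x - weight n x')"
  have "hstrip UNIV n ?a x' x \<and> hstrip UNIV n (m - ?a) y' y \<and> ?a \<le> m"
    using bx ley sx sy x0 y0 w wx wy by (simp add: hstrip_def of_nat_diff)
  then show ?r by blast
next
  assume ?r
  then obtain a where a: "a \<le> m" and hx: "hstrip UNIV n a x' x" and hy: "hstrip UNIV n (m - a) y' y"
    by blast
  have "x t = 0 \<and> x' t = 0" if "t \<ge> n" for t
    using hx that unfolding hstrip_def by (metis antisym)
  moreover have "hstrip (- {n - 1}) (2 * n) m (stack n x' y') (stack n x y)"
    unfolding hstrip_def
  proof (intro conjI ballI allI impI)
    fix t
    show "0 \<le> stack n x' y' t" "stack n x' y' t \<le> stack n x y t"
      using hx hy by (auto simp: stack_def hstrip_def)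
  next
    fix t assume "t \<in> - {n - 1}"
    then show "stack n x y (Suc t) \<le> stack n x' y' t"
      using hx hy by (auto simp: stack_def hstrip_def Suc_diff_le)
  next
    fix t assume "2 * n \<le> t"
    then show "stack n x y t = 0" using hy by (auto simp: stack_def hstrip_def)
  next
    show "weight (2 * n) (stack n x y) - weight (2 * n) (stack n x' y') = int m"
      using hx hy a by (simp add: weight_stack hstrip_def of_nat_diff)
  qed
  ultimately show ?l by blast
qed

lemma stack_cases:
  obtains x y where "U = stack n x y" "\<And>t. t \<ge> n \<Longrightarrow> x t = 0"
proof
  show "U = stack n (\<lambda>t. if t < n then U t else 0) (\<lambda>t. U (n + t))"
    by (auto simp: stack_def fun_eq_iff)
qed simp

lemma sum_hstrip_stack:
  assumes n: "n \<ge> 1" and x0: "\<And>t. t \<ge> n \<Longrightarrow> x t = 0"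
  shows "(\<Sum>U | hstrip (- {n - 1}) (2 * n) m U (stack n x y). f U) =
    (\<Sum>a\<le>m. \<Sum>x' | hstrip UNIV n a x' x. \<Sum>y' | hstrip UNIV n (m - a) y' y. f (stack n x' y') :: nat)"
proof -
  let ?P = "SIGMA a : {..m}. {x'. hstrip UNIV n a x' x} \<times> {y'. hstrip UNIV n (m - a) y' y}"
  let ?g = "\<lambda>(a, x', y'). stack n x' y'"
  have x'0: "x' t = 0" if "hstrip UNIV n a x' x" "t \<ge> n" for a x' t
    using that by (rule hstrip_inner_zero)
  have inj: "inj_on ?g ?P"
  proof (rule inj_onI, clarsimp)
    fix a x' y' b x'' y''
    assume h: "hstrip UNIV n a x' x" "hstrip UNIV n b x'' x" "stack n x' y' = stack n x'' y''"
    then have "x' = x'' \<and> y' = y''" using stack_eq_iff[of n x' x'' y' y''] x'0 by blast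
    then show "a = b \<and> x' = x'' \<and> y' = y''" using h(1,2) by (auto simp: hstrip_def)
  qed
  have "?g ` ?P = {U. hstrip (- {n - 1}) (2 * n) m U (stack n x y)}"
  proof (intro equalityI subsetI)
    fix U assume "U \<in> ?g ` ?P"
    then show "U \<in> {U. hstrip (- {n - 1}) (2 * n) m U (stack n x y)}"
      using hstrip_stack_iff[OF n] by fastforce
  next
    fix U assume U: "U \<in> {U. hstrip (- {n - 1}) (2 * n) m U (stack n x y)}"
    obtain x' y' where s: "U = stack n x' y'" "\<And>t. t \<ge> n \<Longrightarrow> x' t = 0"
      using stack_cases[of U n] by blast
    then obtain a where "a \<le> m" "hstrip UNIV n a x' x" "hstrip UNIV n (m - a) y' y"
      using hstrip_stack_iff[OF n, of m x' y' x y] U x0 by auto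
    then have "(a, x', y') \<in> ?P" by simp
    then show "U \<in> ?g ` ?P" using s(1) by force
  qed
  then have "(\<Sum>U | hstrip (- {n - 1}) (2 * n) m U (stack n x y). f U) = (\<Sum>p\<in>?P. f (?g p))"
    using sum.reindex[OF inj, of f] by simp
  also have "\<dots> = (\<Sum>a\<le>m. \<Sum>p \<in> {x'. hstrip UNIV n a x' x} \<times> {y'. hstrip UNIV n (m - a) y' y}.
      f (?g (a, p)))"
    by (subst sum.Sigma) (auto simp: finite_hstrip_inner case_prod_unfold)
  also have "\<dots> = (\<Sum>a\<le>m. \<Sum>x' | hstrip UNIV n a x' x. \<Sum>y' | hstrip UNIV n (m - a) y' y.
      f (stack n x' y'))"
    by (simp add: sum.cartesian_product case_prod_unfold)
  finally show ?thesis .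
qed

text \<open>
  Separating the multiplicity of the largest letter turns the convolution of two series into a recursion on
  the number of letters.
\<close>

lemma sum_submultisets_split:
  fixes M :: "nat multiset"
  assumes M: "\<And>c. c \<in># M \<Longrightarrow> c \<le> N"
  shows "(\<Sum>A | A \<subseteq># M. f A) =
    (\<Sum>a\<le>count M N. \<Sum>A | A \<subseteq># filter_mset (\<lambda>c. c < N) M. f (A + replicate_mset a N) :: nat)"
proof -
  let ?M = "filter_mset (\<lambda>c. c < N) M"
  let ?P = "{..count M N} \<times> {A. A \<subseteq># ?M}"
  let ?g = "\<lambda>(a, A). A + replicate_mset a N"
  have notin: "count A N = 0" if "A \<subseteq># ?M" for A
    using mset_subset_eq_count[OF that, of N] by simp
  have "(\<Sum>A | A \<subseteq># M. f A) = (\<Sum>p\<in>?P. f (?g p))"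
  proof (rule sum.reindex_bij_witness[where i = ?g and j = "\<lambda>A. (count A N, filter_mset (\<lambda>c. c < N) A)"])
    fix A assume "A \<in> {A. A \<subseteq># M}"
    then have A: "A \<subseteq># M" by simp
    have le: "c \<le> N" if "c \<in># A" for c by (rule M[OF mset_subset_eqD[OF A that]])
    show 1: "?g (count A N, filter_mset (\<lambda>c. c < N) A) = A"
    proof (rule multiset_eqI)
      fix c
      show "count (?g (count A N, filter_mset (\<lambda>c. c < N) A)) c = count A c"
        using le[of c] by (cases "c \<in># A") (auto simp: le_less count_eq_zero_iff[THEN iffD2])
    qed
    show "(count A N, filter_mset (\<lambda>c. c < N) A) \<in> ?P"
      using A by (simp add: mset_subset_eq_count multiset_filter_mono)
    show "f (?g (count A N, filter_mset (\<lambda>c. c < N) A)) = f A" using 1 by simp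
  next
    fix p assume "p \<in> ?P"
    then obtain a A where p: "p = (a, A)" "a \<le> count M N" "A \<subseteq># ?M" by auto
    have lt: "c < N" if "c \<in># A" for c using mset_subset_eqD[OF p(3) that] by simp
    have "filter_mset (\<lambda>c. c < N) A = A" using lt by (simp add: filter_mset_eq_conv)
    then show "(count (?g p) N, filter_mset (\<lambda>c. c < N) (?g p)) = p"
      using notin[OF p(3)] by (simp add: p)
    have "?g p \<subseteq># M"
    proof (rule mset_subset_eqI)
      fix c
      show "count (?g p) c \<le> count M c"
        using mset_subset_eq_count[OF p(3), of c] p(2) by (auto simp: p(1) split: if_splits)
    qed
    then show "?g p \<in> {A. A \<subseteq># M}" by simp
  qed
  then show ?thesis by (simp add: sum.cartesian_product case_prod_unfold)
qed

text \<open>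
  A chain of strips on a stack is a pair of chains; the sizes of its strips are sums, which is the convolution
  that defines the product of two series.
\<close>

lemma chain_count_stack:
  assumes n: "n \<ge> 1" and x0: "\<And>t. t \<ge> n \<Longrightarrow> x t = 0" and r0: "\<And>t. t \<ge> n \<Longrightarrow> r t = 0"
    and M: "\<And>c. c \<in># M \<Longrightarrow> c < N"
  shows "chain_count (- {n - 1}) (2 * n) (letter_counts N M) (stack n r s) (stack n x y) =
    (\<Sum>A | A \<subseteq># M. chain_count UNIV n (letter_counts N A) r x *
                     chain_count UNIV n (letter_counts N (M - A)) s y)"
  using x0 M
proof (induction N arbitrary: M x y)
  case 0
  have "M = {#}" using 0(2) by (metis multiset_nonemptyE not_less0)
  moreover have "{A. A \<subseteq># {#}} = {{#} :: nat multiset}" by auto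
  ultimately show ?case
    using stack_eq_iff[of n r x s y] r0 0(1) by (simp add: letter_counts_def)
next
  case (Suc N)
  let ?M = "filter_mset (\<lambda>c. c < N) M"
  let ?c = "chain_count UNIV n"
  have counts: "letter_counts (Suc N) A = count A N # letter_counts N A" for A
    by (simp add: letter_counts_def)
  have cong: "letter_counts N A = letter_counts N B" if "\<And>c. c < N \<Longrightarrow> count A c = count B c" for A B
    using that by (simp add: letter_counts_def)
  have "chain_count (- {n - 1}) (2 * n) (letter_counts (Suc N) M) (stack n r s) (stack n x y) =
      (\<Sum>a\<le>count M N. \<Sum>x' | hstrip UNIV n a x' x. \<Sum>y' | hstrip UNIV n (count M N - a) y' y.
         chain_count (- {n - 1}) (2 * n) (letter_counts N ?M) (stack n r s) (stack n x' y'))"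
    unfolding counts chain_count.simps cong[of M ?M, simplified]
    using Suc.prems(1) by (intro sum_hstrip_stack n) auto
  also have "\<dots> = (\<Sum>a\<le>count M N. \<Sum>x' | hstrip UNIV n a x' x. \<Sum>y' | hstrip UNIV n (count M N - a) y' y.
      \<Sum>A | A \<subseteq># ?M. ?c (letter_counts N A) r x' * ?c (letter_counts N (?M - A)) s y')"
  proof (intro sum.cong refl Suc.IH)
    fix a x' t assume "x' \<in> {x'. hstrip UNIV n a x' x}" "n \<le> t"
    then show "x' t = 0" using hstrip_inner_zero by blast
  qed simp
  also have "\<dots> = (\<Sum>a\<le>count M N. \<Sum>A | A \<subseteq># ?M.
      (\<Sum>x' | hstrip UNIV n a x' x. ?c (letter_counts N A) r x') *
      (\<Sum>y' | hstrip UNIV n (count M N - a) y' y. ?c (letter_counts N (?M - A)) s y'))"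
    by (simp add: sum_product sum.swap[of _ "{A. A \<subseteq># ?M}"])
  also have "\<dots> = (\<Sum>a\<le>count M N. \<Sum>A | A \<subseteq># ?M.
      ?c (letter_counts (Suc N) (A + replicate_mset a N)) r x *
      ?c (letter_counts (Suc N) (M - (A + replicate_mset a N))) s y)"
  proof (intro sum.cong refl)
    fix a A assume a: "a \<in> {..count M N}" and "A \<in> {A. A \<subseteq># ?M}"
    then have A: "A \<subseteq># ?M" by simp
    have "count A N = 0" using mset_subset_eq_count[OF A, of N] by simp
    then have "letter_counts (Suc N) (A + replicate_mset a N) = a # letter_counts N A"
      "letter_counts (Suc N) (M - (A + replicate_mset a N)) =
        (count M N - a) # letter_counts N (?M - A)"
      unfolding counts by (simp_all add: letter_counts_def)
    then show "(\<Sum>x' | hstrip UNIV n a x' x. ?c (letter_counts N A) r x') *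
      (\<Sum>y' | hstrip UNIV n (count M N - a) y' y. ?c (letter_counts N (?M - A)) s y') =
      ?c (letter_counts (Suc N) (A + replicate_mset a N)) r x *
      ?c (letter_counts (Suc N) (M - (A + replicate_mset a N))) s y" by simp
  qed
  also have "\<dots> = (\<Sum>A | A \<subseteq># M. ?c (letter_counts (Suc N) A) r x * ?c (letter_counts (Suc N) (M - A)) s y)"
    using Suc.prems(2) by (intro sum_submultisets_split[symmetric]) (simp add: less_Suc_eq_le)
  finally show ?case .
qed

lemma skew_schur_product_eq_chain_count:
  assumes n: "n \<ge> 1" and "is_partition n la" "is_partition n mu" "is_partition n nu" "is_partition n rh"
    and M: "\<And>c. c \<in># M \<Longrightarrow> c < N"
  shows "series_mult (skew_schur la mu) (skew_schur nu rh) M =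
    int (chain_count (- {n - 1}) (2 * n) (letter_counts N M)
      (stack n (row_lengths mu) (row_lengths rh)) (stack n (row_lengths la) (row_lengths nu)))"
proof -
  have "series_mult (skew_schur la mu) (skew_schur nu rh) M =
    (\<Sum>A | A \<subseteq># M. int (chain_count UNIV n (letter_counts N A) (row_lengths mu) (row_lengths la)) *
      int (chain_count UNIV n (letter_counts N (M - A)) (row_lengths rh) (row_lengths nu)))"
    unfolding series_mult_def
  proof (intro sum.cong refl arg_cong2[where f = "(*)"])
    fix A assume "A \<in> {A. A \<subseteq># M}"
    then have A: "A \<subseteq># M" by simp
    show "skew_schur la mu A = int (chain_count UNIV n (letter_counts N A) (row_lengths mu) (row_lengths la))"
      using assms mset_subset_eqD[OF A] by (intro skew_schur_eq_chain_count[where m = n and m' = n]) auto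
    show "skew_schur nu rh (M - A) =
        int (chain_count UNIV n (letter_counts N (M - A)) (row_lengths rh) (row_lengths nu))"
      using assms in_diffD[of _ M A] by (intro skew_schur_eq_chain_count[where m = n and m' = n]) auto
  qed
  also have "\<dots> = int (chain_count (- {n - 1}) (2 * n) (letter_counts N M)
      (stack n (row_lengths mu) (row_lengths rh)) (stack n (row_lengths la) (row_lengths nu)))"
    using partition_row_lengths(2)[OF assms(2)] partition_row_lengths(2)[OF assms(3)]
    by (subst chain_count_stack[OF n _ _ M]) auto
  finally show ?thesis .
qed

section \<open>Linear independence of Schur functions and the coefficient of a product\<close>


lemma sum_lessThan_support:
  fixes f :: "nat \<Rightarrow> int"
  assumes "\<And>s. s \<ge> a \<Longrightarrow> f s = 0" "\<And>s. s \<ge> b \<Longrightarrow> f s = 0"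
  shows "(\<Sum>s<a. f s) = (\<Sum>s<b. f s)"
proof -
  have "(\<Sum>s<a. f s) = (\<Sum>s<max a b. f s)" using assms(1) by (intro sum.mono_neutral_left) auto
  also have "\<dots> = (\<Sum>s<b. f s)" using assms(2) by (intro sum.mono_neutral_right) auto
  finally show ?thesis .
qed

text \<open>
  After \<open>t\<close> strips a shape has at most \<open>t\<close> rows, so the letters placed so far all lie in the first \<open>t\<close> rows
  of the final shape.
\<close>

lemma chain_count_dominance:
  assumes "chain_count UNIV L ms (\<lambda>_. 0) z \<noteq> 0"
  shows "(\<forall>s\<ge>length ms. z s = 0) \<and> int (sum_list ms) = weight L z \<and>
    (\<forall>t\<le>length ms. int (sum_list (drop (length ms - t) ms)) \<le> (\<Sum>s<t. z s))"
  using assms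
proof (induction ms arbitrary: z)
  case Nil
  then have "z = (\<lambda>_. 0)" by auto
  then show ?case by (simp add: weight_def)
next
  case (Cons m ms)
  then have "(\<Sum>y | hstrip UNIV L m y z. chain_count UNIV L ms (\<lambda>_. 0) y) \<noteq> 0" by simp
  then obtain y where y: "hstrip UNIV L m y z" "chain_count UNIV L ms (\<lambda>_. 0) y \<noteq> 0"
    by (rule sum.not_neutral_contains_not_neutral) blast
  note IH = Cons.IH[OF y(2)]
  have yz: "y s \<le> z s" and zy: "z (Suc s) \<le> y s" and y0: "0 \<le> y s" for s
    using y(1) by (auto simp: hstrip_def)
  have zero: "z s = 0" if "s \<ge> length (m # ms)" for s
  proof -
    obtain r where r: "s = Suc r" "r \<ge> length ms" using \<open>s \<ge> length (m # ms)\<close> by (cases s) auto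
    then show ?thesis using zy[of r] yz[of s] y0[of s] IH by simp
  qed
  have w: "int (sum_list (m # ms)) = weight L z" using IH y(1) by (simp add: hstrip_def)
  have "int (sum_list (drop (length (m # ms) - t) (m # ms))) \<le> (\<Sum>s<t. z s)"
    if t: "t \<le> length (m # ms)" for t
  proof (cases "t = length (m # ms)")
    case True
    have "weight L z = (\<Sum>s<t. z s)"
      unfolding weight_def using zero y(1) True by (intro sum_lessThan_support) (auto simp: hstrip_def)
    then show ?thesis using w True by simp
  next
    case False
    then have t': "t \<le> length ms" and d: "length (m # ms) - t = Suc (length ms - t)" using t by auto
    have "int (sum_list (drop (length ms - t) ms)) \<le> (\<Sum>s<t. y s)" using IH t' by blast
    also have "\<dots> \<le> (\<Sum>s<t. z s)" using yz by (intro sum_mono) auto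
    finally show ?thesis unfolding d by simp
  qed
  then show ?case using zero w by blast
qed

lemma sum_list_letter_counts: "sum_list (letter_counts N M) = (\<Sum>s<N. count M s)"
  by (induction N) (auto simp: letter_counts_def)

lemma length_letter_counts: "length (letter_counts N M) = N"
  by (simp add: letter_counts_def)

lemma drop_letter_counts: "t \<le> N \<Longrightarrow> drop (N - t) (letter_counts N M) = letter_counts t M"
proof (induction N)
  case (Suc N)
  then show ?case
    by (cases "t = Suc N") (auto simp: letter_counts_def Suc_diff_le)
qed (simp add: letter_counts_def)

text \<open>
  The monomial in which letter \<open>s\<close> occurs as often as row \<open>s\<close> has cells: the leading monomial of the Schur
  function.
\<close>

lemma obtain_row_content:
  obtains M where "\<And>s. int (count M s) = row_lengths la s"
proof
  fix s
  show "int (count (\<Sum>i<length la. replicate_mset (la ! i) i) s) = row_lengths la s"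
    by (simp add: count_sum row_lengths_def nth_default_def if_distrib sum.delta cong: if_cong)
qed

lemma is_partition_Nil: "is_partition 0 []"
  by (simp add: is_partition_def)

lemma row_lengths_Nil: "row_lengths [] = (\<lambda>_. 0)"
  by (simp add: row_lengths_def fun_eq_iff)

lemma schur_eq_chain_count:
  assumes "is_partition m la" "m \<le> L" "\<And>c. c \<in># M \<Longrightarrow> c < N"
  shows "schur la M = int (chain_count UNIV L (letter_counts N M) (\<lambda>_. 0) (row_lengths la))"
  using skew_schur_eq_chain_count[OF assms(1,2) is_partition_Nil assms(3)]
  by (simp add: schur_def row_lengths_Nil)

lemma schur_dominance:
  assumes la: "is_partition m la" and ka: "is_partition m' ka"
    and M: "\<And>s. int (count M s) = row_lengths ka s" and nz: "schur la M \<noteq> 0"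
  shows "(\<Sum>s<t. row_lengths ka s) \<le> (\<Sum>s<t. row_lengths la s)"
proof -
  let ?N = "max t m'"
  have "c < ?N" if "c \<in># M" for c
  proof (rule ccontr)
    assume "\<not> c < ?N"
    then have "row_lengths ka c = 0" using partition_row_lengths(2)[OF ka] by simp
    then show False using M[of c] that not_in_iff[of c M] by simp
  qed
  then have "chain_count UNIV m (letter_counts ?N M) (\<lambda>_. 0) (row_lengths la) \<noteq> 0"
    using nz schur_eq_chain_count[OF la order_refl, of M ?N] by simp
  from chain_count_dominance[OF this]
  have "int (sum_list (letter_counts t M)) \<le> (\<Sum>s<t. row_lengths la s)"
    by (auto simp: length_letter_counts dest!: spec[of _ t] simp flip: drop_letter_counts[of t ?N])
  then show ?thesis by (simp add: sum_list_letter_counts M)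
qed

text \<open>
  The witness is the tableau whose row \<open>s\<close> is filled with the letter \<open>s\<close>, as a chain of truncated shapes.
\<close>

lemma schur_leading_coefficient:
  assumes ka: "is_partition m ka" and M: "\<And>s. int (count M s) = row_lengths ka s"
  shows "schur ka M \<noteq> 0"
proof -
  let ?x = "row_lengths ka"
  let ?trunc = "\<lambda>t s. if s < t then ?x s else 0"
  note px = partition_row_lengths[OF ka]
  have "chain_count UNIV m (letter_counts t M) (\<lambda>_. 0) (?trunc t) \<noteq> 0" if "t \<le> m" for t
    using that
  proof (induction t)
    case 0 then show ?case by (simp add: letter_counts_def)
  next
    case (Suc t)
    have "weight m (?trunc (Suc t)) - weight m (?trunc t) = (\<Sum>s<m. if s = t then ?x s else 0)"
      unfolding weight_def sum_subtractf[symmetric] by (intro sum.cong) auto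
    also have "\<dots> = int (count M t)" using Suc.prems by (simp add: M)
    finally have w: "weight m (?trunc (Suc t)) - weight m (?trunc t) = int (count M t)" .
    have h: "hstrip UNIV m (count M t) (?trunc t) (?trunc (Suc t))"
      unfolding hstrip_def using px w Suc.prems by auto
    have "chain_count UNIV m (letter_counts t M) (\<lambda>_. 0) (?trunc t) \<le>
      (\<Sum>y | hstrip UNIV m (count M t) y (?trunc (Suc t)). chain_count UNIV m (letter_counts t M) (\<lambda>_. 0) y)"
      using h finite_hstrip_inner by (intro member_le_sum) auto
    also have "\<dots> = chain_count UNIV m (letter_counts (Suc t) M) (\<lambda>_. 0) (?trunc (Suc t))"
      by (simp add: letter_counts_def)
    finally show ?case using Suc by simp
  qed
  moreover have "?trunc m = ?x" using px(2) by (auto simp: fun_eq_iff not_less)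
  ultimately have "chain_count UNIV m (letter_counts m M) (\<lambda>_. 0) ?x \<noteq> 0" by (metis order_refl)
  moreover have "c < m" if "c \<in># M" for c
  proof (rule ccontr)
    assume "\<not> c < m"
    then have "?x c = 0" using px(2) by simp
    then show False using M[of c] that not_in_iff[of c M] by simp
  qed
  ultimately show ?thesis using schur_eq_chain_count[OF ka order_refl, of M m] by simp
qed

lemma schur_cong: "row_lengths la = row_lengths ka \<Longrightarrow> schur la = schur ka"
proof -
  assume "row_lengths la = row_lengths ka"
  then have "nth_default 0 la = nth_default 0 ka" by (auto simp: row_lengths_def fun_eq_iff)
  then have "part_le [] la = part_le [] ka" "cells la [] = cells ka []"
    by (auto simp: part_le_def cells_def)
  then show ?thesis by (simp add: schur_def skew_schur_def ssyt_def fun_eq_iff)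
qed

lemma row_lengths_eqI:
  assumes "\<And>t. (\<Sum>s<t. row_lengths la s) = (\<Sum>s<t. row_lengths ka s)"
  shows "row_lengths la = row_lengths ka"
proof
  fix s show "row_lengths la s = row_lengths ka s" using assms[of s] assms[of "Suc s"] by simp
qed

lemma schur_inject:
  assumes "is_partition m la" "is_partition m' ka" "schur la = schur ka"
  shows "row_lengths la = row_lengths ka"
proof (rule row_lengths_eqI)
  fix t
  obtain M where M: "\<And>s. int (count M s) = row_lengths ka s" using obtain_row_content by blast
  obtain M' where M': "\<And>s. int (count M' s) = row_lengths la s" using obtain_row_content by blast
  have "schur la M \<noteq> 0" "schur ka M' \<noteq> 0"
    using schur_leading_coefficient[OF assms(2) M] schur_leading_coefficient[OF assms(1) M'] assms(3) by auto
  then show "(\<Sum>s<t. row_lengths la s) = (\<Sum>s<t. row_lengths ka s)"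
    using schur_dominance[OF assms(1,2) M, of t] schur_dominance[OF assms(2,1) M', of t] by simp
qed

lemma row_lengths_inject:
  assumes r: "row_lengths la = row_lengths ka" and len: "length la = length ka"
  shows "la = ka"
proof (rule nth_equalityI[OF len])
  fix i assume "i < length la"
  then show "la ! i = ka ! i" using fun_cong[OF r, of i] len by (simp add: row_lengths_def nth_default_def)
qed

lemma sum_fun_apply: "(\<Sum>i\<in>I. f i) x = (\<Sum>i\<in>I. f i x :: int)"
  by (induction I rule: infinite_finite_induct) auto

text \<open>
  In a vanishing combination, take a shape with nonzero coefficient that is maximal for dominance and look
  at its leading monomial. By \<open>schur_dominance\<close> it occurs in no other term with nonzero coefficient.
\<close>

lemma independent_schur_basis: "series.independent schur_basis"
  unfolding series.independent_explicit_module
proof (intro allI impI)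
  fix B u v
  assume B: "finite B" "B \<subseteq> schur_basis" "(\<Sum>w\<in>B. series_scale (u w) w) = 0" and v: "v \<in> B"
  show "u v = 0"
  proof (rule ccontr)
    assume uv: "u v \<noteq> 0"
    have "\<exists>la m. is_partition m la \<and> schur la = w" if "w \<in> B" for w
      using B(2) that unfolding schur_basis_def by blast
    then obtain la m where la: "\<And>w. w \<in> B \<Longrightarrow> is_partition (m w) (la w) \<and> schur (la w) = w"
      by metis
    define D where "D w t = (\<Sum>s<t. row_lengths (la w) s)" for w t
    define K where "K = Max (m ` B)"
    have K: "m w \<le> K" if "w \<in> B" for w using B(1) that by (simp add: K_def)
    \<comment> \<open>a strictly monotone function for dominance, so that its maximum picks a dominance-maximal shape\<close>
    define F where "F w = (\<Sum>t\<le>K. D w t)" for w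
    let ?A = "{w \<in> B. u w \<noteq> 0}"
    have A: "finite (F ` ?A)" "F ` ?A \<noteq> {}" using B(1) v uv by auto
    obtain w where w: "w \<in> ?A" "F w = Max (F ` ?A)" using Max_in[OF A] by auto
    have top: "F w' \<le> F w" if "w' \<in> ?A" for w' using A that w(2) by simp
    obtain M where M: "\<And>s. int (count M s) = row_lengths (la w) s" using obtain_row_content by blast
    have wB: "w \<in> B" using w by simp
    have other: "u w' * w' M = 0" if w': "w' \<in> B" "w' \<noteq> w" for w'
    proof (rule ccontr)
      assume "u w' * w' M \<noteq> 0"
      then have A': "w' \<in> ?A" and nz: "schur (la w') M \<noteq> 0" using w' la by auto
      have le: "D w t \<le> D w' t" for t
        using schur_dominance[OF _ _ M nz] la[OF w'(1)] la[OF wB] unfolding D_def by blast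
      have eq: "D w t = D w' t" if "t \<le> K" for t
      proof (rule ccontr)
        assume "D w t \<noteq> D w' t"
        then have "D w t < D w' t" using le[of t] by simp
        then have "F w < F w'" unfolding F_def using le that by (intro sum_strict_mono_ex1) auto
        then show False using top[OF A'] by simp
      qed
      have "row_lengths (la w) s = row_lengths (la w') s" for s
      proof (cases "s < K")
        case True
        then show ?thesis using eq[of s] eq[of "Suc s"] by (simp add: D_def)
      next
        case False
        then show ?thesis
          using partition_row_lengths(2) la[OF w'(1)] la[OF wB] K[OF w'(1)] K[OF wB]
          by (metis not_less order_trans)
      qed
      then have "schur (la w) = schur (la w')" by (intro schur_cong) blast
      then show False using la[OF w'(1)] la[OF wB] w'(2) by simp
    qed
    have "0 = (\<Sum>w'\<in>B. series_scale (u w') w') M" using B(3) by simp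
    also have "\<dots> = (\<Sum>w'\<in>B. u w' * w' M)" by (simp add: sum_fun_apply series_scale_def)
    also have "\<dots> = u w * w M"
      using sum.remove[OF B(1) wB, of "\<lambda>w'. u w' * w' M"] sum.neutral[of "B - {w}" "\<lambda>w'. u w' * w' M"] other
      by simp
    finally have "w M = 0" using w by simp
    then show False using schur_leading_coefficient[OF _ M] la[OF wB] by metis
  qed
qed

lemma schur_coeff_expansion:
  assumes K: "finite K" "\<And>la. la \<in> K \<Longrightarrow> is_partition m la" and ka: "is_partition m ka"
  shows "schur_coeff (\<Sum>la\<in>K. series_scale (c la) (schur la)) ka = (if ka \<in> K then c ka else 0)"
proof -
  have inb: "schur la \<in> schur_basis" if "la \<in> K" for la
    using K that by (auto simp: schur_basis_def)
  have inj: "schur ka = schur la \<longleftrightarrow> la = ka" if "la \<in> K" for la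
  proof
    assume "schur ka = schur la"
    then have "schur la = schur ka" ..
    then have r: "row_lengths la = row_lengths ka" using schur_inject K(2)[OF that] ka by blast
    show "la = ka"
      using row_lengths_inject[OF r] K(2)[OF that] ka by (simp add: is_partition_def)
  qed simp
  have "schur_coeff (\<Sum>la\<in>K. series_scale (c la) (schur la)) ka =
      (\<Sum>la\<in>K. c la * series.representation schur_basis (schur la) (schur ka))"
    using inb by (simp add: schur_coeff_def series.representation_sum[OF independent_schur_basis]
        series.representation_scale[OF independent_schur_basis] series.span_base series.span_scale)
  also have "\<dots> = (\<Sum>la\<in>K. if la = ka then c ka else 0)"
    using inb inj by (intro sum.cong) (auto simp: series.representation_basis[OF independent_schur_basis])
  finally show ?thesis using K(1) by simp
qed

lemma obtain_partition_list:
  assumes "z \<in> partitions_of L w"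
  obtains ka where "is_partition L ka" "row_lengths ka = z"
proof
  have dec: "z s' \<le> z s" if "s \<le> s'" for s s'
    using assms that by (intro lift_Suc_antimono_le[of z s s']) (auto simp: partitions_of_def)
  have nn: "0 \<le> z s" for s
    using dec[of s "max s L"] assms by (simp add: partitions_of_def)
  let ?ka = "map (\<lambda>s. nat (z s)) [0..<L]"
  show "is_partition L ?ka"
    using dec by (auto simp: is_partition_def sorted_wrt_iff_nth_less intro!: nat_mono)
  show "row_lengths ?ka = z"
    using nn assms by (auto simp: row_lengths_def nth_default_def partitions_of_def fun_eq_iff)
qed

text \<open>
  A Littlewood--Richardson rule for the product of two skew Schur functions: the ballot conditions pair up rows of \<open>la/mu\<close> and
  rows of \<open>nu/rh\<close>, but not row \<open>n - 1\<close> with row \<open>n\<close>.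
\<close>

theorem schur_coeff_product_eq_ballot_patterns:
  assumes n: "n \<ge> 1" and la: "is_partition n la" and mu: "is_partition n mu"
    and nu: "is_partition n nu" and rh: "is_partition n rh" and ka: "is_partition (2 * n) ka"
  shows "schur_coeff (series_mult (skew_schur la mu) (skew_schur nu rh)) ka =
    int (card (ballot_patterns (- {n - 1}) (2 * n) (stack n (row_lengths mu) (row_lengths rh))
      (stack n (row_lengths la) (row_lengths nu)) (row_lengths ka)))"
proof -
  let ?R = "stack n (row_lengths mu) (row_lengths rh)"
  let ?U = "stack n (row_lengths la) (row_lengths nu)"
  let ?L = "2 * n"
  let ?b = "\<lambda>z. card (ballot_patterns (- {n - 1}) ?L ?R ?U z)"
  let ?P = "partitions_of ?L (weight ?L ?U - weight ?L ?R)"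
  let ?K = "{ka. is_partition ?L ka \<and> row_lengths ka \<in> ?P}"
  have inj: "inj_on row_lengths ?K"
    by (rule inj_onI, rule row_lengths_inject) (simp_all add: is_partition_def)
  have img: "row_lengths ` ?K = ?P"
  proof (intro equalityI subsetI)
    fix z assume z: "z \<in> ?P"
    then obtain a where "is_partition ?L a" "row_lengths a = z" by (rule obtain_partition_list)
    then show "z \<in> row_lengths ` ?K" using z by blast
  qed blast
  have reindex: "(\<Sum>z\<in>?P. g z) = (\<Sum>ka\<in>?K. g (row_lengths ka))" for g :: "_ \<Rightarrow> nat"
    using sum.reindex[OF inj, of g] unfolding img by (simp only: o_def)
  have finK: "finite ?K" 
    by (rule finite_imageD[OF _ inj]) (simp only: img finite_partitions_of)
  have R: "0 \<le> ?R t" "t \<ge> ?L \<Longrightarrow> ?R t = 0" "t \<in> - {n - 1} \<Longrightarrow> ?R (Suc t) \<le> ?R t" for t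
    using partition_row_lengths[OF mu] partition_row_lengths[OF rh]
    by (auto simp: stack_def Suc_diff_le)
  have U: "t \<ge> ?L \<Longrightarrow> ?U t = 0" for t
    using partition_row_lengths[OF nu] by (auto simp: stack_def)
  have "series_mult (skew_schur la mu) (skew_schur nu rh) M =
      (\<Sum>ka\<in>?K. series_scale (int (?b (row_lengths ka))) (schur ka)) M" for M
  proof -
    \<comment> \<open>any bound for the letters of \<open>M\<close> will do\<close>
    define N where "N = Suc (Max (set_mset M))"
    have M: "c < N" if "c \<in># M" for c using that by (simp add: N_def less_Suc_eq_le)
    let ?l = "letter_counts N M"
    have "series_mult (skew_schur la mu) (skew_schur nu rh) M = int (chain_count (- {n - 1}) ?L ?l ?R ?U)"
      by (rule skew_schur_product_eq_chain_count[OF n la mu nu rh M])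
    also have "\<dots> = int (\<Sum>z\<in>?P. ?b z * chain_count UNIV ?L (rev ?l) (\<lambda>_. 0) z)"
      using ballot_patterns_count[where R = ?R and L = ?L and S = "- {n - 1}" and U = ?U
          and ms = "rev ?l", OF R U] by (simp only: rev_rev_ident)
    also have "\<dots> = int (\<Sum>ka\<in>?K. ?b (row_lengths ka) * chain_count UNIV ?L ?l (\<lambda>_. 0) (row_lengths ka))"
      unfolding reindex chain_count_rev ..
    also have "\<dots> = (\<Sum>ka\<in>?K. int (?b (row_lengths ka)) * schur ka M)"
      unfolding of_nat_sum of_nat_mult
      using schur_eq_chain_count[of ?L _ ?L M N] M by (intro sum.cong) auto
    finally show ?thesis by (simp add: sum_fun_apply series_scale_def)
  qed
  then have "series_mult (skew_schur la mu) (skew_schur nu rh) =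
      (\<Sum>ka\<in>?K. series_scale (int (?b (row_lengths ka))) (schur ka))" by blast
  then have "schur_coeff (series_mult (skew_schur la mu) (skew_schur nu rh)) ka =
      (if ka \<in> ?K then int (?b (row_lengths ka)) else 0)"
    using schur_coeff_expansion[OF finK _ ka] by simp
  also have "\<dots> = int (?b (row_lengths ka))"
  proof (cases "ka \<in> ?K")
    case False
    then have "row_lengths ka \<notin> ?P" using ka by simp
    then have "ballot_patterns (- {n - 1}) ?L ?R ?U (row_lengths ka) = {}"
      using gt_patterns_shape[of _ ?L "\<lambda>t. ?U t - ?R t" "row_lengths ka"]
      by (auto simp: ballot_patterns_def weight_def sum_subtractf)
    then show ?thesis by simp
  qed simp
  finally show ?thesis .
qed

section \<open>Patterns of all phases are equinumerous\<close>


text \<open>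
  Letter \<open>t\<close> of \<open>P_k\<close>, for \<open>k > 0\<close>, is \<open>West\<close>. The strip between the levels \<open>t\<close> and \<open>t + 1\<close> then belongs to
  the first skew shape.
\<close>

definition west :: "nat \<Rightarrow> nat \<Rightarrow> nat \<Rightarrow> bool" where
  "west n k t \<longleftrightarrow> t < k \<or> t < 2 * n - k \<and> odd (t - k)"

text \<open>
  The shuffle \<open>x \<circledast>\<^sub>k y\<close> as an explicit function of the position.
\<close>

definition interleave :: "nat \<Rightarrow> nat \<Rightarrow> (nat \<Rightarrow> int) \<Rightarrow> (nat \<Rightarrow> int) \<Rightarrow> nat \<Rightarrow> int" where
  "interleave n k x y t = (if t < k then x t
     else if t < 2 * n - k then (if even (t - k) then y ((t - k) div 2) else x (k + (t - k) div 2))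
     else y (t - n))"

text \<open>
  Two strips with the same letter are compared if they are adjacent or if a single strip with the other
  letter separates them. These are all pairs of consecutive rows of the same shape.
\<close>

definition phase_conditions :: "nat \<Rightarrow> nat \<Rightarrow> (nat \<Rightarrow> int) \<Rightarrow> (nat \<Rightarrow> nat \<Rightarrow> int) \<Rightarrow> bool" where
  "phase_conditions n k R a \<longleftrightarrow>
     (\<forall>t. t + 2 \<le> 2 * n \<and> west n k t = west n k (Suc t) \<longrightarrow>
        ballot (R t - R (Suc t)) (a t) (a (Suc t)) (a (t + 2))) \<and>
     (\<forall>t. t + 3 \<le> 2 * n \<and> west n k t \<noteq> west n k (Suc t) \<and> west n k (Suc t) \<noteq> west n k (t + 2) \<longrightarrow>
        spread_ballot (R t - R (t + 2)) (a t) (a (Suc t)) (a (t + 2)) (a (t + 3)))"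

definition phased_patterns ::
  "nat \<Rightarrow> nat \<Rightarrow> (nat \<Rightarrow> int) \<Rightarrow> (nat \<Rightarrow> int) \<Rightarrow> (nat \<Rightarrow> int) \<Rightarrow> (nat \<Rightarrow> nat \<Rightarrow> int) set" where
  "phased_patterns n k R U z =
     {a \<in> gt_patterns (2 * n) (\<lambda>t. U t - R t) z. phase_conditions n k R a}"

lemma west_Suc_iff:
  assumes k: "1 \<le> k" "k \<le> n"
  shows "west n k t = west n k (Suc t) \<longleftrightarrow> Suc t < k \<or> 2 * n - k \<le> t"
proof (cases "Suc t < k \<or> 2 * n - k \<le> t")
  case True then show ?thesis using k by (auto simp: west_def)
next
  case False
  consider "Suc t = k" | "k \<le> t" "Suc t < 2 * n - k" | "k \<le> t" "Suc t = 2 * n - k"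
    using False by linarith
  then have "west n k t \<noteq> west n k (Suc t)"
  proof cases
    case 1 then show ?thesis by (auto simp: west_def)
  next
    case 2 then show ?thesis by (auto simp: west_def Suc_diff_le)
  next
    case 3
    then have "t - k = 2 * (n - k - 1) + 1" using k by linarith
    then have "odd (t - k)" by simp
    then show ?thesis using 3 k by (auto simp: west_def)
  qed
  then show ?thesis using False by blast
qed

text \<open>
  The path alternates exactly between the positions \<open>k - 1\<close> and \<open>2 n - k\<close>, so the three families are the
  initial run of \<open>West\<close>, the zigzag and the final run of \<open>North\<close>.
\<close>

lemma phase_conditions_iff:
  assumes k: "1 \<le> k" "k \<le> n"
  shows "phase_conditions n k R a \<longleftrightarrow>
    (\<forall>t. Suc t < k \<longrightarrow> ballot (R t - R (Suc t)) (a t) (a (Suc t)) (a (t + 2))) \<and>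
    (\<forall>t. k \<le> Suc t \<and> t + 2 \<le> 2 * n - k \<longrightarrow>
       spread_ballot (R t - R (t + 2)) (a t) (a (Suc t)) (a (t + 2)) (a (t + 3))) \<and>
    (\<forall>t. 2 * n - k \<le> t \<and> t + 2 \<le> 2 * n \<longrightarrow> ballot (R t - R (Suc t)) (a t) (a (Suc t)) (a (t + 2)))"
proof -
  have 1: "t + 2 \<le> 2 * n \<and> west n k t = west n k (Suc t) \<longleftrightarrow>
      Suc t < k \<or> 2 * n - k \<le> t \<and> t + 2 \<le> 2 * n" for t
    unfolding west_Suc_iff[OF k] using k by auto
  have 2: "t + 3 \<le> 2 * n \<and> west n k t \<noteq> west n k (Suc t) \<and> west n k (Suc t) \<noteq> west n k (t + 2) \<longleftrightarrow>
      k \<le> Suc t \<and> t + 2 \<le> 2 * n - k" for t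
    using west_Suc_iff[OF k, of t] west_Suc_iff[OF k, of "Suc t"] k by auto
  show ?thesis unfolding phase_conditions_def 1 2 by blast
qed

text \<open>
  The path \<open>P_(k+1)\<close> is \<open>W\<^sup>k (W N)\<^bsup>n-k\<^esup> N\<^sup>k\<close>, and \<open>P_k\<close> is
  \<open>W\<^sup>k (N W)\<^bsup>n-k\<^esup> N\<^sup>k\<close>. The levels in the middle of the \<open>n - k\<close> blocks
  \<open>W N\<close> are \<open>k + 1, k + 3, \<dots>, 2 n - k - 1\<close>. They are toggled simultaneously, as none of them is next to
  another.
\<close>

definition toggle_odd :: "nat \<Rightarrow> nat \<Rightarrow> (nat \<Rightarrow> nat \<Rightarrow> int) \<Rightarrow> nat \<Rightarrow> nat \<Rightarrow> int" where
  "toggle_odd n k a t = (if k < t \<and> t < 2 * n - k \<and> odd (t - k)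
     then toggle (a (t - 1)) (a (t + 1)) (a t) else a t)"

lemma toggle_odd_simps:
  assumes "k \<le> n"
  shows "q < n - k \<Longrightarrow> toggle_odd n k a (k + 2 * q + 1) =
      toggle (a (k + 2 * q)) (a (k + 2 * q + 2)) (a (k + 2 * q + 1))"
    and "toggle_odd n k a (k + 2 * q) = a (k + 2 * q)"
    and "t \<le> k \<or> 2 * n - k \<le> t \<Longrightarrow> toggle_odd n k a t = a t"
  using assms by (auto simp: toggle_odd_def)

text \<open>
  Outside the zigzag, first strip of a block, second strip of a block.
\<close>

lemma toggle_odd_cases:
  assumes "k \<le> (n::nat)"
  obtains "t < k \<or> 2 * n - k \<le> t" | q where "q < n - k" "t = k + 2 * q" | q where "q < n - k" "t = k + 2 * q + 1"
proof (cases "t < k \<or> 2 * n - k \<le> t")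
  case False
  then have t: "t = k + 2 * ((t - k) div 2) \<or> t = k + 2 * ((t - k) div 2) + 1" by presburger
  moreover have "(t - k) div 2 < n - k" using False by auto
  ultimately show ?thesis using that by blast
qed (use that in blast)

lemma toggle_odd_toggle_odd:
  assumes "k \<le> n"
  shows "toggle_odd n k (toggle_odd n k a) = a"
proof
  fix t
  show "toggle_odd n k (toggle_odd n k a) t = a t"
  proof (rule toggle_odd_cases[OF assms, of t])
    fix q assume q: "q < n - k" "t = k + 2 * q + 1"
    have "toggle_odd n k a (k + 2 * q + 2) = a (k + 2 * q + 2)"
      using toggle_odd_simps(2)[OF assms, of a "q + 1"] by simp
    then show ?thesis unfolding q(2) toggle_odd_simps(1)[OF assms q(1)] toggle_odd_simps(2)[OF assms]
      by (simp add: toggle_toggle)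
  qed (use toggle_odd_simps(2,3)[OF assms] in auto)
qed

lemma toggle_odd_gt_patterns:
  assumes k: "k \<le> n"
    and c: "\<And>q. q < n - k \<Longrightarrow> c' (k + 2 * q) = c (k + 2 * q + 1)"
      "\<And>q. q < n - k \<Longrightarrow> c' (k + 2 * q + 1) = c (k + 2 * q)"
      "\<And>t. t < k \<or> 2 * n - k \<le> t \<Longrightarrow> c' t = c t"
    and a: "a \<in> gt_patterns (2 * n) c z"
  shows "toggle_odd n k a \<in> gt_patterns (2 * n) c' z"
proof -
  let ?b = "toggle_odd n k a"
  have ia: "interlaces (a t) (a (Suc t))" and wa: "weight (2 * n) (a (Suc t)) - weight (2 * n) (a t) = c t"
    if "t < 2 * n" for t using a that by (auto simp: gt_patterns_def)
  have za: "\<forall>s\<ge>2 * n. a t s = 0" if "t \<le> 2 * n" for t using gt_pattern_zero[OF a that] that by auto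
  note simps = toggle_odd_simps[OF k]
  have even2: "?b (k + 2 * q + 2) = a (k + 2 * q + 2)" for q using simps(2)[of a "q + 1"] by simp
  have "interlaces (?b t) (?b (Suc t)) \<and> weight (2 * n) (?b (Suc t)) - weight (2 * n) (?b t) = c' t"
    if t: "t < 2 * n" for t
  proof (rule toggle_odd_cases[OF k, of t])
    assume out: "t < k \<or> 2 * n - k \<le> t"
    then have "?b t = a t" "?b (Suc t) = a (Suc t)" using simps(3)[of t a] simps(3)[of "Suc t" a] by auto
    then show ?thesis using ia wa t c(3)[OF out] by simp
  next
    fix q assume q: "q < n - k" "t = k + 2 * q"
    have le: "k + 2 * q + 2 \<le> 2 * n" using q k by linarith
    have i: "interlaces (a (k + 2 * q)) (a (k + 2 * q + 1))" "interlaces (a (k + 2 * q + 1)) (a (k + 2 * q + 2))"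
      using ia[of "k + 2 * q"] ia[of "k + 2 * q + 1"] le by auto
    show ?thesis
      using interlaces_toggle(1)[OF i] weight_toggle[OF i za[OF le]] wa[of "k + 2 * q + 1"] le
        simps(1)[OF q(1), of a] simps(2)[of a q] c(1)[OF q(1)] by (simp add: q(2))
  next
    fix q assume q: "q < n - k" "t = k + 2 * q + 1"
    have le: "k + 2 * q + 2 \<le> 2 * n" using q k by linarith
    have i: "interlaces (a (k + 2 * q)) (a (k + 2 * q + 1))" "interlaces (a (k + 2 * q + 1)) (a (k + 2 * q + 2))"
      using ia[of "k + 2 * q"] ia[of "k + 2 * q + 1"] le by auto
    show ?thesis
      using interlaces_toggle(2)[OF i] weight_toggle[OF i za[OF le]] wa[of "k + 2 * q"] le
        simps(1)[OF q(1), of a] even2[of q] c(2)[OF q(1)] by (simp add: q(2))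
  qed
  moreover have "?b t = z" if "t \<ge> 2 * n" for t
  proof -
    have "t \<le> k \<or> 2 * n - k \<le> t" using that by linarith
    then show ?thesis using simps(3)[of t a] a that by (simp add: gt_patterns_def)
  qed
  ultimately show ?thesis using a simps(3)[of 0 a] by (simp add: gt_patterns_def)
qed

lemma interleave_block:
  assumes "k \<le> n" "q < n - k"
  shows "interleave n k x y (k + 2 * q) = y q" "interleave n k x y (k + 2 * q + 1) = x (k + q)"
  using assms by (auto simp: interleave_def)

lemma interleave_Suc_block:
  assumes "k < n" "q < n - k"
  shows "interleave n (Suc k) x y (k + 2 * q) = x (k + q)" "interleave n (Suc k) x y (k + 2 * q + 1) = y q"
proof -
  show "interleave n (Suc k) x y (k + 2 * q) = x (k + q)"
  proof (cases q)
    case (Suc p)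
    then have "k + 2 * q - Suc k = 2 * p + 1" by simp
    moreover have "k + 2 * q < 2 * n - Suc k" using assms by linarith
    ultimately show ?thesis using Suc by (simp add: interleave_def)
  qed (simp add: interleave_def)
  show "interleave n (Suc k) x y (k + 2 * q + 1) = y q"
  proof (cases "q + 1 = n - k")
    case True
    have "k + 2 * q + 1 - n = q" "\<not> k + 2 * q + 1 < 2 * n - Suc k"
      using assms True by linarith+
    then show ?thesis by (simp add: interleave_def)
  next
    case False
    then have "k + 2 * q + 1 < 2 * n - Suc k" using assms by linarith
    then show ?thesis by (simp add: interleave_def)
  qed
qed

lemma interleave_Suc_outside:
  assumes "k < n" "t < k \<or> 2 * n - k \<le> t"
  shows "interleave n (Suc k) x y t = interleave n k x y t"
  using assms by (auto simp: interleave_def)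

text \<open>
  Every condition of phase \<open>k + 1\<close> is transported to one of phase \<open>k\<close> by moving from the four rows of a spread
  condition to the three rows of a ballot condition and back: toggling one of the inner rows removes the
  separating strip, and a second toggle of an outer row inserts one on the other side. At the two ends of
  the zigzag one of these moves is missing, and a ballot condition of phase \<open>k + 1\<close> becomes a spread
  condition of phase \<open>k\<close>.
\<close>

lemma phase_conditions_toggle_odd:
  assumes k: "1 \<le> k" "k < n"
  shows "phase_conditions n (Suc k) (interleave n (Suc k) x y) a \<longleftrightarrow>
    phase_conditions n k (interleave n k x y) (toggle_odd n k a)"
proof -
  let ?b = "toggle_odd n k a"
  let ?R = "interleave n k x y" and ?R' = "interleave n (Suc k) x y"
  let ?C = "\<lambda>R a t. ballot (R t - R (Suc t)) (a t) (a (Suc t)) (a (t + 2))"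
  let ?B = "\<lambda>R a t. spread_ballot (R t - R (t + 2)) (a t) (a (Suc t)) (a (t + 2)) (a (t + 3))"
  have kn: "k \<le> n" using k by simp
  note simps = toggle_odd_simps[OF kn]
  note blk = interleave_block[OF kn] and blk' = interleave_Suc_block[OF k(2)]
  have odd: "a (k + 2 * q + 1) = toggle (?b (k + 2 * q)) (?b (k + 2 * q + 2)) (?b (k + 2 * q + 1))"
    "?b (k + 2 * q + 1) = toggle (a (k + 2 * q)) (a (k + 2 * q + 2)) (a (k + 2 * q + 1))"
    if "q < n - k" for q
    using simps(1)[OF that, of ?b] simps(1)[OF that, of a] toggle_odd_toggle_odd[OF kn, of a] by simp_all
  have even: "?b (k + 2 * q) = a (k + 2 * q)" for q by (rule simps(2))
  have even2: "?b (k + 2 * q + 2) = a (k + 2 * q + 2)" for q using even[of "q + 1"] by simp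
  have even4: "?b (k + 2 * q + 4) = a (k + 2 * q + 4)" for q
  proof -
    have "k + 2 * q + 4 = k + 2 * (q + 2)" by simp
    then show ?thesis using even[of "q + 2"] by (simp only:)
  qed
  have i: "?B ?R ?b (k + 2 * q + 1) \<longleftrightarrow> ?B ?R' a (k + 2 * q)" if q: "q + 1 < n - k" for q
  proof -
    have q0: "q < n - k" using q by simp
    define d where "d = x (k + q) - x (k + (q + 1))"
    have R: "?R (k + 2 * q + 1) - ?R (k + 2 * q + 1 + 2) = d"
      using blk(2)[OF q0, of x y] blk(2)[OF q, of x y] by (simp add: d_def)
    have R': "?R' (k + 2 * q) - ?R' (k + 2 * q + 2) = d"
      using blk'(1)[OF q0, of x y] blk'(1)[OF q, of x y] by (simp add: d_def)
    have 1: "?B ?R' a (k + 2 * q) \<longleftrightarrow>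
        ballot d (?b (k + 2 * q + 1)) (a (k + 2 * q + 2)) (a (k + 2 * q + 3))"
      unfolding R' odd(2)[OF q0] using spread_ballot_iff_toggle_first by (simp add: numeral_3_eq_3)
    have last: "a (k + 2 * q + 3) = toggle (?b (k + 2 * q + 2)) (?b (k + 2 * q + 4)) (?b (k + 2 * q + 3))"
      using odd(1)[OF q] by (simp add: numeral_3_eq_3 eval_nat_numeral)
    have 2: "ballot d (?b (k + 2 * q + 1)) (a (k + 2 * q + 2)) (a (k + 2 * q + 3)) \<longleftrightarrow>
        spread_ballot d (?b (k + 2 * q + 1)) (?b (k + 2 * q + 2)) (?b (k + 2 * q + 3)) (?b (k + 2 * q + 4))"
      unfolding last even2[of q, symmetric] by (rule spread_ballot_iff_toggle_last[symmetric])
    show ?thesis unfolding 1 2 R by (simp add: numeral_3_eq_3 eval_nat_numeral)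
  qed
  have ii: "?B ?R ?b (k - 1) \<longleftrightarrow> ?C ?R' a (k - 1)"
  proof -
    obtain p where p: "k = Suc p" using k by (cases k) auto
    have q: "0 < n - k" using k by simp
    have R: "?R p - ?R (p + 2) = x p - x k" "?R' p - ?R' (Suc p) = x p - x k"
      using blk(2)[OF q, of x y] blk'(1)[OF q, of x y] by (simp_all add: p interleave_def)
    have b: "?b p = a p" "?b (Suc p) = a (Suc p)" "a (p + 2) = toggle (?b (Suc p)) (?b (p + 3)) (?b (p + 2))"
      using simps(3)[of p a] simps(3)[of "Suc p" a] odd(1)[OF q] by (simp_all add: p numeral_3_eq_3)
    show ?thesis using spread_ballot_iff_toggle_last[of _ "?b p" "?b (Suc p)" "?b (p + 2)" "?b (p + 3)"] b
      unfolding p diff_Suc_1 R[unfolded p] by simp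
  qed
  have iii: "?B ?R ?b (k + 2 * q) \<longleftrightarrow> ?B ?R' a (k + 2 * q + 1)" if q: "q + 1 < n - k" for q
  proof -
    have q0: "q < n - k" using q by simp
    define d where "d = y q - y (q + 1)"
    have R: "?R (k + 2 * q) - ?R (k + 2 * q + 2) = d"
      using blk(1)[OF q0, of x y] blk(1)[OF q, of x y] by (simp add: d_def)
    have R': "?R' (k + 2 * q + 1) - ?R' (k + 2 * q + 1 + 2) = d"
      using blk'(2)[OF q0, of x y] blk'(2)[OF q, of x y] by (simp add: d_def)
    have 1: "?B ?R ?b (k + 2 * q) \<longleftrightarrow>
        ballot d (a (k + 2 * q + 1)) (?b (k + 2 * q + 2)) (?b (k + 2 * q + 3))"
      unfolding R odd(1)[OF q0] using spread_ballot_iff_toggle_first by (simp add: numeral_3_eq_3)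
    have last: "?b (k + 2 * q + 3) = toggle (a (k + 2 * q + 2)) (a (k + 2 * q + 4)) (a (k + 2 * q + 3))"
      using odd(2)[OF q] by (simp add: numeral_3_eq_3 eval_nat_numeral)
    have 2: "ballot d (a (k + 2 * q + 1)) (?b (k + 2 * q + 2)) (?b (k + 2 * q + 3)) \<longleftrightarrow>
        spread_ballot d (a (k + 2 * q + 1)) (a (k + 2 * q + 2)) (a (k + 2 * q + 3)) (a (k + 2 * q + 4))"
      unfolding last even2[of q] by (rule spread_ballot_iff_toggle_last[symmetric])
    show ?thesis unfolding 1 2 R' by (simp add: numeral_3_eq_3 eval_nat_numeral)
  qed
  \<comment> \<open>the last block of the zigzag is block \<open>D\<close>\<close>
  obtain D where D: "n = k + Suc D" using k by (metis less_imp_Suc_add add_Suc_right)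
  have q: "D < n - k" using D by simp
  have iv: "?B ?R ?b (k + 2 * D) \<longleftrightarrow> ?C ?R' a (k + 2 * D + 1)"
  proof -
    have e: "k + 2 * D + 2 = 2 * n - k" using D by simp
    define d where "d = y D - y (Suc D)"
    have "?R (k + 2 * D + 2) = y (Suc D)" "?R' (k + 2 * D + 2) = y (Suc D)"
      unfolding e using D by (simp_all add: interleave_def)
    then have R: "?R (k + 2 * D) - ?R (k + 2 * D + 2) = d" "?R' (k + 2 * D + 1) - ?R' (k + 2 * D + 2) = d"
      using blk(1)[OF q, of x y] blk'(2)[OF q, of x y] by (simp_all add: d_def)
    have b: "?b (k + 2 * D + 3) = a (k + 2 * D + 3)" using simps(3)[of "k + 2 * D + 3" a] D by simp
    have "?B ?R ?b (k + 2 * D) \<longleftrightarrow>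
        ballot d (a (k + 2 * D + 1)) (?b (k + 2 * D + 2)) (?b (k + 2 * D + 3))"
      unfolding R odd(1)[OF q] using spread_ballot_iff_toggle_first by (simp add: numeral_3_eq_3)
    then show ?thesis using R b even2[of D] by (simp add: numeral_3_eq_3)
  qed
  have low: "?C ?R ?b t \<longleftrightarrow> ?C ?R' a t" if "Suc t < k" for t
    using that simps(3)[of t a] simps(3)[of "Suc t" a] simps(3)[of "t + 2" a]
      interleave_Suc_outside[OF k(2), of t x y] interleave_Suc_outside[OF k(2), of "Suc t" x y] by simp
  have high: "?C ?R ?b t \<longleftrightarrow> ?C ?R' a t" if "2 * n - k \<le> t" for t
    using that simps(3)[of t a] simps(3)[of "Suc t" a] simps(3)[of "t + 2" a]
      interleave_Suc_outside[OF k(2), of t x y] interleave_Suc_outside[OF k(2), of "Suc t" x y] by simp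
  have mid: "(\<forall>t. k \<le> Suc t \<and> t + 2 \<le> 2 * n - k \<longrightarrow> P t) \<longleftrightarrow>
      P (k - 1) \<and> (\<forall>q. q + 1 < n - k \<longrightarrow> P (k + 2 * q) \<and> P (k + 2 * q + 1)) \<and> P (k + 2 * D)" for P
  proof (intro iffI conjI allI impI)
    fix t assume *: "P (k - 1) \<and> (\<forall>q. q + 1 < n - k \<longrightarrow> P (k + 2 * q) \<and> P (k + 2 * q + 1)) \<and> P (k + 2 * D)"
      and t: "k \<le> Suc t \<and> t + 2 \<le> 2 * n - k"
    show "P t"
    proof (rule toggle_odd_cases[OF kn, of t])
      assume "t < k \<or> 2 * n - k \<le> t"
      then have "t = k - 1" using t k by linarith
      then show ?thesis using * by simp
    next
      fix q assume q: "q < n - k" "t = k + 2 * q"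
      then have "q + 1 < n - k \<or> q = D" using D by linarith
      then show ?thesis using * q(2) by blast
    next
      fix q assume q: "q < n - k" "t = k + 2 * q + 1"
      then have "q + 1 < n - k" using t by linarith
      then show ?thesis using * q(2) by blast
    qed
  qed (use k D in auto)
  have mid': "(\<forall>t. Suc k \<le> Suc t \<and> t + 2 \<le> 2 * n - Suc k \<longrightarrow> P t) \<longleftrightarrow>
      (\<forall>q. q + 1 < n - k \<longrightarrow> P (k + 2 * q) \<and> P (k + 2 * q + 1))" for P
  proof (intro iffI allI impI)
    fix t assume *: "\<forall>q. q + 1 < n - k \<longrightarrow> P (k + 2 * q) \<and> P (k + 2 * q + 1)"
      and t: "Suc k \<le> Suc t \<and> t + 2 \<le> 2 * n - Suc k"
    show "P t"
    proof (rule toggle_odd_cases[OF kn, of t])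
      fix q assume q: "q < n - k" "t = k + 2 * q"
      then have "q + 1 < n - k" using t by linarith
      then show ?thesis using * q(2) by blast
    next
      fix q assume q: "q < n - k" "t = k + 2 * q + 1"
      then have "q + 1 < n - k" using t by linarith
      then show ?thesis using * q(2) by blast
    qed (use t in linarith)
  qed (use k in auto)
  have low': "(\<forall>t. Suc t < Suc k \<longrightarrow> P t) \<longleftrightarrow> (\<forall>t. Suc t < k \<longrightarrow> P t) \<and> P (k - 1)" for P
    using k by (metis Suc_diff_1 Suc_lessD Suc_less_eq less_Suc_eq less_eq_Suc_le One_nat_def)
  have high': "(\<forall>t. 2 * n - Suc k \<le> t \<and> t + 2 \<le> 2 * n \<longrightarrow> P t) \<longleftrightarrow>
      (\<forall>t. 2 * n - k \<le> t \<and> t + 2 \<le> 2 * n \<longrightarrow> P t) \<and> P (k + 2 * D + 1)" for P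
  proof -
    have "2 * n - Suc k \<le> t \<and> t + 2 \<le> 2 * n \<longleftrightarrow> 2 * n - k \<le> t \<and> t + 2 \<le> 2 * n \<or> t = k + 2 * D + 1" for t
      using D k by auto
    then show ?thesis by blast
  qed
  have k': "1 \<le> Suc k" "Suc k \<le> n" using k by auto
  show ?thesis
    unfolding phase_conditions_iff[OF k'] phase_conditions_iff[OF k(1) kn] mid mid' low' high'
    using i ii iii iv low high by blast
qed

lemma card_phased_patterns_Suc:
  assumes k: "1 \<le> k" "k < n"
  shows "card (phased_patterns n (Suc k) (interleave n (Suc k) x y) (interleave n (Suc k) x' y') z) =
    card (phased_patterns n k (interleave n k x y) (interleave n k x' y') z)"
proof (rule bij_betw_same_card[OF bij_betw_byWitness[where f = "toggle_odd n k" and f' = "toggle_odd n k"]])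
  have kn: "k \<le> n" using k by simp
  let ?c = "\<lambda>k t. interleave n k x' y' t - interleave n k x y t"
  show "\<forall>a\<in>phased_patterns n (Suc k) (interleave n (Suc k) x y) (interleave n (Suc k) x' y') z.
      toggle_odd n k (toggle_odd n k a) = a"
    "\<forall>a\<in>phased_patterns n k (interleave n k x y) (interleave n k x' y') z.
      toggle_odd n k (toggle_odd n k a) = a"
    using toggle_odd_toggle_odd[OF kn] by blast+
  have 1: "toggle_odd n k a \<in> gt_patterns (2 * n) (?c k) z" if "a \<in> gt_patterns (2 * n) (?c (Suc k)) z" for a
    by (rule toggle_odd_gt_patterns[OF kn _ _ _ that])
      (simp_all add: interleave_block[OF kn, simplified] interleave_Suc_block[OF k(2), simplified] interleave_Suc_outside[OF k(2)])
  have 2: "toggle_odd n k a \<in> gt_patterns (2 * n) (?c (Suc k)) z" if "a \<in> gt_patterns (2 * n) (?c k) z" for a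
    by (rule toggle_odd_gt_patterns[OF kn _ _ _ that])
      (simp_all add: interleave_block[OF kn, simplified] interleave_Suc_block[OF k(2), simplified] interleave_Suc_outside[OF k(2)])
  show "toggle_odd n k ` phased_patterns n (Suc k) (interleave n (Suc k) x y) (interleave n (Suc k) x' y') z
      \<subseteq> phased_patterns n k (interleave n k x y) (interleave n k x' y') z"
    using 1 phase_conditions_toggle_odd[OF k, of x y] by (auto simp: phased_patterns_def)
  show "toggle_odd n k ` phased_patterns n k (interleave n k x y) (interleave n k x' y') z
      \<subseteq> phased_patterns n (Suc k) (interleave n (Suc k) x y) (interleave n (Suc k) x' y') z"
    using 2 phase_conditions_toggle_odd[OF k, of x y] toggle_odd_toggle_odd[OF kn]
    by (auto simp: phased_patterns_def)
qed

lemma interleave_eq_stack: "interleave n n x y = stack n x y"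
  by (auto simp: interleave_def stack_def fun_eq_iff)

lemma phased_patterns_last: 
  assumes "1 \<le> n"
  shows "phased_patterns n n R U z = ballot_patterns (- {n - 1}) (2 * n) R U z"
proof -
  have "phase_conditions n n R a \<longleftrightarrow> (\<forall>t\<in>- {n - 1}. t + 2 \<le> 2 * n \<longrightarrow>
      ballot (R t - R (Suc t)) (a t) (a (Suc t)) (a (Suc (Suc t))))" for a
  proof -
    have "t \<in> - {n - 1} \<longleftrightarrow> Suc t < n \<or> n \<le> t" for t using assms by auto
    then show ?thesis unfolding phase_conditions_iff[OF assms order_refl] by auto
  qed
  then show ?thesis by (simp add: phased_patterns_def ballot_patterns_def)
qed

theorem card_phased_patterns:
  assumes "1 \<le> k" "k \<le> n"
  shows "card (phased_patterns n k (interleave n k x y) (interleave n k x' y') z) =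
    card (ballot_patterns (- {n - 1}) (2 * n) (stack n x y) (stack n x' y') z)"
  using assms(2)
proof (induction k rule: inc_induct)
  case base
  then show ?case using assms by (simp add: interleave_eq_stack phased_patterns_last)
next
  case (step m)
  then show ?case using card_phased_patterns_Suc[of m n x y x' y' z] assms(1) by simp
qed

section \<open>Unit rhombi\<close>


text \<open>
  The difference vectors of two vertices of a unit triangle.
\<close>

definition face_diagonal :: "int \<times> int \<times> int \<Rightarrow> bool" where
  "face_diagonal v \<longleftrightarrow> (case v of (a, b, c) \<Rightarrow>
     (\<bar>a\<bar> = 1 \<and> \<bar>b\<bar> = 1 \<and> c = 0) \<or> (\<bar>a\<bar> = 1 \<and> b = 0 \<and> \<bar>c\<bar> = 1) \<or> (a = 0 \<and> \<bar>b\<bar> = 1 \<and> \<bar>c\<bar> = 1))"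

lemma face_diagonal_minus: "face_diagonal (- v) = face_diagonal v"
  by (cases v) (auto simp: face_diagonal_def)

lemma face_diagonal_commute: "face_diagonal (p - q) = face_diagonal (q - p)"
  using face_diagonal_minus[of "p - q"] by simp

lemma face_diagonal_zero:
  "face_diagonal (0, b, c) \<longleftrightarrow> \<bar>b\<bar> = 1 \<and> \<bar>c\<bar> = 1"
  "face_diagonal (a, 0, c) \<longleftrightarrow> \<bar>a\<bar> = 1 \<and> \<bar>c\<bar> = 1"
  "face_diagonal (a, b, 0) \<longleftrightarrow> \<bar>a\<bar> = 1 \<and> \<bar>b\<bar> = 1"
  by (simp_all add: face_diagonal_def)

lemma face_diagonal_swap:
  "face_diagonal (a, b, c) = face_diagonal (a, c, b)"
  "face_diagonal (a, b, c) = face_diagonal (b, c, a)"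
  by (auto simp: face_diagonal_def)

lemma face_diagonal_neighbours_horizontal:
  assumes e: "\<bar>e1\<bar> = 1" "\<bar>e2\<bar> = 1" and x: "face_diagonal (x1, x2, x3)"
    and xe: "face_diagonal (x1 - e1, x2 - e2, x3)"
  shows "x1 = e1 \<and> x2 = 0 \<or> x1 = 0 \<and> x2 = e2"
proof -
  have odd: "\<bar>a - b\<bar> \<noteq> 1" if "\<bar>a\<bar> = 1" "\<bar>b\<bar> = 1" for a b :: int using that by arith
  consider "\<bar>x1\<bar> = 1" "\<bar>x2\<bar> = 1" "x3 = 0" | "\<bar>x1\<bar> = 1" "x2 = 0" "\<bar>x3\<bar> = 1"
    | "x1 = 0" "\<bar>x2\<bar> = 1" "\<bar>x3\<bar> = 1"
    using x unfolding face_diagonal_def by blast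
  then show ?thesis
  proof cases
    case 1 then show ?thesis using xe odd[OF 1(1) e(1)] by (simp add: face_diagonal_zero)
  next
    case 2
    then have "x3 \<noteq> 0" "e2 \<noteq> 0" using e by auto
    then show ?thesis using xe odd[OF 2(1) e(1)] 2 by (simp add: face_diagonal_def)
  next
    case 3
    then have "x3 \<noteq> 0" "e1 \<noteq> 0" using e by auto
    then show ?thesis using xe odd[OF 3(2) e(2)] 3 by (simp add: face_diagonal_def)
  qed
qed

text \<open>
  A common neighbour of the ends of an edge agrees with one end in one of the two coordinates along which the
  edge runs, and with the other end in the other one.
\<close>

lemma face_diagonal_neighbours:
  assumes "face_diagonal (e1, e2, e3)" "face_diagonal (x1, x2, x3)"
    "face_diagonal (x1 - e1, x2 - e2, x3 - e3)"
  shows "e3 = 0 \<Longrightarrow> x1 = e1 \<and> x2 = 0 \<or> x1 = 0 \<and> x2 = e2"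
    "e2 = 0 \<Longrightarrow> x1 = e1 \<and> x3 = 0 \<or> x1 = 0 \<and> x3 = e3"
    "e1 = 0 \<Longrightarrow> x2 = e2 \<and> x3 = 0 \<or> x2 = 0 \<and> x3 = e3"
proof -
  show "x1 = e1 \<and> x2 = 0 \<or> x1 = 0 \<and> x2 = e2" if "e3 = 0"
    using assms that by (intro face_diagonal_neighbours_horizontal[of e1 e2 x1 x2 x3]) (simp_all add: face_diagonal_zero)
  show "x1 = e1 \<and> x3 = 0 \<or> x1 = 0 \<and> x3 = e3" if "e2 = 0"
    using assms that face_diagonal_swap(1)[of x1 x2 x3] face_diagonal_swap(1)[of "x1 - e1" x2 "x3 - e3"]
    by (intro face_diagonal_neighbours_horizontal[of e1 e3 x1 x3 x2]) (simp_all add: face_diagonal_zero)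
  show "x2 = e2 \<and> x3 = 0 \<or> x2 = 0 \<and> x3 = e3" if "e1 = 0"
    using assms that face_diagonal_swap(2)[of x1 x2 x3] face_diagonal_swap(2)[of x1 "x2 - e2" "x3 - e3"]
    by (intro face_diagonal_neighbours_horizontal[of e2 e3 x2 x3 x1]) (simp_all add: face_diagonal_zero)
qed

lemma unit_triangleI:
  assumes "\<bar>x' - x\<bar> = 1" "\<bar>y' - y\<bar> = 1" "\<bar>z' - z\<bar> = 1"
  shows "unit_triangle {(x', y, z), (x, y', z), (x, y, z')}"
  unfolding unit_triangle_def
proof (intro exI bexI)
  show "{(x', y, z), (x, y', z), (x, y, z')} =
    {(x, y, z) + (x' - x, 0, 0), (x, y, z) + (0, y' - y, 0), (x, y, z) + (0, 0, z' - z)}" by simp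
qed (use assms in auto)

lemma unit_triangle_iff:
  "unit_triangle {p, q, r} \<longleftrightarrow> face_diagonal (p - q) \<and> face_diagonal (p - r) \<and> face_diagonal (q - r)"
proof
  assume "unit_triangle {p, q, r}"
  then obtain w a b c where abc: "a \<in> {1, -1}" "b \<in> {1, -1}" "c \<in> {1, -1}"
    and S: "{p, q, r} = {w + (a, 0, 0), w + (0, b, 0), w + (0, 0, c)}" (is "_ = ?S")
    unfolding unit_triangle_def by blast
  obtain w1 w2 w3 where w: "w = (w1, w2, w3)" by (cases w)
  have abs: "\<bar>a\<bar> = 1" "\<bar>b\<bar> = 1" "\<bar>c\<bar> = 1" using abc by auto
  have diff: "face_diagonal (u - v)" if "u \<in> ?S" "v \<in> ?S" "u \<noteq> v" for u v
  proof -
    have "face_diagonal ((w + (a, 0, 0)) - (w + (0, b, 0)))"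
      "face_diagonal ((w + (a, 0, 0)) - (w + (0, 0, c)))"
      "face_diagonal ((w + (0, b, 0)) - (w + (0, 0, c)))"
      using abs by (simp_all add: w face_diagonal_def)
    then show ?thesis
      using that by (elim insertE emptyE) (metis face_diagonal_commute)+
  qed
  have "card ?S = 3" using abc by (auto simp: w card_insert_if)
  then have "card {p, q, r} = 3" unfolding S .
  then have "p \<noteq> q" "p \<noteq> r" "q \<noteq> r" by (auto simp: card_insert_if split: if_splits)
  then show "face_diagonal (p - q) \<and> face_diagonal (p - r) \<and> face_diagonal (q - r)"
    using diff S by blast
next
  assume D: "face_diagonal (p - q) \<and> face_diagonal (p - r) \<and> face_diagonal (q - r)"
  obtain p1 p2 p3 q1 q2 q3 r1 r2 r3 where pqr: "p = (p1, p2, p3)" "q = (q1, q2, q3)" "r = (r1, r2, r3)"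
    by (cases p, cases q, cases r)
  have D': "face_diagonal (p1 - q1, p2 - q2, p3 - q3)" "face_diagonal (p1 - r1, p2 - r2, p3 - r3)"
    "face_diagonal (q1 - r1, q2 - r2, q3 - r3)" using D by (simp_all add: pqr)
  have D3: "face_diagonal (p1 - r1 - (p1 - q1), p2 - r2 - (p2 - q2), p3 - r3 - (p3 - q3))"
    using D'(3) by simp
  note nb = face_diagonal_neighbours[OF D'(1,2) D3]
  have n3: "p3 = q3 \<Longrightarrow> p2 = r2 \<and> q1 = r1 \<or> p1 = r1 \<and> q2 = r2" using nb(1) by auto
  have n2: "p2 = q2 \<Longrightarrow> p3 = r3 \<and> q1 = r1 \<or> p1 = r1 \<and> q3 = r3" using nb(2) by auto
  have n1: "p1 = q1 \<Longrightarrow> p3 = r3 \<and> q2 = r2 \<or> p2 = r2 \<and> q3 = r3" using nb(3) by auto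
  have "p1 = q1 \<or> p2 = q2 \<or> p3 = q3" using D'(1) unfolding face_diagonal_def by auto
  then consider "p1 = q1" "p2 = r2" "q3 = r3" | "p1 = q1" "p3 = r3" "q2 = r2"
    | "p2 = q2" "p1 = r1" "q3 = r3" | "p2 = q2" "p3 = r3" "q1 = r1"
    | "p3 = q3" "p1 = r1" "q2 = r2" | "p3 = q3" "p2 = r2" "q1 = r1"
    using n1 n2 n3 by blast
  then show "unit_triangle {p, q, r}"
  proof cases
    case 1
    then show ?thesis using unit_triangleI[of r1 p1 q2 p2 p3 q3] D'
      by (simp add: pqr face_diagonal_zero abs_minus_commute insert_commute)
  next
    case 2
    then show ?thesis using unit_triangleI[of r1 p1 p2 q2 q3 p3] D'
      by (simp add: pqr face_diagonal_zero abs_minus_commute insert_commute)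
  next
    case 3
    then show ?thesis using unit_triangleI[of q1 p1 r2 p2 p3 q3] D'
      by (simp add: pqr face_diagonal_zero abs_minus_commute insert_commute)
  next
    case 4
    then show ?thesis using unit_triangleI[of p1 q1 r2 p2 q3 p3] D'
      by (simp add: pqr face_diagonal_zero abs_minus_commute insert_commute)
  next
    case 5
    then show ?thesis using unit_triangleI[of q1 p1 p2 q2 r3 p3] D'
      by (simp add: pqr face_diagonal_zero abs_minus_commute insert_commute)
  next
    case 6
    then show ?thesis using unit_triangleI[of p1 q1 q2 p2 r3 p3] D'
      by (simp add: pqr face_diagonal_zero abs_minus_commute insert_commute)
  qed
qed

definition det3 :: "'a::comm_ring_1 \<times> 'a \<times> 'a \<Rightarrow> 'a \<times> 'a \<times> 'a \<Rightarrow> 'a \<times> 'a \<times> 'a \<Rightarrow> 'a" where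
  "det3 = (\<lambda>(a1, a2, a3) (b1, b2, b3) (c1, c2, c3).
     a1 * (b2 * c3 - b3 * c2) - a2 * (b1 * c3 - b3 * c1) + a3 * (b1 * c2 - b2 * c1))"

lemma det3_plane:
  fixes v w :: "real \<times> real \<times> real"
  shows "det3 (a1 *\<^sub>R v + b1 *\<^sub>R w) (a2 *\<^sub>R v + b2 *\<^sub>R w) (a3 *\<^sub>R v + b3 *\<^sub>R w) = 0"
  by (cases v, cases w) (simp add: det3_def algebra_simps)

lemma coplanar_imp_det3:
  fixes p q r s :: "real \<times> real \<times> real"
  assumes "coplanar {p, q, r, s}"
  shows "det3 (q - p) (r - p) (s - p) = 0"
proof -
  obtain u v w where sub: "{p, q, r, s} \<subseteq> affine hull {u, v, w}"
    using assms unfolding coplanar_def by blast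
  have "\<exists>b c. x = u + b *\<^sub>R (v - u) + c *\<^sub>R (w - u)" if "x \<in> affine hull {u, v, w}" for x
  proof -
    obtain a b c where x: "x = a *\<^sub>R u + b *\<^sub>R v + c *\<^sub>R w" "a + b + c = 1"
      using \<open>x \<in> affine hull {u, v, w}\<close> unfolding affine_hull_3 by blast
    then have a: "a = 1 - b - c" by simp
    have "x = u + b *\<^sub>R (v - u) + c *\<^sub>R (w - u)"
      unfolding x(1) a by (simp add: algebra_simps)
    then show ?thesis by blast
  qed
  note rep = this
  obtain b0 c0 where p: "p = u + b0 *\<^sub>R (v - u) + c0 *\<^sub>R (w - u)" using rep[of p] sub by blast
  have diff: "\<exists>b c. x - p = b *\<^sub>R (v - u) + c *\<^sub>R (w - u)" if x: "x \<in> affine hull {u, v, w}" for x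
  proof -
    obtain b c where "x = u + b *\<^sub>R (v - u) + c *\<^sub>R (w - u)" using rep[OF x] by blast
    then have "x - p = (b - b0) *\<^sub>R (v - u) + (c - c0) *\<^sub>R (w - u)"
      unfolding p by (simp add: algebra_simps)
    then show ?thesis by blast
  qed
  obtain b1 c1 b2 c2 b3 c3 where
    "q - p = b1 *\<^sub>R (v - u) + c1 *\<^sub>R (w - u)" "r - p = b2 *\<^sub>R (v - u) + c2 *\<^sub>R (w - u)"
    "s - p = b3 *\<^sub>R (v - u) + c3 *\<^sub>R (w - u)"
    using diff[of q] diff[of r] diff[of s] sub by blast
  then show ?thesis by (simp only: det3_plane)
qed

lemma real_point_diff: "real_point p - real_point q = real_point (p - q)"
  by (cases p, cases q) (simp add: real_point_def)

lemma det3_real_point: "det3 (real_point p) (real_point q) (real_point r) = of_int (det3 p q r)"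
  by (cases p, cases q, cases r) (simp add: real_point_def det3_def)

lemma flat_coordinates:
  fixes e1 e2 :: int
  assumes "\<bar>e1\<bar> = 1" "\<bar>e2\<bar> = 1"
    and "v1 = e1 \<and> v2 = 0 \<or> v1 = 0 \<and> v2 = e2" "w1 = e1 \<and> w2 = 0 \<or> w1 = 0 \<and> w2 = e2"
    and "e1 * (v2 * w3 - v3 * w2) = e2 * (v1 * w3 - v3 * w1)"
    and "\<not> (v1 = w1 \<and> v2 = w2 \<and> v3 = w3)"
  shows "v1 + w1 = e1 \<and> v2 + w2 = e2 \<and> v3 + w3 = 0"
proof -
  have "e1 = 1 \<or> e1 = -1" "e2 = 1 \<or> e2 = -1" using assms(1,2) by linarith+
  then show ?thesis using assms(3-6) by (elim disjE) auto
qed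

text \<open>
  Of the four common neighbours of an edge, the coplanar pairs are those symmetric about its midpoint.
\<close>

lemma face_diagonal_flat:
  assumes e: "face_diagonal e" and v: "face_diagonal v" "face_diagonal (v - e)"
    and w: "face_diagonal w" "face_diagonal (w - e)" and "v \<noteq> w" and "det3 e v w = 0"
  shows "v + w = e"
proof -
  obtain e1 e2 e3 v1 v2 v3 w1 w2 w3 where c: "e = (e1, e2, e3)" "v = (v1, v2, v3)" "w = (w1, w2, w3)"
    by (cases e, cases v, cases w)
  note nv = face_diagonal_neighbours[OF e[unfolded c] v[unfolded c diff_Pair]]
  note nw = face_diagonal_neighbours[OF e[unfolded c] w[unfolded c diff_Pair]]
  have det: "e1 * (v2 * w3 - v3 * w2) - e2 * (v1 * w3 - v3 * w1) + e3 * (v1 * w2 - v2 * w1) = 0"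
    using assms(7) by (simp add: c det3_def)
  have ne: "\<not> (v1 = w1 \<and> v2 = w2 \<and> v3 = w3)" using assms(6) by (simp add: c)
  consider "e3 = 0" "\<bar>e1\<bar> = 1" "\<bar>e2\<bar> = 1" | "e2 = 0" "\<bar>e1\<bar> = 1" "\<bar>e3\<bar> = 1"
    | "e1 = 0" "\<bar>e2\<bar> = 1" "\<bar>e3\<bar> = 1"
    using e unfolding c face_diagonal_def by auto
  then show ?thesis
  proof cases
    case 1
    then show ?thesis using flat_coordinates[OF 1(2,3) nv(1) nw(1), of w3 v3] det ne by (simp add: c)
  next
    case 2
    then have "e1 * (v3 * w2 - v2 * w3) = e3 * (v1 * w2 - v2 * w1)"
      using det by (simp add: algebra_simps)
    then show ?thesis using flat_coordinates[OF 2(2,3) nv(2) nw(2), of w2 v2] 2(1) ne by (auto simp: c)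
  next
    case 3
    then have "e2 * (v3 * w1 - v1 * w3) = e3 * (v2 * w1 - v1 * w2)"
      using det by (simp add: algebra_simps)
    then show ?thesis using flat_coordinates[OF 3(2,3) nv(3) nw(3), of w1 v1] 3(1) ne by (auto simp: c)
  qed
qed

text \<open>
  A unit rhombus is a parallelogram with three of its four vertices in a unit triangle. This form of the
  definition reduces questions about rhombi to integer arithmetic.
\<close>

lemma unit_rhombus_iff:
  "unit_rhombus p q p' q' \<longleftrightarrow>
     p + q = p' + q' \<and> face_diagonal (q' - p') \<and> face_diagonal (p - p') \<and> face_diagonal (p - q')"
proof
  assume r: "unit_rhombus p q p' q'"
  then have D: "face_diagonal (p - p')" "face_diagonal (p - q')" "face_diagonal (p' - q')"
      "face_diagonal (q - p')" "face_diagonal (q - q')" and "p \<noteq> q"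
    and cop: "coplanar (real_point ` {p, q, p', q'})"
    unfolding unit_rhombus_def unit_triangle_iff by blast+
  have "real_point ` {p, q, p', q'} = {real_point p', real_point q', real_point p, real_point q}" by auto
  then have "det3 (q' - p') (p - p') (q - p') = 0"
    using coplanar_imp_det3[of "real_point p'" "real_point q'" "real_point p" "real_point q"] cop
    by (simp add: real_point_diff det3_real_point)
  then have "(p - p') + (q - p') = q' - p'"
    using D \<open>p \<noteq> q\<close> face_diagonal_commute[of p' q']
    by (intro face_diagonal_flat) (simp_all add: algebra_simps)
  then have "p + q = p' + q'" by (simp add: algebra_simps)
  then show "p + q = p' + q' \<and> face_diagonal (q' - p') \<and> face_diagonal (p - p') \<and> face_diagonal (p - q')"
    using D face_diagonal_commute[of p' q'] by simp
next
  assume r: "p + q = p' + q' \<and> face_diagonal (q' - p') \<and> face_diagonal (p - p') \<and> face_diagonal (p - q')"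
  then have q: "q = p' + q' - p" by (simp add: algebra_simps)
  have "p \<noteq> q"
  proof
    assume "p = q"
    then have "q' - p' = (p - p') + (p - p')" using r by (simp add: algebra_simps)
    then show False using r by (cases "p - p'") (auto simp: face_diagonal_def)
  qed
  moreover have "coplanar (real_point ` {p, q, p', q'})"
    unfolding coplanar_def
  proof (intro exI)
    let ?A = "affine hull {real_point p, real_point p', real_point q'}"
    have "real_point q = (-1) *\<^sub>R real_point p + 1 *\<^sub>R real_point p' + 1 *\<^sub>R real_point q'"
      unfolding q by (cases p, cases p', cases q') (simp add: real_point_def)
    then have "real_point q \<in> ?A" unfolding affine_hull_3
      by (intro CollectI exI[of _ "-1"] exI[of _ 1] conjI) simp_all
    then show "real_point ` {p, q, p', q'} \<subseteq> ?A" by (auto intro: hull_inc)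
  qed
  moreover have "face_diagonal (q - p')" "face_diagonal (q - q')"
    using r face_diagonal_commute[of p p'] face_diagonal_commute[of p q'] by (simp_all add: q algebra_simps)
  ultimately show "unit_rhombus p q p' q'"
    using r face_diagonal_commute[of p' q'] unfolding unit_rhombus_def unit_triangle_iff by blast
qed



definition level_point :: "(nat \<Rightarrow> int) \<Rightarrow> nat \<times> nat \<Rightarrow> int \<times> int \<times> int" where
  "level_point H = (\<lambda>(i, j). (int i, int j, H (i + j)))"

text \<open>
  The first two families are the rhombi between two neighbouring levels. The third one holds for the rhombi
  across a level at which the heights continue in the same direction, the last one for the rhombi that cross
  three strips of a zigzag.
\<close>

definition hive_inequalities :: "nat \<Rightarrow> (nat \<Rightarrow> int) \<Rightarrow> (nat \<times> nat \<Rightarrow> int) \<Rightarrow> bool" where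
  "hive_inequalities N H h \<longleftrightarrow>
     (\<forall>i j. i + j + 2 \<le> N \<longrightarrow> h (i + 2, j) + h (i, j + 1) \<le> h (i + 1, j) + h (i + 1, j + 1)) \<and>
     (\<forall>i j. i + j + 2 \<le> N \<longrightarrow> h (i, j + 2) + h (i + 1, j) \<le> h (i, j + 1) + h (i + 1, j + 1)) \<and>
     (\<forall>i j. i + j + 2 \<le> N \<and> H (i + j) + H (i + j + 2) = 2 * H (i + j + 1) \<longrightarrow>
        h (i, j) + h (i + 1, j + 1) \<le> h (i + 1, j) + h (i, j + 1)) \<and>
     (\<forall>i j. i + j + 3 \<le> N \<and> H (i + j) = H (i + j + 2) \<and> H (i + j + 1) = H (i + j + 3) \<longrightarrow>
        h (i, j) + h (i + 2, j + 1) \<le> h (i + 1, j) + h (i + 1, j + 1) \<and>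
        h (i, j) + h (i + 1, j + 2) \<le> h (i, j + 1) + h (i + 1, j + 1))"

lemma unit_rhombus_swap:
  "unit_rhombus p q p' q' \<Longrightarrow> unit_rhombus q p p' q'"
  "unit_rhombus p q p' q' \<Longrightarrow> unit_rhombus p q q' p'"
  by (auto simp: unit_rhombus_def insert_commute)

lemma face_diagonal_step:
  assumes "face_diagonal (int a' - int a, int b' - int b, c)"
  shows "a' = a + 1 \<and> b = b' + 1 \<or> a' = a + 1 \<and> b' = b + 1 \<or> a' = a \<and> b' = b + 1 \<or> a' = a + 1 \<and> b' = b \<or>
     a = a' + 1 \<and> b' = b + 1 \<or> a = a' + 1 \<and> b = b' + 1 \<or> a' = a \<and> b = b' + 1 \<or> a = a' + 1 \<and> b' = b"
proof -
  have near: "u' = u + 1 \<or> u' = u \<or> u = u' + 1" if "\<bar>int u' - int u\<bar> = 1 \<or> int u' - int u = 0" for u u' :: nat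
    using that by linarith
  have "a' = a + 1 \<or> a' = a \<or> a = a' + 1" "b' = b + 1 \<or> b' = b \<or> b = b' + 1" "\<not> (a' = a \<and> b' = b)"
    using assms unfolding face_diagonal_def prod.case by (intro near | auto)+
  then show ?thesis by blast
qed

text \<open>
  The vertices of a rhombus may be named in four ways. The assumptions \<open>short\<close> and \<open>long\<close> fix a direction of
  both diagonals, and five rhombi remain: the short diagonal \<open>(1, -1)\<close> gives one, \<open>(0, 1)\<close> and \<open>(1, 0)\<close> give
  two each, and \<open>(1, 1)\<close> would need different heights on the same level.
\<close>

lemma hive_inequalities_rhombus:
  assumes h: "hive_inequalities N H h"
    and mem: "(x1, x2) \<in> Delta N" "(y1, y2) \<in> Delta N" "(p1, p2) \<in> Delta N" "(q1, q2) \<in> Delta N"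
    and r: "unit_rhombus (level_point H (x1, x2)) (level_point H (y1, y2))
        (level_point H (p1, p2)) (level_point H (q1, q2))"
    and short: "q1 = p1 + 1 \<and> p2 = q2 + 1 \<or> q1 = p1 + 1 \<and> q2 = p2 + 1 \<or> q1 = p1 \<and> q2 = p2 + 1 \<or> q1 = p1 + 1 \<and> q2 = p2"
    and long: "x1 + x2 \<ge> y1 + y2" "x1 + x2 = y1 + y2 \<Longrightarrow> x1 > y1"
  shows "h (x1, x2) + h (y1, y2) \<le> h (p1, p2) + h (q1, q2)"
proof -
  have s: "x1 + y1 = p1 + q1" "x2 + y2 = p2 + q2" "H (x1 + x2) + H (y1 + y2) = H (p1 + p2) + H (q1 + q2)"
    and D: "face_diagonal (int q1 - int p1, int q2 - int p2, H (q1 + q2) - H (p1 + p2))"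
      "face_diagonal (int x1 - int p1, int x2 - int p2, H (x1 + x2) - H (p1 + p2))"
      "face_diagonal (int x1 - int q1, int x2 - int q2, H (x1 + x2) - H (q1 + q2))"
    using r unfolding unit_rhombus_iff level_point_def by (auto simp flip: of_nat_add)
  let ?v1 = "int x1 - int p1" and ?v2 = "int x2 - int p2" and ?v3 = "H (x1 + x2) - H (p1 + p2)"
  have D3: "face_diagonal (?v1 - (int q1 - int p1), ?v2 - (int q2 - int p2), ?v3 - (H (q1 + q2) - H (p1 + p2)))"
    using D(3) by simp
  note nb = face_diagonal_neighbours[OF D(1,2) D3]
  have lev: "p1 + p2 \<le> N" "q1 + q2 \<le> N" "x1 + x2 \<le> N" using mem by (auto simp: Delta_def)
  from short show ?thesis
  proof (elim disjE)
    assume e: "q1 = p1 + 1 \<and> p2 = q2 + 1"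
    then have "H (q1 + q2) - H (p1 + p2) = 0" using D(1) by (auto simp: face_diagonal_def)
    from nb(1)[OF this] have "?v1 = 1 \<and> ?v2 = 0 \<or> ?v1 = 0 \<and> ?v2 = -1" using e by simp
    then have "x1 = p1 + 1 \<and> x2 = p2" using long s(1,2) e by linarith
    then have x: "x1 = p1 + 1" "x2 = p2" by auto
    then have y: "y1 = p1" "y2 = q2" using e s(1,2) by auto
    have "H (p1 + q2) + H (p1 + q2 + 2) = 2 * H (p1 + q2 + 1)"
      using s(3) e x y by (simp add: algebra_simps)
    then show ?thesis using h e x y lev unfolding hive_inequalities_def by (simp add: algebra_simps)
  next
    assume e: "q1 = p1 + 1 \<and> q2 = p2 + 1"
    then have "H (q1 + q2) - H (p1 + p2) = 0" using D(1) by (auto simp: face_diagonal_def)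
    from nb(1)[OF this] have "?v1 = 1 \<and> ?v2 = 0 \<or> ?v1 = 0 \<and> ?v2 = 1" using e by simp
    then have "x1 = p1 + 1 \<and> x2 = p2" using long s(1,2) e by linarith
    then have x: "x1 = p1 + 1" "x2 = p2" by auto
    then have y: "y1 = p1" "y2 = p2 + 1" using e s(1,2) by auto
    show ?thesis using s(3) D(1,2) e x y by (auto simp: face_diagonal_def)
  next
    assume e: "q1 = p1 \<and> q2 = p2 + 1"
    then have v: "?v2 = 1 \<and> ?v3 = 0 \<or> ?v2 = 0 \<and> ?v3 = H (q1 + q2) - H (p1 + p2)" using nb(3) by simp
    then have "\<bar>?v1\<bar> = 1" using D(2) by (auto simp: face_diagonal_def)
    then have "x1 = p1 + 1 \<and> x2 = p2 + 1 \<or> x1 = p1 + 1 \<and> x2 = p2"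
      using v long s(1,2) e by linarith
    moreover obtain i where i: "p1 = Suc i" using calculation s(1) e by (cases p1) auto
    ultimately show ?thesis
    proof (elim disjE conjE)
      assume x: "x1 = p1 + 1" "x2 = p2 + 1"
      then have y: "y1 = i" "y2 = p2" using e s(1,2) i by auto
      have "H (i + p2) = H (i + p2 + 2) \<and> H (i + p2 + 1) = H (i + p2 + 3)"
        using s(3) D(2) e x y i by (auto simp: face_diagonal_def algebra_simps numeral_3_eq_3)
      then show ?thesis using h e x y i lev unfolding hive_inequalities_def by (simp add: algebra_simps)
    next
      assume x: "x1 = p1 + 1" "x2 = p2"
      then have y: "y1 = i" "y2 = p2 + 1" using e s(1,2) i by auto
      then show ?thesis using h e x i lev unfolding hive_inequalities_def by (simp add: algebra_simps)
    qed
  next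
    assume e: "q1 = p1 + 1 \<and> q2 = p2"
    then have v: "?v1 = 1 \<and> ?v3 = 0 \<or> ?v1 = 0 \<and> ?v3 = H (q1 + q2) - H (p1 + p2)" using nb(2) by simp
    then have "\<bar>?v2\<bar> = 1" using D(2) by (auto simp: face_diagonal_def)
    then have "x1 = p1 + 1 \<and> x2 = p2 + 1 \<or> x1 = p1 \<and> x2 = p2 + 1"
      using v long s(1,2) e by linarith
    moreover obtain j where j: "p2 = Suc j" using calculation s(2) e by (cases p2) auto
    ultimately show ?thesis
    proof (elim disjE conjE)
      assume x: "x1 = p1 + 1" "x2 = p2 + 1"
      then have y: "y1 = p1" "y2 = j" using e s(1,2) j by auto
      have "H (p1 + j) = H (p1 + j + 2) \<and> H (p1 + j + 1) = H (p1 + j + 3)"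
        using s(3) D(2) e x y j by (auto simp: face_diagonal_def algebra_simps numeral_3_eq_3)
      then show ?thesis using h e x y j lev unfolding hive_inequalities_def by (simp add: algebra_simps)
    next
      assume x: "x1 = p1" "x2 = p2 + 1"
      then have y: "y1 = p1 + 1" "y2 = j" using e s(1,2) j by auto
      then show ?thesis using h e x j lev unfolding hive_inequalities_def by (simp add: algebra_simps)
    qed
  qed
qed

lemma rhombus_condition_iff:
  assumes H: "\<And>t. t < N \<Longrightarrow> \<bar>H (Suc t) - H t\<bar> = 1"
  shows "(\<forall>x \<in> Delta N. \<forall>y \<in> Delta N. \<forall>x' \<in> Delta N. \<forall>y' \<in> Delta N.
      unit_rhombus (level_point H x) (level_point H y) (level_point H x') (level_point H y') \<longrightarrow>
      h x' + h y' \<ge> h x + h y) \<longleftrightarrow> hive_inequalities N H h" (is "?l \<longleftrightarrow> ?r")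
proof
  assume ?l
  then have P: "h x + h y \<le> h x' + h y'"
    if "unit_rhombus (level_point H x) (level_point H y) (level_point H x') (level_point H y')"
      "x \<in> Delta N" "y \<in> Delta N" "x' \<in> Delta N" "y' \<in> Delta N" for x y x' y'
    using that by blast
  have H2: "\<bar>H (i + j + 1) - H (i + j)\<bar> = 1" "\<bar>H (i + j) - H (i + j + 1)\<bar> = 1" if "i + j < N" for i j
    using H[OF that] by (simp_all add: abs_minus_commute)
  show ?r unfolding hive_inequalities_def
  proof (intro conjI allI impI)
    fix i j assume le: "i + j + 2 \<le> N"
    show "h (i + 2, j) + h (i, j + 1) \<le> h (i + 1, j) + h (i + 1, j + 1)"
      using le H2[of i "j + 1"]
      by (intro P) (simp_all add: unit_rhombus_iff level_point_def face_diagonal_def Delta_def algebra_simps)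
    show "h (i, j + 2) + h (i + 1, j) \<le> h (i, j + 1) + h (i + 1, j + 1)"
      using le H2[of i "j + 1"]
      by (intro P) (simp_all add: unit_rhombus_iff level_point_def face_diagonal_def Delta_def algebra_simps)
  next
    fix i j assume "i + j + 2 \<le> N \<and> H (i + j) + H (i + j + 2) = 2 * H (i + j + 1)"
    then show "h (i, j) + h (i + 1, j + 1) \<le> h (i + 1, j) + h (i, j + 1)"
      using H2[of i j]
      by (intro P) (simp_all add: unit_rhombus_iff level_point_def face_diagonal_def Delta_def algebra_simps)
  next
    fix i j assume le: "i + j + 3 \<le> N \<and> H (i + j) = H (i + j + 2) \<and> H (i + j + 1) = H (i + j + 3)"
    then have Hs: "H (i + (j + 2)) = H (i + j)" "H (Suc (Suc (Suc (i + j)))) = H (Suc (i + j))"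
      by (simp_all add: eval_nat_numeral)
    show "h (i, j) + h (i + 2, j + 1) \<le> h (i + 1, j) + h (i + 1, j + 1)"
      using le Hs H2[of i j]
      by (intro P) (simp_all add: unit_rhombus_iff level_point_def face_diagonal_def Delta_def algebra_simps)
    show "h (i, j) + h (i + 1, j + 2) \<le> h (i, j + 1) + h (i + 1, j + 1)"
      using le Hs H2[of i j]
      by (intro P) (simp_all add: unit_rhombus_iff level_point_def face_diagonal_def Delta_def algebra_simps)
  qed
next
  assume h: ?r
  show ?l
  proof (intro ballI impI)
    fix x y p q assume mem: "x \<in> Delta N" "y \<in> Delta N" "p \<in> Delta N" "q \<in> Delta N"
      and r: "unit_rhombus (level_point H x) (level_point H y) (level_point H p) (level_point H q)"
    obtain x1 x2 y1 y2 p1 p2 q1 q2 where c: "x = (x1, x2)" "y = (y1, y2)" "p = (p1, p2)" "q = (q1, q2)"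
      by (cases x, cases y, cases p, cases q)
    have "face_diagonal (int q1 - int p1, int q2 - int p2, H (q1 + q2) - H (p1 + p2))"
      using r unfolding unit_rhombus_iff c level_point_def by simp
    note st = face_diagonal_step[OF this]
    have "x \<noteq> y" using r by (auto simp: unit_rhombus_def)
    then have ord: "(x1 + x2 \<ge> y1 + y2 \<and> (x1 + x2 = y1 + y2 \<longrightarrow> x1 > y1)) \<or>
        (y1 + y2 \<ge> x1 + x2 \<and> (y1 + y2 = x1 + x2 \<longrightarrow> y1 > x1))" unfolding c by auto
    note r = r unit_rhombus_swap(1)[OF r] unit_rhombus_swap(2)[OF r]
      unit_rhombus_swap(2)[OF unit_rhombus_swap(1)[OF r]]
    note inst = hive_inequalities_rhombus[OF h]
    show "h x + h y \<le> h p + h q"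
      using st ord inst[OF mem(1,2,3,4)[unfolded c] r(1)[unfolded c]]
        inst[OF mem(2,1,3,4)[unfolded c] r(2)[unfolded c]]
        inst[OF mem(1,2,4,3)[unfolded c] r(3)[unfolded c]]
        inst[OF mem(2,1,4,3)[unfolded c] r(4)[unfolded c]]
      unfolding c add.commute[of "h (y1, y2)"] add.commute[of "h (q1, q2)"] by blast
  qed
qed

section \<open>Phased paths, heights and borders\<close>

lemma concat_replicate_pair:
  "length (concat (replicate m [a, b])) = 2 * m"
  "i < 2 * m \<Longrightarrow> concat (replicate m [a, b]) ! i = (if even i then a else b)"
proof -
  show "length (concat (replicate m [a, b])) = 2 * m" by (induction m) auto
  show "i < 2 * m \<Longrightarrow> concat (replicate m [a, b]) ! i = (if even i then a else b)"
  proof (induction m arbitrary: i)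
    case (Suc m)
    show ?case
    proof (cases "i < 2")
      case True then show ?thesis by (auto simp: less_2_cases_iff)
    next
      case False
      then obtain r where "i = Suc (Suc r)" by (metis add_2_eq_Suc le_Suc_ex not_less)
      then show ?thesis using Suc by simp
    qed
  qed simp
qed

lemma phased_path_pos:
  assumes "1 \<le> k" "k \<le> n"
  shows "length (phased_path n (int k)) = 2 * n"
    and "t < 2 * n \<Longrightarrow> phased_path n (int k) ! t = (if west n k t then West else North)"
proof -
  have P: "phased_path n (int k) =
      replicate k West @ concat (replicate (n - k) [North, West]) @ replicate k North"
    using assms by (simp add: phased_path_def)
  show "length (phased_path n (int k)) = 2 * n"
    unfolding P using assms by (simp add: concat_replicate_pair(1))
  assume t: "t < 2 * n"
  consider "t < k" | "k \<le> t" "t < 2 * n - k" | "2 * n - k \<le> t" "k \<le> t" using assms by linarith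
  then show "phased_path n (int k) ! t = (if west n k t then West else North)"
  proof cases
    case 1 then show ?thesis by (simp add: P nth_append west_def)
  next
    case 2
    then have "t - k < 2 * (n - k)" using assms by linarith
    then show ?thesis using 2
      by (simp add: P nth_append west_def concat_replicate_pair)
  next
    case 3
    then have "\<not> t - k < 2 * (n - k)" "t - k - 2 * (n - k) < k" using assms t by linarith+
    then show ?thesis using 3
      by (simp add: P nth_append west_def concat_replicate_pair(1))
  qed
qed

definition west_count :: "nat \<Rightarrow> nat \<Rightarrow> nat \<Rightarrow> nat" where
  "west_count n k t = (if t \<le> k then t else if t \<le> 2 * n - k then k + (t - k) div 2 else n)"

lemma west_count_Suc:
  assumes "1 \<le> k" "k \<le> n" "t < 2 * n"
  shows "west_count n k (Suc t) = west_count n k t + (if west n k t then 1 else 0)"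
proof -
  consider "t < k" | "k \<le> t" "t < 2 * n - k" | "2 * n - k \<le> t" "k \<le> t" using assms by linarith
  then show ?thesis
  proof cases
    case 1 then show ?thesis by (simp add: west_count_def west_def)
  next
    case 2
    then show ?thesis
      by (cases "even (t - k)") (auto simp: west_count_def west_def Suc_diff_le elim!: evenE oddE)
  next
    case 3
    then have "(t - k) div 2 = n - k" if "t \<le> 2 * n - k" using that assms by auto
    then show ?thesis using 3 assms by (auto simp: west_count_def west_def)
  qed
qed

lemma count_west:
  assumes "1 \<le> k" "k \<le> n" "t \<le> 2 * n"
  shows "count_list (take t (phased_path n (int k))) West = west_count n k t"
    and "count_list (take t (phased_path n (int k))) North = t - west_count n k t"
    and "west_count n k t \<le> t"
proof -
  have "count_list (take t (phased_path n (int k))) West = west_count n k t \<and>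
    count_list (take t (phased_path n (int k))) North + west_count n k t = t"
    using assms(3)
  proof (induction t)
    case 0 then show ?case by (simp add: west_count_def)
  next
    case (Suc t)
    then show ?case
      using phased_path_pos[OF assms(1,2)] west_count_Suc[OF assms(1,2), of t]
      by (simp add: take_Suc_conv_app_nth)
  qed
  then show "count_list (take t (phased_path n (int k))) West = west_count n k t"
    "count_list (take t (phased_path n (int k))) North = t - west_count n k t"
    "west_count n k t \<le> t" by auto
qed

text \<open>
  The heights are indexed from the other end of the path than the shuffled sequences. Reversing \<open>P_k\<close>
  exchanges its two letters, which makes both descriptions fit together.
\<close>

lemma west_reflect:
  assumes "1 \<le> k" "k \<le> n" "t < 2 * n"
  shows "west n k (2 * n - Suc t) \<longleftrightarrow> \<not> west n k t"
proof -
  consider "t < k" | "k \<le> t" "t < 2 * n - k" | "2 * n - k \<le> t" "k \<le> t" using assms by linarith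
  then show ?thesis
  proof cases
    case 2
    obtain j where j: "t = k + j" using 2(1) le_Suc_ex by blast
    have "2 * n - Suc t - k = 2 * (n - k) - Suc j" "Suc j \<le> 2 * (n - k)" using 2 j assms by auto
    then have "even (2 * n - Suc t - k) \<longleftrightarrow> odd j" by simp
    moreover have "2 * n - Suc t < 2 * n - k" "\<not> 2 * n - Suc t < k" using 2 assms by auto
    ultimately show ?thesis using 2 j by (simp add: west_def)
  qed (use assms in \<open>auto simp: west_def\<close>)
qed

text \<open>
  The points on level \<open>t\<close> have the height of the path after \<open>2 n - t\<close> letters.
\<close>

lemma height_step:
  assumes "1 \<le> k" "k \<le> n" "t < 2 * n"
  shows "height (phased_path n (int k)) (2 * n - Suc t) - height (phased_path n (int k)) (2 * n - t) =
    (if west n k t then -1 else 1)"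
proof -
  let ?q = "2 * n - Suc t"
  have q: "2 * n - t = Suc ?q" "?q < 2 * n" using assms by auto
  have "height (phased_path n (int k)) (Suc ?q) = height (phased_path n (int k)) ?q +
      (if west n k ?q then -1 else 1)"
    using q phased_path_pos[OF assms(1,2)] by (simp add: height_def take_Suc_conv_app_nth)
  then show ?thesis unfolding q(1) west_reflect[OF assms] by auto
qed

lemma shuffle_pos:
  assumes "1 \<le> k" "k \<le> n" "length la = n" "length nu = n"
  shows "shuffle n (int k) (map int la) (map int nu) =
    map (interleave n k (row_lengths la) (row_lengths nu)) [0..<2 * n]"
proof -
  let ?P = "phased_path n (int k)"
  have "(if ?P ! p = West then map int la else map int nu) ! count_list (take p ?P) (?P ! p) =
      interleave n k (row_lengths la) (row_lengths nu) p" if p: "p < 2 * n" for p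
  proof -
    consider "p < k" | "k \<le> p" "p < 2 * n - k" "even (p - k)" | "k \<le> p" "p < 2 * n - k" "odd (p - k)"
      | "2 * n - k \<le> p" "k \<le> p" using assms by linarith
    then show ?thesis
    proof cases
      case 1
      then show ?thesis
        using assms p phased_path_pos(2)[OF assms(1,2) p] count_west[OF assms(1,2), of p]
        by (simp add: west_def west_count_def interleave_def row_lengths_def nth_default_def)
    next
      case 2
      obtain r where "p = k + 2 * r" using 2(1,3) by (metis evenE le_add_diff_inverse)
      then have "p - (k + (p - k) div 2) = (p - k) div 2" "(p - k) div 2 < n" using 2(2) by auto
      then show ?thesis
        using 2 assms p phased_path_pos(2)[OF assms(1,2) p] count_west[OF assms(1,2), of p]
        by (auto simp: west_def west_count_def interleave_def row_lengths_def nth_default_def)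
    next
      case 3
      then have "k + (p - k) div 2 < n" by (auto elim!: oddE)
      then show ?thesis
        using 3 assms p phased_path_pos(2)[OF assms(1,2) p] count_west[OF assms(1,2), of p]
        by (auto simp: west_def west_count_def interleave_def row_lengths_def nth_default_def)
    next
      case 4
      then have w: "west_count n k p = n" using assms by (auto simp: west_count_def)
      have "p - n < n" "\<not> p < k" using 4 p assms by auto
      then show ?thesis
        using 4 w assms p phased_path_pos(2)[OF assms(1,2) p] count_west[OF assms(1,2), of p]
        by (auto simp: west_def interleave_def row_lengths_def nth_default_def)
    qed
  qed
  then show ?thesis by (simp add: shuffle_def Let_def)
qed

definition flip :: "step \<Rightarrow> step" where
  "flip s = (case s of North \<Rightarrow> West | West \<Rightarrow> North)"

lemma flip_eq: "flip s = West \<longleftrightarrow> s = North" "flip s = North \<longleftrightarrow> s = West" "s \<noteq> West \<longleftrightarrow> s = North"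
  by (cases s; simp add: flip_def)+

lemma phased_path_minus: "0 < k \<Longrightarrow> phased_path n (- k) = map flip (phased_path n k)"
  by (simp add: phased_path_def Let_def flip_def map_concat)

lemma count_list_flip:
  "count_list (map flip xs) West = count_list xs North" "count_list (map flip xs) North = count_list xs West"
  by (induction xs) (auto simp: flip_eq)

lemma height_minus: "0 < k \<Longrightarrow> height (phased_path n (- k)) t = - height (phased_path n k) t"
  by (simp add: phased_path_minus height_def take_map count_list_flip)

lemma shuffle_minus:
  assumes "0 < k" "length (phased_path n k) = 2 * n"
  shows "shuffle n (- k) a b = shuffle n k b a"
proof -
  let ?P = "phased_path n k"
  have "(if map flip ?P ! p = West then a else b) ! count_list (take p (map flip ?P)) (map flip ?P ! p) =
    (if ?P ! p = West then b else a) ! count_list (take p ?P) (?P ! p)" if "p < 2 * n" for p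
    using that assms(2) by (cases "?P ! p") (auto simp: flip_eq flip_def take_map count_list_flip)
  then show ?thesis by (simp add: shuffle_def Let_def phased_path_minus[OF assms(1)])
qed

lemma unit_rhombus_reflect:
  "unit_rhombus (a1, a2, - a3) (b1, b2, - b3) (c1, c2, - c3) (d1, d2, - d3) =
   unit_rhombus (a1, a2, a3) (b1, b2, b3) (c1, c2, c3) (d1, d2, d3)"
proof -
  have "face_diagonal (x, y, - z - - w) = face_diagonal (x, y, z - w)" for x y z w
    by (auto simp: face_diagonal_def abs_minus_commute)
  then show ?thesis by (simp add: unit_rhombus_iff) linarith
qed

text \<open>
  The path \<open>P_(-k)\<close> is \<open>P_k\<close> with its letters exchanged. This reflects all heights, which preserves unit
  rhombi, and exchanges the arguments of the shuffle.
\<close>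

lemma skew_hives_minus:
  assumes k: "1 \<le> k" "k \<le> n"
  shows "skew_hives n (- int k) la mu nu rh ka = skew_hives n (int k) nu rh la mu ka"
proof -
  have pos: "0 < int k" using k by simp
  have "unit_rhombus (lift n (- int k) x) (lift n (- int k) y) (lift n (- int k) x') (lift n (- int k) y') =
    unit_rhombus (lift n (int k) x) (lift n (int k) y) (lift n (int k) x') (lift n (int k) y')" for x y x' y'
    by (cases x, cases y, cases x', cases y') (simp add: lift_def height_minus[OF pos] unit_rhombus_reflect)
  then show ?thesis
    using shuffle_minus[OF pos phased_path_pos(1)[OF k]] by (simp add: skew_hives_def phased_skew_hive_def)
qed

section \<open>Hives as phased patterns\<close>


text \<open>
  Entry \<open>s\<close> of row \<open>t\<close> is the increase of \<open>h\<close> along step \<open>s\<close> of level \<open>t\<close>. The minimum makes the rows beyond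
  level \<open>N\<close> constant.
\<close>

definition pattern_of_hive :: "nat \<Rightarrow> (nat \<times> nat \<Rightarrow> int) \<Rightarrow> nat \<Rightarrow> nat \<Rightarrow> int" where
  "pattern_of_hive N h t s =
     (let t' = min t N in if s < t' then h (t' - Suc s, Suc s) - h (t' - s, s) else 0)"

definition hive_of_pattern :: "nat \<Rightarrow> (nat \<Rightarrow> int) \<Rightarrow> (nat \<Rightarrow> nat \<Rightarrow> int) \<Rightarrow> nat \<times> nat \<Rightarrow> int" where
  "hive_of_pattern N R a =
     (\<lambda>(i, j). if i + j \<le> N then (\<Sum>t<i + j. R t) + (\<Sum>s<j. a (i + j) s) else undefined)"

text \<open>
  The hive is recovered by walking along the horizontal border to level \<open>i + j\<close>, and then along this level.
\<close>

definition hive_represents :: "nat \<Rightarrow> (nat \<Rightarrow> int) \<Rightarrow> (nat \<times> nat \<Rightarrow> int) \<Rightarrow> (nat \<Rightarrow> nat \<Rightarrow> int) \<Rightarrow> bool" where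
  "hive_represents N R h a \<longleftrightarrow>
     (\<forall>i j. i + j \<le> N \<longrightarrow> h (i, j) = (\<Sum>t<i + j. R t) + (\<Sum>s<j. a (i + j) s)) \<and>
     (\<forall>t\<le>N. \<forall>s\<ge>t. a t s = 0)"

lemma hive_increments:
  assumes "hive_represents N R h a" "i + j < N"
  shows "h (i + 1, j) - h (i, j) = R (i + j) + (\<Sum>s<j. a (Suc (i + j)) s - a (i + j) s)"
    and "h (i, j + 1) - h (i, j) =
      R (i + j) + (\<Sum>s<j. a (Suc (i + j)) s - a (i + j) s) + a (Suc (i + j)) j"
  using assms by (simp_all add: hive_represents_def sum_subtractf)

lemma hive_level_step:
  assumes "hive_represents N R h a" "i + j < N"
  shows "h (i, j + 1) - h (i + 1, j) = a (Suc (i + j)) j"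
  using hive_increments[OF assms] by simp

text \<open>
  The rhombi relate only the \<open>t\<close> entries of row \<open>t\<close> to those of row \<open>t + 1\<close>. What interlacing requires
  beyond this is that the last entry of every row be nonnegative, and this descends from row \<open>N\<close>.
\<close>

lemma hive_strip_inequalities_iff:
  assumes rep: "hive_represents N R h a" and top: "\<And>s. 0 \<le> a N s"
  shows "(\<forall>i j. i + j + 2 \<le> N \<longrightarrow> h (i + 2, j) + h (i, j + 1) \<le> h (i + 1, j) + h (i + 1, j + 1)) \<and>
     (\<forall>i j. i + j + 2 \<le> N \<longrightarrow> h (i, j + 2) + h (i + 1, j) \<le> h (i, j + 1) + h (i + 1, j + 1)) \<longleftrightarrow>
     (\<forall>t<N. interlaces (a t) (a (Suc t)))" (is "?l \<longleftrightarrow> ?r")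
proof -
  have S: "h (i + 2, j) + h (i, j + 1) \<le> h (i + 1, j) + h (i + 1, j + 1) \<longleftrightarrow>
        a (i + j + 1) j \<le> a (i + j + 2) j"
      "h (i, j + 2) + h (i + 1, j) \<le> h (i, j + 1) + h (i + 1, j + 1) \<longleftrightarrow>
        a (i + j + 2) (j + 1) \<le> a (i + j + 1) j" if "i + j + 2 \<le> N" for i j
    using hive_level_step[OF rep, of i j] hive_level_step[OF rep, of "i + 1" j]
      hive_level_step[OF rep, of i "j + 1"] that by auto
  have zero: "a t s = 0" if "t \<le> N" "t \<le> s" for t s
    using rep that by (simp add: hive_represents_def)
  show ?thesis
  proof
    assume ?l
    then have le: "a t j \<le> a (Suc t) j" "a (Suc t) (Suc j) \<le> a t j" if "t < N" "j < t" for t j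
    proof -
      have e: "t - Suc j + j + 1 = t" "t - Suc j + j + 2 = Suc t" "t - Suc j + j + 2 \<le> N"
        using that by auto
      have "a (t - Suc j + j + 1) j \<le> a (t - Suc j + j + 2) j"
        "a (t - Suc j + j + 2) (j + 1) \<le> a (t - Suc j + j + 1) j"
        using S[OF e(3)] \<open>?l\<close> e(3) by blast+
      then show "a t j \<le> a (Suc t) j" "a (Suc t) (Suc j) \<le> a t j" unfolding e(1,2) by simp_all
    qed
    \<comment> \<open>the last entries of the rows decrease with \<open>t\<close>\<close>
    have last: "0 \<le> a (Suc t) t" if "Suc t \<le> N" for t
    proof -
      have "0 \<le> a t' (t' - 1)" if "1 \<le> t'" "t' \<le> N" for t'
        using that(2,1)
      proof (induction t' rule: inc_induct)
        case base then show ?case using top by simp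
      next
        case (step r)
        then show ?case using le(2)[of r "r - 1"] by simp
      qed
      from this[of "Suc t"] show ?thesis using that by simp
    qed
    show ?r unfolding interlaces_def
    proof (intro allI impI conjI)
      fix t s assume t: "t < N"
      show "a (Suc t) (Suc s) \<le> a t s"
        using le(2)[OF t, of s] zero[of t s] zero[of "Suc t" "Suc s"] t by (cases "s < t") auto
      show "a t s \<le> a (Suc t) s"
      proof (cases "s < t")
        case True then show ?thesis using le(1)[OF t] by blast
      next
        case False
        then have "a t s = 0" using zero t by simp
        moreover have "0 \<le> a (Suc t) s" using last[of t] zero[of "Suc t" s] False t by (cases "s = t") auto
        ultimately show ?thesis by simp
      qed
    qed
  next
    assume r: ?r
    then have "a (i + j + 1) j \<le> a (i + j + 2) j" "a (i + j + 2) (j + 1) \<le> a (i + j + 1) j"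
      if "i + j + 2 \<le> N" for i j
      using that by (auto simp: interlaces_def)
    then show ?l using S by auto
  qed
qed

text \<open>
  The rhombi provide the ballot inequalities only for the rows \<open>j \<le> m\<close>. In the lower rows all boxes of the
  first strip have been counted, and the inequality follows from \<open>U\<close> being weakly decreasing along the
  rows of a shape.
\<close>

lemma hive_phase_inequalities_iff:
  assumes rep: "hive_represents N R h a"
    and int: "\<And>t. t < N \<Longrightarrow> interlaces (a t) (a (Suc t))"
    and wt: "\<And>t. t < N \<Longrightarrow> weight N (a (Suc t)) - weight N (a t) = U t - R t"
  shows "m + 2 \<le> N \<Longrightarrow> U (Suc m) \<le> U m \<Longrightarrow>
      (\<forall>i j. i + j = m \<longrightarrow> h (i, j) + h (i + 1, j + 1) \<le> h (i + 1, j) + h (i, j + 1)) \<longleftrightarrow>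
      ballot (R m - R (Suc m)) (a m) (a (Suc m)) (a (m + 2))"
    and "m + 3 \<le> N \<Longrightarrow> U (m + 2) \<le> U m \<Longrightarrow>
      (\<forall>i j. i + j = m \<longrightarrow> h (i, j) + h (i + 2, j + 1) \<le> h (i + 1, j) + h (i + 1, j + 1) \<and>
         h (i, j) + h (i + 1, j + 2) \<le> h (i, j + 1) + h (i + 1, j + 1)) \<longleftrightarrow>
      spread_ballot (R m - R (m + 2)) (a m) (a (Suc m)) (a (m + 2)) (a (m + 3))"
proof -
  define d where "d t j = (\<Sum>s<j. a (Suc t) s - a t s)" for t j
  have d_Suc: "d t (Suc j) = d t j + a (Suc t) j - a t j" for t j by (simp add: d_def)
  have d_atMost: "(\<Sum>s\<le>j. a (Suc t) s - a t s) = d t (Suc j)" for t j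
    by (simp add: d_def lessThan_Suc_atMost)
  have right: "h (i + 1, j) - h (i, j) = R (i + j) + d (i + j) j"
    and up: "h (i, j + 1) - h (i, j) = R (i + j) + d (i + j) j + a (Suc (i + j)) j"
    if "i + j < N" for i j using hive_increments[OF rep that] by (simp_all add: d_def)
  have zero: "a t s = 0" if "t \<le> N" "t \<le> s" for t s
    using rep that by (simp add: hive_represents_def)
  have mono: "d t j \<le> d t j'" if "t < N" "j \<le> j'" for t j j'
    unfolding d_def using int[OF that(1)] that(2)
    by (intro sum_mono2) (auto simp: interlaces_def)
  have total: "d t j = U t - R t" if "t < N" "Suc t \<le> j" for t j
  proof -
    have "d t j = (\<Sum>s<N. a (Suc t) s - a t s)"
      unfolding d_def using zero that by (intro sum_lessThan_support) auto
    then show ?thesis using wt[OF that(1)] by (simp add: weight_def sum_subtractf)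
  qed
  have le_total: "d t j \<le> U t - R t" if "t < N" for t j
    using mono[OF that, of j "max j (Suc t)"] total[OF that, of "max j (Suc t)"] by simp
  show "(\<forall>i j. i + j = m \<longrightarrow> h (i, j) + h (i + 1, j + 1) \<le> h (i + 1, j) + h (i, j + 1)) \<longleftrightarrow>
      ballot (R m - R (Suc m)) (a m) (a (Suc m)) (a (m + 2))"
    if m: "m + 2 \<le> N" and U: "U (Suc m) \<le> U m"
  proof -
    have eq: "h (i, j) + h (i + 1, j + 1) \<le> h (i + 1, j) + h (i, j + 1) \<longleftrightarrow>
        d (Suc m) (Suc j) \<le> R m - R (Suc m) + d m j" if "i + j = m" for i j
      using up[of i j] up[of "i + 1" j] that m d_Suc[of "Suc m" j] by auto
    have out: "d (Suc m) (Suc j) \<le> R m - R (Suc m) + d m j" if "m < j" for j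
      using le_total[of "Suc m" "Suc j"] total[of m j] that m U by simp
    have "ballot (R m - R (Suc m)) (a m) (a (Suc m)) (a (m + 2)) \<longleftrightarrow>
        (\<forall>j. d (Suc m) (Suc j) \<le> R m - R (Suc m) + d m j)"
      using d_atMost[of "Suc m"] by (simp add: ballot_def d_def[of m])
    also have "\<dots> \<longleftrightarrow> (\<forall>j\<le>m. d (Suc m) (Suc j) \<le> R m - R (Suc m) + d m j)"
      using out not_less by blast
    also have "\<dots> \<longleftrightarrow> (\<forall>i j. i + j = m \<longrightarrow> d (Suc m) (Suc j) \<le> R m - R (Suc m) + d m j)"
      by (metis le_add2 le_add_diff_inverse2)
    finally show ?thesis using eq by blast
  qed
  show "(\<forall>i j. i + j = m \<longrightarrow> h (i, j) + h (i + 2, j + 1) \<le> h (i + 1, j) + h (i + 1, j + 1) \<and>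
         h (i, j) + h (i + 1, j + 2) \<le> h (i, j + 1) + h (i + 1, j + 1)) \<longleftrightarrow>
      spread_ballot (R m - R (m + 2)) (a m) (a (Suc m)) (a (m + 2)) (a (m + 3))"
    if m: "m + 3 \<le> N" and U: "U (m + 2) \<le> U m"
  proof -
    let ?P = "\<lambda>j. d (m + 2) (Suc j) \<le> R m - R (m + 2) + d m j"
    let ?Q = "\<lambda>j. d (m + 2) (Suc (Suc j)) \<le> R m - R (m + 2) + d m (Suc j) + a m j - a (m + 2) (Suc j)"
    have eq1: "h (i, j) + h (i + 2, j + 1) \<le> h (i + 1, j) + h (i + 1, j + 1) \<longleftrightarrow> ?P j"
      and eq2: "h (i, j) + h (i + 1, j + 2) \<le> h (i, j + 1) + h (i + 1, j + 1) \<longleftrightarrow> ?Q j"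
      if ij: "i + j = m" for i j
    proof -
      have "h (i + 1, j) - h (i, j) = R m + d m j" using right[of i j] ij m by simp
      moreover have "h (i + 2, j + 1) - h (i + 1, j + 1) = R (m + 2) + d (m + 2) (Suc j)"
        using right[of "i + 1" "j + 1"] ij m by simp
      ultimately show "h (i, j) + h (i + 2, j + 1) \<le> h (i + 1, j) + h (i + 1, j + 1) \<longleftrightarrow> ?P j"
        by linarith
      have "h (i, j + 1) - h (i, j) = R m + d m j + a (Suc m) j" using up[of i j] ij m by simp
      moreover have "h (i + 1, j + 2) - h (i + 1, j + 1) =
          R (m + 2) + d (m + 2) (Suc j) + a (Suc (m + 2)) (Suc j)"
        using up[of "i + 1" "j + 1"] ij m by simp
      ultimately show "h (i, j) + h (i + 1, j + 2) \<le> h (i, j + 1) + h (i + 1, j + 1) \<longleftrightarrow> ?Q j"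
        using d_Suc[of m j] d_Suc[of "m + 2" "Suc j"] by linarith
    qed
    have out: "?P j" "?Q j" if "m < j" for j
    proof -
      show "?P j" using le_total[of "m + 2" "Suc j"] total[of m j] that m U by simp
      show "?Q j" using le_total[of "m + 2" "Suc (Suc j)"] total[of m "Suc j"] that m U
          zero[of m j] zero[of "m + 2" "Suc j"] by simp
    qed
    have s: "Suc (m + 2) = m + 3" by simp
    have "spread_ballot (R m - R (m + 2)) (a m) (a (Suc m)) (a (m + 2)) (a (m + 3)) \<longleftrightarrow>
        (\<forall>j. ?P j) \<and> (\<forall>j. ?Q j)"
      unfolding spread_ballot_def s[symmetric] d_atMost by (simp only: d_def[of m, symmetric])
    also have "\<dots> \<longleftrightarrow> (\<forall>j\<le>m. ?P j \<and> ?Q j)"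
      using out not_less by blast
    also have "\<dots> \<longleftrightarrow> (\<forall>i j. i + j = m \<longrightarrow> ?P j \<and> ?Q j)"
      by (metis le_add2 le_add_diff_inverse2)
    finally show ?thesis using eq1 eq2 by blast
  qed
qed

lemma phased_skew_hive_iff:
  assumes k: "1 \<le> k" "k \<le> n"
  shows "phased_skew_hive n (int k) h \<longleftrightarrow> h \<in> extensional (Delta (2 * n)) \<and>
    hive_inequalities (2 * n) (\<lambda>t. height (phased_path n (int k)) (2 * n - t)) h"
proof -
  let ?H = "\<lambda>t. height (phased_path n (int k)) (2 * n - t)"
  have "lift n (int k) = level_point ?H"
    by (auto simp: fun_eq_iff lift_def level_point_def)
  moreover have "\<bar>?H (Suc t) - ?H t\<bar> = 1" if "t < 2 * n" for t
    unfolding height_step[OF k that] by simp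
  ultimately show ?thesis using rhombus_condition_iff[of "2 * n" ?H h] by (simp add: phased_skew_hive_def)
qed

lemma height_conditions:
  fixes n k :: nat
  defines "H \<equiv> \<lambda>t. height (phased_path n (int k)) (2 * n - t)"
  assumes k: "1 \<le> k" "k \<le> n"
  shows "t + 2 \<le> 2 * n \<Longrightarrow> H t + H (t + 2) = 2 * H (t + 1) \<longleftrightarrow> west n k t = west n k (Suc t)"
    and "t + 3 \<le> 2 * n \<Longrightarrow> H t = H (t + 2) \<and> H (t + 1) = H (t + 3) \<longleftrightarrow>
      west n k t \<noteq> west n k (Suc t) \<and> west n k (Suc t) \<noteq> west n k (t + 2)"
proof -
  have st: "H (Suc t) = H t + (if west n k t then -1 else 1)" if "t < 2 * n" for t
    using height_step[OF k that] by (simp add: H_def)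
  show "H t + H (t + 2) = 2 * H (t + 1) \<longleftrightarrow> west n k t = west n k (Suc t)" if "t + 2 \<le> 2 * n"
    using st[of t] st[of "Suc t"] that by simp
  show "H t = H (t + 2) \<and> H (t + 1) = H (t + 3) \<longleftrightarrow>
      west n k t \<noteq> west n k (Suc t) \<and> west n k (Suc t) \<noteq> west n k (t + 2)" if "t + 3 \<le> 2 * n"
    using st[of t] st[of "Suc t"] st[of "Suc (Suc t)"] that by (simp add: numeral_3_eq_3)
qed

lemma interleave_dominance:
  assumes k: "1 \<le> k" "k \<le> n" and x: "\<And>i. x (Suc i) \<le> x i" and y: "\<And>i. y (Suc i) \<le> y i"
  shows "west n k t = west n k (Suc t) \<Longrightarrow> interleave n k x y (Suc t) \<le> interleave n k x y t"
    and "west n k t \<noteq> west n k (Suc t) \<Longrightarrow> west n k (Suc t) \<noteq> west n k (t + 2) \<Longrightarrow>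
      interleave n k x y (t + 2) \<le> interleave n k x y t"
proof -
  show "interleave n k x y (Suc t) \<le> interleave n k x y t" if w: "west n k t = west n k (Suc t)"
  proof -
    consider "Suc t < k" | "2 * n - k \<le> t" using w unfolding west_Suc_iff[OF k] by blast
    then show ?thesis
    proof cases
      case 2
      then have "Suc t - n = Suc (t - n)" "\<not> t < k" using k by linarith+
      then show ?thesis using 2 k y by (simp add: interleave_def)
    qed (simp add: interleave_def x)
  qed
  show "interleave n k x y (t + 2) \<le> interleave n k x y t"
    if "west n k t \<noteq> west n k (Suc t)" "west n k (Suc t) \<noteq> west n k (t + 2)"
  proof -
    have t: "k \<le> Suc t" "t + 2 < 2 * n - k \<or> t + 2 = 2 * n - k"
      using that west_Suc_iff[OF k, of t] west_Suc_iff[OF k, of "Suc t"] by auto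
    show ?thesis
    proof (cases "Suc t = k")
      case True
      have "t + 2 < 2 * n - k"
      proof (rule ccontr)
        assume "\<not> t + 2 < 2 * n - k"
        then have "2 * k + 1 = 2 * n" using t True by linarith
        then show False by presburger
      qed
      then show ?thesis using True x[of t] by (auto simp: interleave_def)
    next
      case False
      then have kt: "k \<le> t" using t by simp
      have d: "t + 2 - k = Suc (Suc (t - k))" using kt by simp
      show ?thesis
      proof (cases "t + 2 = 2 * n - k")
        case True
        then have "t = k + 2 * (n - k - 1) \<and> n = k + Suc (n - k - 1)" using kt k by arith
        then obtain D where "t = k + 2 * D" "n = k + Suc D" by blast
        then show ?thesis using y by (simp add: interleave_def)
      next
        case False
        then show ?thesis using t kt x y d by (simp add: interleave_def)
      qed
    qed
  qed
qed

text \<open>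
  The difference of the sums of two neighbouring rows is the difference of the steps on the two borders, so
  the vertical border prescribes the content of the pattern.
\<close>

lemma hive_iff_phased_pattern:
  assumes k: "1 \<le> k" "k \<le> n" and U: "U = interleave n k x y"
    and x: "\<And>i. x (Suc i) \<le> x i" and y: "\<And>i. y (Suc i) \<le> y i"
    and rep: "hive_represents (2 * n) R h a" and top: "\<And>t. 2 * n \<le> t \<Longrightarrow> a t = z" and z: "\<And>s. 0 \<le> z s"
  shows "hive_inequalities (2 * n) (\<lambda>t. height (phased_path n (int k)) (2 * n - t)) h \<and>
      (\<forall>t<2 * n. h (0, t + 1) - h (0, t) = U t) \<longleftrightarrow> a \<in> phased_patterns n k R U z"
proof -
  let ?N = "2 * n" and ?H = "\<lambda>t. height (phased_path n (int k)) (2 * n - t)"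
  have zero: "a t s = 0" if "t \<le> ?N" "t \<le> s" for t s
    using rep that by (simp add: hive_represents_def)
  have w: "weight ?N (a t) = (\<Sum>s<t. a t s)" if "t \<le> ?N" for t
    unfolding weight_def using zero that by (intro sum_lessThan_support) auto
  have up: "(\<forall>t<?N. h (0, t + 1) - h (0, t) = U t) \<longleftrightarrow>
      (\<forall>t<?N. weight ?N (a (Suc t)) - weight ?N (a t) = U t - R t)"
    using w rep by (auto simp: hive_represents_def)
  have a0: "a 0 = (\<lambda>_. 0)" using zero by auto
  have strips: "(\<forall>i j. i + j + 2 \<le> ?N \<longrightarrow> h (i + 2, j) + h (i, j + 1) \<le> h (i + 1, j) + h (i + 1, j + 1)) \<and>
     (\<forall>i j. i + j + 2 \<le> ?N \<longrightarrow> h (i, j + 2) + h (i + 1, j) \<le> h (i, j + 1) + h (i + 1, j + 1)) \<longleftrightarrow>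
     (\<forall>t<?N. interlaces (a t) (a (Suc t)))"
    using z top[of ?N] by (intro hive_strip_inequalities_iff[OF rep]) simp
  let ?X = "\<lambda>i j. h (i, j) + h (i + 1, j + 1) \<le> h (i + 1, j) + h (i, j + 1)"
  let ?Y = "\<lambda>i j. h (i, j) + h (i + 2, j + 1) \<le> h (i + 1, j) + h (i + 1, j + 1) \<and>
        h (i, j) + h (i + 1, j + 2) \<le> h (i, j + 1) + h (i + 1, j + 1)"
  have phase: "(\<forall>i j. i + j + 2 \<le> ?N \<and> ?H (i + j) + ?H (i + j + 2) = 2 * ?H (i + j + 1) \<longrightarrow> ?X i j) \<and>
      (\<forall>i j. i + j + 3 \<le> ?N \<and> ?H (i + j) = ?H (i + j + 2) \<and> ?H (i + j + 1) = ?H (i + j + 3) \<longrightarrow> ?Y i j) \<longleftrightarrow>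
      phase_conditions n k R a"
    if int: "\<And>t. t < ?N \<Longrightarrow> interlaces (a t) (a (Suc t))"
      and wt: "\<And>t. t < ?N \<Longrightarrow> weight ?N (a (Suc t)) - weight ?N (a t) = U t - R t"
  proof -
    have "(\<forall>i j. i + j + 2 \<le> ?N \<and> ?H (i + j) + ?H (i + j + 2) = 2 * ?H (i + j + 1) \<longrightarrow> ?X i j) \<longleftrightarrow>
        (\<forall>m. m + 2 \<le> ?N \<and> west n k m = west n k (Suc m) \<longrightarrow> (\<forall>i j. i + j = m \<longrightarrow> ?X i j))"
      using height_conditions(1)[OF k] by blast
    also have "\<dots> \<longleftrightarrow> (\<forall>m. m + 2 \<le> ?N \<and> west n k m = west n k (Suc m) \<longrightarrow>
        ballot (R m - R (Suc m)) (a m) (a (Suc m)) (a (m + 2)))"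
      using hive_phase_inequalities_iff(1)[OF rep int wt] interleave_dominance(1)[where x = x and y = y, OF k x y]
      unfolding U by (smt (verit, best))
    finally have 1: "(\<forall>i j. i + j + 2 \<le> ?N \<and> ?H (i + j) + ?H (i + j + 2) = 2 * ?H (i + j + 1) \<longrightarrow> ?X i j) \<longleftrightarrow>
      (\<forall>m. m + 2 \<le> ?N \<and> west n k m = west n k (Suc m) \<longrightarrow>
        ballot (R m - R (Suc m)) (a m) (a (Suc m)) (a (m + 2)))" .
    have "(\<forall>i j. i + j + 3 \<le> ?N \<and> ?H (i + j) = ?H (i + j + 2) \<and> ?H (i + j + 1) = ?H (i + j + 3) \<longrightarrow> ?Y i j) \<longleftrightarrow>
        (\<forall>m. m + 3 \<le> ?N \<and> west n k m \<noteq> west n k (Suc m) \<and> west n k (Suc m) \<noteq> west n k (m + 2) \<longrightarrow>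
          (\<forall>i j. i + j = m \<longrightarrow> ?Y i j))"
      using height_conditions(2)[OF k] by blast
    also have "\<dots> \<longleftrightarrow> (\<forall>m. m + 3 \<le> ?N \<and> west n k m \<noteq> west n k (Suc m) \<and> west n k (Suc m) \<noteq> west n k (m + 2) \<longrightarrow>
        spread_ballot (R m - R (m + 2)) (a m) (a (Suc m)) (a (m + 2)) (a (m + 3)))"
      using hive_phase_inequalities_iff(2)[OF rep int wt] interleave_dominance(2)[where x = x and y = y, OF k x y]
      unfolding U by (smt (verit, best))
    finally show ?thesis unfolding 1 phase_conditions_def by blast
  qed
  show ?thesis
    unfolding hive_inequalities_def phased_patterns_def gt_patterns_def up mem_Collect_eq
    using strips phase a0 top by blast
qed

lemma pattern_of_hive_represents:
  assumes "h (0, 0) = 0" and right: "\<And>t. t < N \<Longrightarrow> h (t + 1, 0) - h (t, 0) = R t"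
  shows "hive_represents N R h (pattern_of_hive N h)"
proof -
  have base: "h (t, 0) = (\<Sum>p<t. R p)" if "t \<le> N" for t
    using that by (induction t) (use assms in \<open>auto simp: algebra_simps\<close>)
  have "h (i, j) = (\<Sum>t<i + j. R t) + (\<Sum>s<j. pattern_of_hive N h (i + j) s)" if ij: "i + j \<le> N" for i j
  proof -
    have "(\<Sum>s<j. pattern_of_hive N h (i + j) s) = (\<Sum>s<j. h (i + j - Suc s, Suc s) - h (i + j - s, s))"
      using ij by (intro sum.cong) (auto simp: pattern_of_hive_def Let_def)
    also have "\<dots> = h (i + j - j, j) - h (i + j - 0, 0)" by (rule sum_lessThan_telescope)
    finally show ?thesis using base[OF ij] by simp
  qed
  moreover have "pattern_of_hive N h t s = 0" if "t \<le> s" for t s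
    using that by (simp add: pattern_of_hive_def Let_def)
  ultimately show ?thesis unfolding hive_represents_def by blast
qed

lemma hive_of_pattern_represents:
  "(\<And>t s. t \<le> N \<Longrightarrow> t \<le> s \<Longrightarrow> a t s = 0) \<Longrightarrow> hive_represents N R (hive_of_pattern N R a) a"
  by (simp add: hive_represents_def hive_of_pattern_def)

theorem bij_betw_skew_hives_phased_patterns:
  assumes k: "1 \<le> k" "k \<le> n" and la: "is_partition n la" and mu: "is_partition n mu"
    and nu: "is_partition n nu" and rh: "is_partition n rh" and ka: "is_partition (2 * n) ka"
  shows "bij_betw (pattern_of_hive (2 * n)) (skew_hives n (int k) la mu nu rh ka)
    (phased_patterns n k (interleave n k (row_lengths mu) (row_lengths rh))
      (interleave n k (row_lengths la) (row_lengths nu)) (row_lengths ka))"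
proof -
  let ?N = "2 * n"
  let ?R = "interleave n k (row_lengths mu) (row_lengths rh)"
  let ?U = "interleave n k (row_lengths la) (row_lengths nu)"
  let ?z = "row_lengths ka"
  let ?H = "\<lambda>t. height (phased_path n (int k)) (2 * n - t)"
  have len: "length la = n" "length mu = n" "length nu = n" "length rh = n" "length ka = ?N"
    using la mu nu rh ka by (simp_all add: is_partition_def)
  have z: "?z s = 0" if "?N \<le> s" for s using partition_row_lengths(2)[OF ka that] .
  have hive: "h \<in> skew_hives n (int k) la mu nu rh ka \<longleftrightarrow>
      h \<in> extensional (Delta ?N) \<and> hive_inequalities ?N ?H h \<and> h (0, 0) = 0 \<and>
      (\<forall>t<?N. h (0, t + 1) - h (0, t) = ?U t) \<and> (\<forall>t<?N. h (t + 1, 0) - h (t, 0) = ?R t) \<and>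
      (\<forall>t<?N. h (?N - (t + 1), t + 1) - h (?N - t, t) = ?z t)" for h
  proof -
    have "map int ka = map ?z [0..<?N]"
      using len by (intro nth_equalityI) (auto simp: row_lengths_def nth_default_def)
    then show ?thesis
      using shuffle_pos[OF k len(1,3)] shuffle_pos[OF k len(2,4)] phased_skew_hive_iff[OF k]
      by (auto simp: skew_hives_def border_up_def border_right_def border_nw_def)
  qed
  have equiv: "hive_inequalities ?N ?H h \<and> (\<forall>t<?N. h (0, t + 1) - h (0, t) = ?U t) \<longleftrightarrow>
      a \<in> phased_patterns n k ?R ?U ?z"
    if "hive_represents ?N ?R h a" "\<And>t. ?N \<le> t \<Longrightarrow> a t = ?z" for h a
    by (rule hive_iff_phased_pattern[OF k refl _ _ that])
      (simp_all add: partition_row_lengths[OF la] partition_row_lengths[OF nu] partition_row_lengths[OF ka])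
  show ?thesis
  proof (rule bij_betw_byWitness[where f' = "hive_of_pattern ?N ?R"])
    have rep: "hive_represents ?N ?R h (pattern_of_hive ?N h)"
      if "h \<in> skew_hives n (int k) la mu nu rh ka" for h
      using that unfolding hive by (intro pattern_of_hive_represents) auto
    show "\<forall>h\<in>skew_hives n (int k) la mu nu rh ka. hive_of_pattern ?N ?R (pattern_of_hive ?N h) = h"
    proof (intro ballI ext)
      fix h and p :: "nat \<times> nat" assume h: "h \<in> skew_hives n (int k) la mu nu rh ka"
      obtain i j where p: "p = (i, j)" by (cases p)
      have "h \<in> extensional (Delta ?N)" using h unfolding hive by blast
      then show "hive_of_pattern ?N ?R (pattern_of_hive ?N h) p = h p"
        using rep[OF h] by (auto simp: p hive_of_pattern_def hive_represents_def extensional_def Delta_def)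
    qed
    show "pattern_of_hive ?N ` skew_hives n (int k) la mu nu rh ka \<subseteq> phased_patterns n k ?R ?U ?z"
    proof (rule image_subsetI)
      fix h assume h: "h \<in> skew_hives n (int k) la mu nu rh ka"
      have "pattern_of_hive ?N h t = ?z" if "?N \<le> t" for t
      proof
        fix s show "pattern_of_hive ?N h t s = ?z s"
          using that h z[of s] unfolding hive by (auto simp: pattern_of_hive_def min_def Let_def)
      qed
      then show "pattern_of_hive ?N h \<in> phased_patterns n k ?R ?U ?z"
        using equiv[OF rep[OF h]] h unfolding hive by blast
    qed
    have rep': "hive_represents ?N ?R (hive_of_pattern ?N ?R a) a" "\<And>t. ?N \<le> t \<Longrightarrow> a t = ?z"
      if "a \<in> phased_patterns n k ?R ?U ?z" for a
    proof -
      have g: "a \<in> gt_patterns ?N (\<lambda>t. ?U t - ?R t) ?z" using that by (simp add: phased_patterns_def)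
      show "hive_represents ?N ?R (hive_of_pattern ?N ?R a) a"
        using gt_pattern_zero[OF g] by (intro hive_of_pattern_represents) auto
      show "\<And>t. ?N \<le> t \<Longrightarrow> a t = ?z" using g by (simp add: gt_patterns_def)
    qed
    show "\<forall>a\<in>phased_patterns n k ?R ?U ?z. pattern_of_hive ?N (hive_of_pattern ?N ?R a) = a"
    proof (intro ballI ext)
      fix a t s assume a: "a \<in> phased_patterns n k ?R ?U ?z"
      have "a t = a (min t ?N)" using rep'(2)[OF a] by (simp add: min_def)
      moreover have "pattern_of_hive ?N (hive_of_pattern ?N ?R a) t s = a (min t ?N) s"
        using rep'(1)[OF a] by (auto simp: pattern_of_hive_def hive_represents_def Let_def)
      ultimately show "pattern_of_hive ?N (hive_of_pattern ?N ?R a) t s = a t s" by simp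
    qed
    show "hive_of_pattern ?N ?R ` phased_patterns n k ?R ?U ?z \<subseteq> skew_hives n (int k) la mu nu rh ka"
    proof (rule image_subsetI)
      fix a assume a: "a \<in> phased_patterns n k ?R ?U ?z"
      let ?h = "hive_of_pattern ?N ?R a"
      have "?h \<in> extensional (Delta ?N)" by (auto simp: extensional_def Delta_def hive_of_pattern_def)
      moreover have "?h (0, 0) = 0" "\<forall>t<?N. ?h (t + 1, 0) - ?h (t, 0) = ?R t"
        by (simp_all add: hive_of_pattern_def)
      moreover have "?h (?N - (t + 1), t + 1) - ?h (?N - t, t) = ?z t" if "t < ?N" for t
        using that rep'(2)[OF a, of ?N] by (simp add: hive_of_pattern_def)
      ultimately show "?h \<in> skew_hives n (int k) la mu nu rh ka"
        using equiv[OF rep'[OF a]] a unfolding hive by blast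
    qed
  qed
qed

lemma skew_hives_count_pos:
  assumes n: "n \<ge> 1" and k: "1 \<le> k" "k \<le> n" and la: "is_partition n la" and mu: "is_partition n mu"
    and nu: "is_partition n nu" and rh: "is_partition n rh" and ka: "is_partition (2 * n) ka"
  shows "finite (skew_hives n (int k) la mu nu rh ka) \<and>
    schur_coeff (series_mult (skew_schur la mu) (skew_schur nu rh)) ka =
      int (card (skew_hives n (int k) la mu nu rh ka))"
proof -
  note bij = bij_betw_skew_hives_phased_patterns[OF k la mu nu rh ka]
  have "finite (skew_hives n (int k) la mu nu rh ka)"
    using bij_betw_finite[OF bij] finite_gt_patterns by (simp add: phased_patterns_def)
  then show ?thesis
    using bij_betw_same_card[OF bij] card_phased_patterns[OF k]
      schur_coeff_product_eq_ballot_patterns[OF n la mu nu rh ka] by simp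
qed

lemma series_mult_commute: "series_mult f g = series_mult g f"
proof
  fix M :: "nat multiset"
  show "series_mult f g M = series_mult g f M"
    unfolding series_mult_def
  proof (rule sum.reindex_bij_witness[where i = "\<lambda>A. M - A" and j = "\<lambda>A. M - A"])
    have inv: "M - (M - A) = A" if "A \<in> {A. A \<subseteq># M}" for A
      using that by (intro multiset_eqI) (simp add: mset_subset_eq_count)
    fix A assume A: "A \<in> {A. A \<subseteq># M}"
    show "M - (M - A) = A" "M - (M - A) = A" by (rule inv[OF A])+
    show "M - A \<in> {A. A \<subseteq># M}" "M - A \<in> {A. A \<subseteq># M}" by auto
    show "g (M - A) * f (M - (M - A)) = f A * g (M - A)" by (simp add: inv[OF A])
  qed
qed

theorem theorem5p13:
  fixes n :: nat and k :: int and la mu nu rh ka :: "nat list"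
  assumes "n \<ge> 1"
    and "is_partition n la" and "is_partition n mu"
    and "is_partition n nu" and "is_partition n rh"
    and "is_partition (2 * n) ka"
    and "1 \<le> \<bar>k\<bar>" and "\<bar>k\<bar> \<le> int n"
  shows "finite (skew_hives n k la mu nu rh ka) \<and>
    schur_coeff (series_mult (skew_schur la mu) (skew_schur nu rh)) ka =
      int (card (skew_hives n k la mu nu rh ka))"
proof -
  define m where "m = nat \<bar>k\<bar>"
  have m: "1 \<le> m" "m \<le> n" using assms(7,8) by (simp_all add: m_def)
  show ?thesis
  proof (cases "k > 0")
    case True
    then have "k = int m" by (simp add: m_def)
    then show ?thesis using skew_hives_count_pos[OF assms(1) m assms(2-6)] by simp
  next
    case False
    then have "k = - int m" by (simp add: m_def)
    then show ?thesis
      using skew_hives_count_pos[OF assms(1) m assms(4,5,2,3,6)] skew_hives_minus[OF m]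
      by (simp add: series_mult_commute[of "skew_schur la mu"])
  qed
qed

end
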